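(* Let $X=\mathbb{P}(L\oplus\mathcal{O})$ be the minimal ruled surface over a genus $2$ Riemann surface $\Sigma$, where $L\to\Sigma$ is a holomorphic line bundle of degree $-1$. For $a,b>0$ consider the normalized Kähler classes $\Omega_a:=2\pi(\mathrm{C}+aD_\infty)$ and $\Omega_b:=2\pi(\mathrm{C}+bD_\infty)$ on $X$. Then for every fixed $a>0$ there exists $K(a)>0$ such that for all $b>K(a)$ the pair $(\Omega_a,\Omega_b)$ does not admit a coupled extremal Kähler metric $(\omega,\chi)\in\Omega_a\times\Omega_b$ satisfying the Calabi ansatz.
   Context: Surface. $\Sigma$ is a compact Riemann surface of genus $2$ with a fixed Kähler metric $\omega_\Sigma$ of scalar curvature $R(\omega_\Sigma)=-2$ (so $\int_\Sigma\omega_\Sigma=2\pi$). $L\to\Sigma$ is a holomorphic line bundle of degree $-1$ with a Hermitian metric $h$ whose curvature form $-\sqrt{-1}\partial\bar\partial\log h$ equals $-\omega_\Sigma$; $\mathcal{O}$ is the trivial line bundle. $X=\mathbb{P}(L\oplus\mathcal{O})$ is the associated $\mathbb{P}^1$-bundle over $\Sigma$. $\mathrm{C}$ is the Poincaré dual of a fiber; $D_\infty$ and $D_0$ are the images in $X$ of the subbundles $L\oplus\{0\}$ and $\{0\}\oplus\mathcal{O}$ (infinity divisor and zero divisor), identified with their Poincaré duals in $H^2(X,\mathbb{R})$ when appearing in cohomology classes. The complement $X\setminus(D_0\cup D_\infty)$ is identified with $L$ minus its zero section, $D_0$ being the zero section; $p$ denotes the projection to $\Sigma$. The Kähler classes of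 $X$ are exactly $a_1\mathrm{C}+a_2D_\infty$ with $a_1,a_2>0$. Conventions. On a Kähler surface, $\mathrm{Ric}(\omega)=-\sqrt{-1}\partial\bar\partial\log(\omega^2)$; for a $(1,1)$-form $\alpha$, $\Lambda_\omega\alpha=2\,\alpha\wedge\omega/\omega^2$; $R(\omega)=\Lambda_\omega\mathrm{Ric}(\omega)$. For a function $f$, $\nabla^{1,0}_\omega f=g^{j\bar k}(\partial_{\bar k}f)\partial_j$, where $g$ is the metric of $\omega$. Coupled extremal pair. A pair of Kähler metrics $(\omega,\chi)$ on $X$ is coupled extremal if $\mathrm{Ric}(\omega)=\mathrm{Ric}(\chi)$ and $\bar\partial\big(\nabla^{1,0}_\omega(R(\omega)-\Lambda_\omega(\omega+\chi))\big)=0$ (since $\Lambda_\omega\omega=2$ is constant, one may replace $\Lambda_\omega(\omega+\chi)$ by $\Lambda_\omega\chi$). Calabi ansatz. Let $s$ be the logarithm of the fiberwise norm squared on $X\setminus(D_0\cup D_\infty)$: $s=\ln h(z)+\ln|w|^2$, where $z$ is a local coordinate on $\Sigma$ and $w$ a fiber coordinate on $L$. A Kähler metric $\omega\in\Omega_a$ satisfies the Calabi ansatz if on $X\setminus(D_0\cup D_\infty)$ it has the form $\omega=p^*\omega_\Sigma+\sqrt{-1}\partial\bar\partial u(s)$ with $u\in C^\infty(\mathbb{R},\mathbb{R})$ strictly convex, $s\mapsto s+u(s)$ strictly increasing, $\lim_{s\to-\infty}u'(s)=0$ and $\lim_{s\to\infty}u'(s)=a$ (and it extends smoothly to a Kähler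 metric on all of $X$). A pair $(\omega,\chi)\in\Omega_a\times\Omega_b$ satisfies the Calabi ansatz if $\omega$ does (with parameter $a$) and $\chi$ does (with parameter $b$). *)

theory Defs
  imports "HOL-Homology.Homology" "HOL-Complex_Analysis.Complex_Analysis"
begin

section \<open>Calculus on open subsets of real and complex vector spaces\<close>

primrec Ck_on ::
  "nat \<Rightarrow> ('a::real_normed_vector \<Rightarrow> 'b::real_normed_vector) \<Rightarrow> 'a set \<Rightarrow> bool" where
  "Ck_on 0 f S \<longleftrightarrow> continuous_on S f"
| "Ck_on (Suc k) f S \<longleftrightarrow> (\<forall>x\<in>S. f differentiable (at x)) \<and>
     (\<forall>v. Ck_on k (\<lambda>x. frechet_derivative f (at x) v) S)"

definition smooth_on ::
  "('a::real_normed_vector \<Rightarrow> 'b::real_normed_vector) \<Rightarrow> 'a set \<Rightarrow> bool" where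
  "smooth_on f S \<longleftrightarrow> (\<forall>k. Ck_on k f S)"

definition strictly_convex :: "(real \<Rightarrow> real) \<Rightarrow> bool" where
  "strictly_convex u \<longleftrightarrow> (\<forall>x y t. x \<noteq> y \<longrightarrow> 0 < t \<longrightarrow> t < 1 \<longrightarrow>
     u ((1 - t) * x + t * y) < (1 - t) * u x + t * u y)"

text \<open>Wirtinger derivatives, in one variable (\<open>dz\<close>, \<open>dzbar\<close>) and in two (\<open>del\<close>, \<open>delbar\<close>).\<close>

definition dz :: "(complex \<Rightarrow> complex) \<Rightarrow> complex \<Rightarrow> complex" where
  "dz f x = (frechet_derivative f (at x) 1 - \<i> * frechet_derivative f (at x) \<i>) / 2"

definition dzbar :: "(complex \<Rightarrow> complex) \<Rightarrow> complex \<Rightarrow> complex" where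
  "dzbar f x = (frechet_derivative f (at x) 1 + \<i> * frechet_derivative f (at x) \<i>) / 2"

definition del :: "2 \<Rightarrow> (complex^2 \<Rightarrow> complex) \<Rightarrow> complex^2 \<Rightarrow> complex" where
  "del j f x = (frechet_derivative f (at x) (axis j 1)
                - \<i> * frechet_derivative f (at x) (axis j \<i>)) / 2"

definition delbar :: "2 \<Rightarrow> (complex^2 \<Rightarrow> complex) \<Rightarrow> complex^2 \<Rightarrow> complex" where
  "delbar j f x = (frechet_derivative f (at x) (axis j 1)
                   + \<i> * frechet_derivative f (at x) (axis j \<i>)) / 2"

section \<open>Charts\<close>

type_synonym ('p, 'e) chart = "'p set \<times> ('p \<Rightarrow> 'e)"

definition chart_inv :: "('p, 'e) chart \<Rightarrow> 'e \<Rightarrow> 'p" where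
  "chart_inv \<kappa> = inv_into (fst \<kappa>) (snd \<kappa>)"

definition chart_image :: "('p, 'e) chart \<Rightarrow> 'e set" where
  "chart_image \<kappa> = snd \<kappa> ` fst \<kappa>"

definition overlap :: "('p, 'e) chart \<Rightarrow> 'p set \<Rightarrow> 'e set" where
  "overlap \<kappa> V = snd \<kappa> ` (fst \<kappa> \<inter> V)"

definition transition :: "('p, 'e) chart \<Rightarrow> ('p, 'e) chart \<Rightarrow> 'e \<Rightarrow> 'e" where
  "transition \<kappa> \<kappa>' = snd \<kappa>' \<circ> chart_inv \<kappa>"

section \<open>Compact Riemann surfaces\<close>

record 'a surface =
  surf_top :: "'a topology"
  surf_atlas :: "('a, complex) chart set"

abbreviation surf_points :: "'a surface \<Rightarrow> 'a set" where
  "surf_points S \<equiv> topspace (surf_top S)"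

definition compact_riemann_surface :: "'a surface \<Rightarrow> bool" where
  "compact_riemann_surface S \<longleftrightarrow>
     surf_points S \<noteq> {} \<and> compact_space (surf_top S) \<and>
     connected_space (surf_top S) \<and> Hausdorff_space (surf_top S) \<and>
     (\<forall>c\<in>surf_atlas S. openin (surf_top S) (fst c) \<and> open (chart_image c) \<and>
        homeomorphic_map (subtopology (surf_top S) (fst c)) (top_of_set (chart_image c)) (snd c)) \<and>
     (\<Union>c\<in>surf_atlas S. fst c) = surf_points S \<and>
     (\<forall>c\<in>surf_atlas S. \<forall>c'\<in>surf_atlas S.
        transition c c' holomorphic_on overlap c (fst c'))"

definition has_genus :: "'a surface \<Rightarrow> nat \<Rightarrow> bool" where
  "has_genus S n \<longleftrightarrow> homology_group 1 (surf_top S) \<cong> free_Abelian_group {..<2 * n}"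

definition holomorphic_fun :: "'a surface \<Rightarrow> 'a set \<Rightarrow> ('a \<Rightarrow> complex) \<Rightarrow> bool" where
  "holomorphic_fun S V f \<longleftrightarrow>
     (\<forall>c\<in>surf_atlas S. (f \<circ> chart_inv c) holomorphic_on overlap c V)"

text \<open>A Kaehler form on a Riemann surface is \<open>\<surd>-1 g dz \<and> d(cnj z)\<close> in each chart, and is represented
  by the family of its coefficients \<open>g\<close>; it is automatically closed.\<close>

type_synonym 'a surface_metric = "('a, complex) chart \<Rightarrow> complex \<Rightarrow> real"

definition surface_kaehler :: "'a surface \<Rightarrow> 'a surface_metric \<Rightarrow> bool" where
  "surface_kaehler S g \<longleftrightarrow>
     (\<forall>c\<in>surf_atlas S. smooth_on (g c) (chart_image c) \<and> (\<forall>z\<in>chart_image c. g c z > 0)) \<and>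
     (\<forall>c\<in>surf_atlas S. \<forall>c'\<in>surf_atlas S. \<forall>z\<in>overlap c (fst c').
        g c z = g c' (transition c c' z) * (cmod (deriv (transition c c') z))\<^sup>2)"

text \<open>The trace of \<open>Ric = -\<surd>-1 \<partial>\<partial>bar log \<omega>\<close> with respect to \<open>\<omega>\<close>. In this normalization
  Gauss-Bonnet reads \<open>\<integral> R \<omega> = 2\<pi>(2 - 2 genus)\<close>, so that \<open>R = -2\<close> and genus 2 give \<open>\<integral> \<omega> = 2\<pi>\<close>.\<close>

definition surface_scalar_curvature :: "'a surface_metric \<Rightarrow> ('a, complex) chart \<Rightarrow> complex \<Rightarrow> complex"
  where "surface_scalar_curvature g c z =
     - dz (dzbar (\<lambda>z. of_real (ln (g c z)))) z / of_real (g c z)"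

section \<open>Holomorphic line bundles\<close>

text \<open>A trivialization over \<open>V\<close> is a pair \<open>(V, \<psi>)\<close> where \<open>\<psi>\<close> gives the fibre coordinate on the
  part of the total space over \<open>V\<close>. The linear structure of the fibres is the one transported
  along the trivializations.\<close>

record ('a, 'l) line_bundle =
  lb_total :: "'l set"
  lb_proj :: "'l \<Rightarrow> 'a"
  lb_trivs :: "('a set \<times> ('l \<Rightarrow> complex)) set"

definition lb_fibre :: "('a, 'l) line_bundle \<Rightarrow> 'a \<Rightarrow> 'l set" where
  "lb_fibre L x = {l \<in> lb_total L. lb_proj L l = x}"

definition holomorphic_line_bundle :: "'a surface \<Rightarrow> ('a, 'l) line_bundle \<Rightarrow> bool" where
  "holomorphic_line_bundle S L \<longleftrightarrow>
     lb_proj L ` lb_total L \<subseteq> surf_points S \<and>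
     (\<forall>(V, \<psi>)\<in>lb_trivs L. openin (surf_top S) V \<and> (\<forall>x\<in>V. bij_betw \<psi> (lb_fibre L x) UNIV)) \<and>
     (\<Union>(V, \<psi>)\<in>lb_trivs L. V) = surf_points S \<and>
     (\<forall>(V, \<psi>)\<in>lb_trivs L. \<forall>(V', \<psi>')\<in>lb_trivs L. \<exists>\<tau>.
        holomorphic_fun S (V \<inter> V') \<tau> \<and>
        (\<forall>x\<in>V \<inter> V'. \<tau> x \<noteq> 0 \<and> (\<forall>l\<in>lb_fibre L x. \<psi>' l = \<tau> x * \<psi> l)))"

text \<open>The degree is the degree of the divisor of a meromorphic section that does not vanish
  identically. The values of \<open>\<sigma>\<close> at the isolated poles are irrelevant: neither
  \<^const>\<open>meromorphic_on\<close> nor \<^const>\<open>zorder\<close> depends on the value at the point.\<close>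

definition section_local ::
  "('a \<Rightarrow> 'l) \<Rightarrow> ('a, complex) chart \<Rightarrow> 'a set \<times> ('l \<Rightarrow> complex) \<Rightarrow> complex \<Rightarrow> complex" where
  "section_local \<sigma> c t = snd t \<circ> \<sigma> \<circ> chart_inv c"

definition nonzero_meromorphic_section ::
  "'a surface \<Rightarrow> ('a, 'l) line_bundle \<Rightarrow> ('a \<Rightarrow> 'l) \<Rightarrow> bool" where
  "nonzero_meromorphic_section S L \<sigma> \<longleftrightarrow>
     (\<forall>x\<in>surf_points S. \<sigma> x \<in> lb_fibre L x) \<and>
     (\<forall>c\<in>surf_atlas S. \<forall>t\<in>lb_trivs L.
        section_local \<sigma> c t meromorphic_on overlap c (fst t) \<and>
        (\<forall>z\<in>overlap c (fst t). \<forall>\<^sub>F w in at z. section_local \<sigma> c t w \<noteq> 0))"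

definition has_degree :: "'a surface \<Rightarrow> ('a, 'l) line_bundle \<Rightarrow> int \<Rightarrow> bool" where
  "has_degree S L d \<longleftrightarrow>
     (\<exists>\<sigma> ordr. nonzero_meromorphic_section S L \<sigma> \<and>
        (\<forall>c\<in>surf_atlas S. \<forall>t\<in>lb_trivs L. \<forall>x\<in>fst c \<inter> fst t.
           zorder (section_local \<sigma> c t) (snd c x) = ordr x) \<and>
        finite {x \<in> surf_points S. ordr x \<noteq> (0::int)} \<and>
        (\<Sum>x | x \<in> surf_points S \<and> ordr x \<noteq> 0. ordr x) = d)"

text \<open>A Hermitian metric \<open>h\<close> on \<open>L\<close> is given by its norm squared \<open>N\<close> on the total space;
  \<open>metric_coeff L N t\<close> is the local function \<open>h\<close> with \<open>N = h \<bar>w\<bar>\<^sup>2\<close> in the trivialization \<open>t\<close>.\<close>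

definition metric_coeff ::
  "('a, 'l) line_bundle \<Rightarrow> ('l \<Rightarrow> real) \<Rightarrow> 'a set \<times> ('l \<Rightarrow> complex) \<Rightarrow> 'a \<Rightarrow> real" where
  "metric_coeff L N t x = N (inv_into (lb_fibre L x) (snd t) 1)"

definition hermitian_metric ::
  "'a surface \<Rightarrow> ('a, 'l) line_bundle \<Rightarrow> ('l \<Rightarrow> real) \<Rightarrow> bool" where
  "hermitian_metric S L N \<longleftrightarrow>
     (\<forall>t\<in>lb_trivs L. \<forall>x\<in>fst t. metric_coeff L N t x > 0 \<and>
        (\<forall>l\<in>lb_fibre L x. N l = metric_coeff L N t x * (cmod (snd t l))\<^sup>2)) \<and>
     (\<forall>c\<in>surf_atlas S. \<forall>t\<in>lb_trivs L.
        smooth_on (metric_coeff L N t \<circ> chart_inv c) (overlap c (fst t)))"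

definition curvature_coeff ::
  "('a, 'l) line_bundle \<Rightarrow> ('l \<Rightarrow> real) \<Rightarrow> ('a, complex) chart \<Rightarrow> 'a set \<times> ('l \<Rightarrow> complex)
    \<Rightarrow> complex \<Rightarrow> complex" where
  "curvature_coeff L N c t z =
     - dz (dzbar (\<lambda>z. of_real (ln (metric_coeff L N t (chart_inv c z))))) z"

definition curvature_is_minus ::
  "'a surface \<Rightarrow> ('a, 'l) line_bundle \<Rightarrow> ('l \<Rightarrow> real) \<Rightarrow> 'a surface_metric \<Rightarrow> bool" where
  "curvature_is_minus S L N g \<longleftrightarrow>
     (\<forall>c\<in>surf_atlas S. \<forall>t\<in>lb_trivs L. \<forall>z\<in>overlap c (fst t).
        curvature_coeff L N c t z = - of_real (g c z))"

section \<open>The projectivization of \<open>L \<oplus> O\<close>\<close>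

definition lb_scale :: "('a, 'l) line_bundle \<Rightarrow> complex \<Rightarrow> 'l \<Rightarrow> 'l" where
  "lb_scale L c l = (THE m. m \<in> lb_fibre L (lb_proj L l) \<and>
     (\<forall>(V, \<psi>)\<in>lb_trivs L. lb_proj L l \<in> V \<longrightarrow> \<psi> m = c * \<psi> l))"

definition lb_zero :: "('a, 'l) line_bundle \<Rightarrow> 'a \<Rightarrow> 'l" where
  "lb_zero L x = (THE m. m \<in> lb_fibre L x \<and> (\<forall>(V, \<psi>)\<in>lb_trivs L. x \<in> V \<longrightarrow> \<psi> m = 0))"

text \<open>A point of the projectivization is a line through the origin of a fibre of \<open>L \<oplus> O\<close>, i.e.
  of \<open>L\<^sub>x \<times> \<complex>\<close>.\<close>

type_synonym 'l proj_point = "('l \<times> complex) set"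

definition line_through :: "('a, 'l) line_bundle \<Rightarrow> 'l \<Rightarrow> complex \<Rightarrow> 'l proj_point" where
  "line_through L l t = {(lb_scale L c l, c * t) | c. True}"

definition proj_bundle :: "('a, 'l) line_bundle \<Rightarrow> 'l proj_point set" where
  "proj_bundle L = {line_through L l t | l t.
     l \<in> lb_total L \<and> \<not> (l = lb_zero L (lb_proj L l) \<and> t = 0)}"

definition D_infinity :: "('a, 'l) line_bundle \<Rightarrow> 'l proj_point set" where
  "D_infinity L = {line_through L l 0 | l. l \<in> lb_total L \<and> l \<noteq> lb_zero L (lb_proj L l)}"

definition D_zero :: "('a, 'l) line_bundle \<Rightarrow> 'l proj_point set" where
  "D_zero L = {line_through L (lb_zero L (lb_proj L l)) 1 | l. l \<in> lb_total L}"

definition base_point :: "('a, 'l) line_bundle \<Rightarrow> 'l proj_point \<Rightarrow> 'a" where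
  "base_point L q = (THE x. \<exists>r\<in>q. lb_proj L (fst r) = x)"

definition fibre_over :: "('a, 'l) line_bundle \<Rightarrow> 'a \<Rightarrow> 'l proj_point set" where
  "fibre_over L x = {q \<in> proj_bundle L. base_point L q = x}"

text \<open>The identification of the complement of \<open>D_infinity\<close> with the total space of \<open>L\<close>.\<close>

definition affine_vector :: "'l proj_point \<Rightarrow> 'l" where
  "affine_vector q = (THE l. (l, 1) \<in> q)"

text \<open>Coordinates \<open>(z, w)\<close> off \<open>D_infinity\<close> and \<open>(z, 1/w)\<close> off \<open>D_zero\<close>.\<close>

definition zero_chart :: "('a, 'l) line_bundle \<Rightarrow> ('a, complex) chart \<Rightarrow>
    'a set \<times> ('l \<Rightarrow> complex) \<Rightarrow> ('l proj_point, complex^2) chart" where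
  "zero_chart L c t =
     ({q \<in> proj_bundle L - D_infinity L. base_point L q \<in> fst c \<inter> fst t},
      \<lambda>q. vector [snd c (base_point L q), snd t (affine_vector q)])"

definition infinity_chart :: "('a, 'l) line_bundle \<Rightarrow> ('a, complex) chart \<Rightarrow>
    'a set \<times> ('l \<Rightarrow> complex) \<Rightarrow> ('l proj_point, complex^2) chart" where
  "infinity_chart L c t =
     ({q \<in> proj_bundle L - D_zero L. base_point L q \<in> fst c \<inter> fst t},
      \<lambda>q. vector [snd c (base_point L q), THE y. \<exists>l. (l, y) \<in> q \<and> snd t l = 1])"

definition proj_atlas ::
  "'a surface \<Rightarrow> ('a, 'l) line_bundle \<Rightarrow> ('l proj_point, complex^2) chart set" where
  "proj_atlas S L = (\<Union>c\<in>surf_atlas S. \<Union>t\<in>lb_trivs L. {zero_chart L c t, infinity_chart L c t})"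

section \<open>Real differential forms and de Rham classes on complex surfaces\<close>

text \<open>In the following, \<open>M\<close> is the set of points and \<open>At\<close> the atlas of a complex surface, and a
  differential form is the family of its coordinate representations, which are only
  meaningful on the images of the charts.\<close>

type_synonym 'p one_form = "('p, complex^2) chart \<Rightarrow> complex^2 \<Rightarrow> complex^2 \<Rightarrow> real"

type_synonym 'p two_form =
  "('p, complex^2) chart \<Rightarrow> complex^2 \<Rightarrow> complex^2 \<Rightarrow> complex^2 \<Rightarrow> real"

definition smooth_one_form :: "('p, complex^2) chart set \<Rightarrow> 'p one_form \<Rightarrow> bool" where
  "smooth_one_form At \<mu> \<longleftrightarrow>
     (\<forall>\<kappa>\<in>At. (\<forall>x\<in>chart_image \<kappa>. linear (\<mu> \<kappa> x)) \<and>
        (\<forall>v. smooth_on (\<lambda>x. \<mu> \<kappa> x v) (chart_image \<kappa>))) \<and>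
     (\<forall>\<kappa>\<in>At. \<forall>\<kappa>'\<in>At. \<forall>x\<in>overlap \<kappa> (fst \<kappa>'). \<forall>v.
        \<mu> \<kappa> x v = \<mu> \<kappa>' (transition \<kappa> \<kappa>' x) (frechet_derivative (transition \<kappa> \<kappa>') (at x) v))"

definition smooth_two_form :: "('p, complex^2) chart set \<Rightarrow> 'p two_form \<Rightarrow> bool" where
  "smooth_two_form At \<alpha> \<longleftrightarrow>
     (\<forall>\<kappa>\<in>At. (\<forall>x\<in>chart_image \<kappa>. bilinear (\<alpha> \<kappa> x) \<and> (\<forall>v. \<alpha> \<kappa> x v v = 0)) \<and>
        (\<forall>v w. smooth_on (\<lambda>x. \<alpha> \<kappa> x v w) (chart_image \<kappa>))) \<and>
     (\<forall>\<kappa>\<in>At. \<forall>\<kappa>'\<in>At. \<forall>x\<in>overlap \<kappa> (fst \<kappa>'). \<forall>v w.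
        \<alpha> \<kappa> x v w = \<alpha> \<kappa>' (transition \<kappa> \<kappa>' x)
          (frechet_derivative (transition \<kappa> \<kappa>') (at x) v)
          (frechet_derivative (transition \<kappa> \<kappa>') (at x) w))"

definition closed_two_form :: "('p, complex^2) chart set \<Rightarrow> 'p two_form \<Rightarrow> bool" where
  "closed_two_form At \<alpha> \<longleftrightarrow> smooth_two_form At \<alpha> \<and>
     (\<forall>\<kappa>\<in>At. \<forall>x\<in>chart_image \<kappa>. \<forall>v1 v2 v3.
          frechet_derivative (\<lambda>y. \<alpha> \<kappa> y v2 v3) (at x) v1
        - frechet_derivative (\<lambda>y. \<alpha> \<kappa> y v1 v3) (at x) v2
        + frechet_derivative (\<lambda>y. \<alpha> \<kappa> y v1 v2) (at x) v3 = 0)"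

definition exact_two_form :: "('p, complex^2) chart set \<Rightarrow> 'p two_form \<Rightarrow> bool" where
  "exact_two_form At \<alpha> \<longleftrightarrow> (\<exists>\<mu>. smooth_one_form At \<mu> \<and>
     (\<forall>\<kappa>\<in>At. \<forall>x\<in>chart_image \<kappa>. \<forall>v w. \<alpha> \<kappa> x v w =
          frechet_derivative (\<lambda>y. \<mu> \<kappa> y w) (at x) v
        - frechet_derivative (\<lambda>y. \<mu> \<kappa> y v) (at x) w))"

text \<open>The coefficient of \<open>\<alpha> \<and> \<beta>\<close> with respect to \<open>dx\<^sub>1 \<and> dy\<^sub>1 \<and> dx\<^sub>2 \<and> dy\<^sub>2\<close>, where
  \<open>z\<^sub>j = x\<^sub>j + \<i> y\<^sub>j\<close>; this basis is positive for the complex orientation.\<close>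

definition wedge_density ::
  "'p two_form \<Rightarrow> 'p two_form \<Rightarrow> ('p, complex^2) chart \<Rightarrow> complex^2 \<Rightarrow> real" where
  "wedge_density \<alpha> \<beta> \<kappa> x =
     (let e1 = axis 1 1; e2 = axis 1 \<i>; e3 = axis 2 1; e4 = axis 2 \<i>; A = \<alpha> \<kappa> x; B = \<beta> \<kappa> x in
        A e1 e2 * B e3 e4 - A e1 e3 * B e2 e4 + A e1 e4 * B e2 e3
      + A e2 e3 * B e1 e4 - A e2 e4 * B e1 e3 + A e3 e4 * B e1 e2)"

text \<open>The integral over \<open>M\<close> of a top-degree form with the given densities: \<open>M\<close> is cut into
  finitely many Borel pieces, each inside one chart. Chart changes are holomorphic, hence
  orientation preserving, so the value does not depend on the decomposition.\<close>

definition has_integral_over :: "'p set \<Rightarrow> ('p, complex^2) chart set \<Rightarrow>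
    (('p, complex^2) chart \<Rightarrow> complex^2 \<Rightarrow> real) \<Rightarrow> real \<Rightarrow> bool" where
  "has_integral_over M At f I \<longleftrightarrow>
     (\<exists>P. finite P \<and>
        (\<forall>(\<kappa>, A)\<in>P. \<kappa> \<in> At \<and> A \<subseteq> fst \<kappa> \<and> snd \<kappa> ` A \<in> sets borel \<and>
           set_integrable lborel (snd \<kappa> ` A) (f \<kappa>)) \<and>
        (\<forall>q\<in>P. \<forall>q'\<in>P. q \<noteq> q' \<longrightarrow> snd q \<inter> snd q' = {}) \<and>
        (\<Union>(\<kappa>, A)\<in>P. A) = M \<and>
        I = (\<Sum>(\<kappa>, A)\<in>P. set_lebesgue_integral lborel (snd \<kappa> ` A) (f \<kappa>)))"

text \<open>The integral of a 2-form over a compact complex curve \<open>D\<close> in \<open>M\<close>, cut into finitely many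
  pieces \<open>\<kappa>\<^sup>-\<^sup>1(\<gamma>(B))\<close> with \<open>\<gamma>\<close> holomorphic into the image of the chart \<open>\<kappa>\<close>.\<close>

definition has_curve_integral ::
  "('p, complex^2) chart set \<Rightarrow> 'p set \<Rightarrow> 'p two_form \<Rightarrow> real \<Rightarrow> bool" where
  "has_curve_integral At D \<eta> I \<longleftrightarrow>
     (\<exists>P. let
          piece = (\<lambda>(\<kappa>, \<gamma>, B). chart_inv \<kappa> ` \<gamma> ` B);
          pullback = (\<lambda>\<kappa> \<gamma> s. \<eta> \<kappa> (\<gamma> s)
            (frechet_derivative \<gamma> (at s) 1) (frechet_derivative \<gamma> (at s) \<i>)) in
        finite P \<and>
        (\<forall>(\<kappa>, \<gamma>, B)\<in>P. \<kappa> \<in> At \<and> B \<in> sets borel \<and> inj_on \<gamma> B \<and>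
           (\<exists>G. open G \<and> B \<subseteq> G \<and> \<gamma> ` G \<subseteq> chart_image \<kappa> \<and>
              (\<forall>j. (\<lambda>s. \<gamma> s $ j) holomorphic_on G)) \<and>
           set_integrable lborel B (pullback \<kappa> \<gamma>)) \<and>
        (\<forall>q\<in>P. \<forall>q'\<in>P. q \<noteq> q' \<longrightarrow> piece q \<inter> piece q' = {}) \<and>
        (\<Union>q\<in>P. piece q) = D \<and>
        I = (\<Sum>(\<kappa>, \<gamma>, B)\<in>P. set_lebesgue_integral lborel B (pullback \<kappa> \<gamma>)))"

definition poincare_dual ::
  "'p set \<Rightarrow> ('p, complex^2) chart set \<Rightarrow> 'p set \<Rightarrow> 'p two_form \<Rightarrow> bool" where
  "poincare_dual M At D \<theta> \<longleftrightarrow> closed_two_form At \<theta> \<and>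
     (\<forall>\<eta>. closed_two_form At \<eta> \<longrightarrow>
        (\<exists>I. has_integral_over M At (wedge_density \<theta> \<eta>) I \<and> has_curve_integral At D \<eta> I))"

text \<open>The cohomology class \<open>2\<pi>(C + a D_infinity)\<close> as the set of closed forms representing it.\<close>

definition Omega_class ::
  "'a surface \<Rightarrow> ('a, 'l) line_bundle \<Rightarrow> real \<Rightarrow> 'l proj_point two_form set" where
  "Omega_class S L a = {\<alpha>. closed_two_form (proj_atlas S L) \<alpha> \<and>
     (\<exists>x\<in>surf_points S. \<exists>\<theta>C \<theta>D.
        poincare_dual (proj_bundle L) (proj_atlas S L) (fibre_over L x) \<theta>C \<and>
        poincare_dual (proj_bundle L) (proj_atlas S L) (D_infinity L) \<theta>D \<and>
        exact_two_form (proj_atlas S L)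
          (\<lambda>\<kappa> y v w. \<alpha> \<kappa> y v w - 2 * pi * (\<theta>C \<kappa> y v w + a * \<theta>D \<kappa> y v w)))}"

section \<open>Kaehler metrics on complex surfaces\<close>

text \<open>A \<open>(1,1)\<close>-form \<open>\<surd>-1 \<Sum> A\<^sub>j\<^sub>k dz\<^sub>j \<and> d(cnj z\<^sub>k)\<close> is represented by the family of its coefficient
  matrices; \<open>real_form\<close> is the corresponding real 2-form (for Hermitian \<open>A\<close>).\<close>

type_synonym 'p form11 = "('p, complex^2) chart \<Rightarrow> complex^2 \<Rightarrow> complex^2^2"

definition real_form :: "'p form11 \<Rightarrow> 'p two_form" where
  "real_form A \<kappa> x v w =
     Re (\<i> * (\<Sum>j\<in>UNIV. \<Sum>k\<in>UNIV. A \<kappa> x $ j $ k * (v $ j * cnj (w $ k) - w $ j * cnj (v $ k))))"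

definition kaehler_metric :: "('p, complex^2) chart set \<Rightarrow> 'p form11 \<Rightarrow> bool" where
  "kaehler_metric At \<omega> \<longleftrightarrow> closed_two_form At (real_form \<omega>) \<and>
     (\<forall>\<kappa>\<in>At. \<forall>x\<in>chart_image \<kappa>.
        (\<forall>j k. \<omega> \<kappa> x $ k $ j = cnj (\<omega> \<kappa> x $ j $ k)) \<and>
        (\<forall>v. v \<noteq> 0 \<longrightarrow> Re (\<Sum>j\<in>UNIV. \<Sum>k\<in>UNIV. \<omega> \<kappa> x $ j $ k * v $ j * cnj (v $ k)) > 0))"

definition i_del_delbar ::
  "(('p, complex^2) chart \<Rightarrow> complex^2 \<Rightarrow> complex) \<Rightarrow> 'p form11" where
  "i_del_delbar f \<kappa> x = (\<chi> j k. del j (delbar k (f \<kappa>)) x)"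

text \<open>The coefficient of \<open>\<alpha> \<and> \<beta>\<close> with respect to
  \<open>(\<surd>-1 dz\<^sub>1 \<and> d(cnj z\<^sub>1)) \<and> (\<surd>-1 dz\<^sub>2 \<and> d(cnj z\<^sub>2))\<close>.\<close>

definition wedge11 :: "complex^2^2 \<Rightarrow> complex^2^2 \<Rightarrow> complex" where
  "wedge11 A B = (let a = (\<lambda>j k. A $ j $ k); b = (\<lambda>j k. B $ j $ k) in
     a 1 1 * b 2 2 + a 2 2 * b 1 1 - a 1 2 * b 2 1 - a 2 1 * b 1 2)"

definition Ric :: "'p form11 \<Rightarrow> 'p form11" where
  "Ric \<omega> \<kappa> x = - i_del_delbar (\<lambda>\<kappa> y. of_real (ln (Re (wedge11 (\<omega> \<kappa> y) (\<omega> \<kappa> y))))) \<kappa> x"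

definition Lambda ::
  "'p form11 \<Rightarrow> 'p form11 \<Rightarrow> ('p, complex^2) chart \<Rightarrow> complex^2 \<Rightarrow> complex" where
  "Lambda \<omega> \<alpha> \<kappa> x = 2 * wedge11 (\<alpha> \<kappa> x) (\<omega> \<kappa> x) / wedge11 (\<omega> \<kappa> x) (\<omega> \<kappa> x)"

definition scalar_curvature ::
  "'p form11 \<Rightarrow> ('p, complex^2) chart \<Rightarrow> complex^2 \<Rightarrow> complex" where
  "scalar_curvature \<omega> = Lambda \<omega> (Ric \<omega>)"

text \<open>The inverse metric \<open>g\<^sup>j\<^sup>k\<close> satisfies \<open>\<Sum>\<^sub>k g\<^sup>j\<^sup>k g\<^sub>l\<^sub>k = \<delta>\<^sub>j\<^sub>l\<close>, whence the transposed indices.\<close>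

definition gradient10 ::
  "'p form11 \<Rightarrow> (('p, complex^2) chart \<Rightarrow> complex^2 \<Rightarrow> complex) \<Rightarrow>
    ('p, complex^2) chart \<Rightarrow> complex^2 \<Rightarrow> complex^2" where
  "gradient10 \<omega> f \<kappa> x = (\<chi> j. \<Sum>k\<in>UNIV. matrix_inv (\<omega> \<kappa> x) $ k $ j * delbar k (f \<kappa>) x)"

definition coupled_extremal ::
  "('p, complex^2) chart set \<Rightarrow> 'p form11 \<Rightarrow> 'p form11 \<Rightarrow> bool" where
  "coupled_extremal At \<omega> \<omega>' \<longleftrightarrow>
     kaehler_metric At \<omega> \<and> kaehler_metric At \<omega>' \<and>
     (\<forall>\<kappa>\<in>At. \<forall>x\<in>chart_image \<kappa>. Ric \<omega> \<kappa> x = Ric \<omega>' \<kappa> x) \<and>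
     (let f = (\<lambda>\<kappa> x. scalar_curvature \<omega> \<kappa> x - Lambda \<omega> (\<lambda>\<kappa> y. \<omega> \<kappa> y + \<omega>' \<kappa> y) \<kappa> x) in
        \<forall>\<kappa>\<in>At. \<forall>x\<in>chart_image \<kappa>. \<forall>j k. delbar k (\<lambda>y. gradient10 \<omega> f \<kappa> y $ j) x = 0)"

section \<open>The Calabi ansatz\<close>

text \<open>\<open>p\<^sup>*\<omega>\<^sub>\<Sigma>\<close> in the chart \<open>\<kappa>\<close>, computed with the chart \<open>c\<close> of the base.\<close>

definition pullback_base :: "('a, 'l) line_bundle \<Rightarrow> 'a surface_metric \<Rightarrow>
    ('a, complex) chart \<Rightarrow> 'l proj_point form11" where
  "pullback_base L g c \<kappa> x =
     (let q = (\<lambda>y. snd c (base_point L (chart_inv \<kappa> y)))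
      in \<chi> j k. of_real (g c (q x)) * del j q x * cnj (del k q x))"

definition log_norm :: "('l \<Rightarrow> real) \<Rightarrow> 'l proj_point \<Rightarrow> real" where
  "log_norm N q = ln (N (affine_vector q))"

definition calabi_ansatz :: "'a surface \<Rightarrow> ('a, 'l) line_bundle \<Rightarrow> ('l \<Rightarrow> real) \<Rightarrow>
    'a surface_metric \<Rightarrow> real \<Rightarrow> 'l proj_point form11 \<Rightarrow> bool" where
  "calabi_ansatz S L N g a \<omega> \<longleftrightarrow>
     (\<exists>u :: real \<Rightarrow> real. smooth_on u UNIV \<and> strictly_convex u \<and> strict_mono (\<lambda>s. s + u s) \<and>
        (deriv u \<longlongrightarrow> 0) at_bot \<and> (deriv u \<longlongrightarrow> a) at_top \<and>
        (\<forall>\<kappa>\<in>proj_atlas S L. \<forall>c\<in>surf_atlas S. \<forall>q\<in>fst \<kappa> - (D_zero L \<union> D_infinity L).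
           base_point L q \<in> fst c \<longrightarrow>
           \<omega> \<kappa> (snd \<kappa> q) = pullback_base L g c \<kappa> (snd \<kappa> q)
             + i_del_delbar (\<lambda>\<kappa> y. of_real (u (log_norm N (chart_inv \<kappa> y)))) \<kappa> (snd \<kappa> q)))"

end

theory Submission
  imports Defs "HOL-Real_Asymp.Real_Asymp"
begin

text \<open>For \<open>\<omega>\<close> and \<open>\<chi>\<close> given by \<open>u\<close> and \<open>v\<close> put \<open>x = 1 + u'\<close> and \<open>y = 1 + v'\<close>, so that \<open>x\<close> increases from \<open>1\<close> to
  \<open>m = 1 + a\<close> and \<open>y\<close> from \<open>1\<close> to \<open>n = 1 + b\<close>. Equality of the Ricci forms means that \<open>x x'\<close> is a constant
  multiple \<open>c\<close> of \<open>y y'\<close>, hence \<open>x\<^sup>2 - 1 = c (y\<^sup>2 - 1)\<close>. A function of \<open>s\<close> has a holomorphic gradient exactly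
  if it is affine in \<open>x\<close>, so in terms of the momentum profile \<open>\<Phi>(x) = x u''\<close> the extremal equation is
  \<open>\<Phi>'' = -2 - (x y)' - A x - B x\<^sup>2\<close>. Smoothness of \<open>\<omega>\<close> along the two divisors gives
  \<open>\<Phi>(1) = \<Phi>(m) = 0\<close>, \<open>\<Phi>'(1) = 1\<close>, \<open>\<Phi>'(m) = -m\<close>, and these conditions determine \<open>A\<close>, \<open>B\<close> and \<open>\<Phi>\<close>. As \<open>n\<close> grows,
  \<open>\<Phi> / n\<close> converges to a function with the expansion \<open>- k (x - 1) powr (3/2) + O((x - 1)\<^sup>2)\<close> at \<open>1\<close>, with \<open>k > 0\<close>, so
  \<open>\<Phi>\<close> is negative near \<open>1\<close> for large \<open>n\<close>, whereas positivity of \<open>\<omega>\<close> requires \<open>\<Phi> > 0\<close>.\<close>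

text \<open>The exponent 3/2 has a simple origin. The relation c (n^2 - 1) = m^2 - 1 makes c of
  order n^-2, so for fixed x the value of y is about n sqrt((x^2 - 1) / (m^2 - 1)); near x = 1 the
  term x y in \<Phi>' therefore looks like n sqrt(x - 1), and one more integration gives n (x -
  1)^(3/2). The condition \<Phi>'(1) = 1 does not scale with n, so the linear term is lost against
  this, and A and B enter only at second order because the two conditions at 1 fix both constants of
  integration. The delicate point is uniformity: the place where \<Phi> becomes negative has to be
  chosen from a alone, before b. This is why A and B are estimated by C n with an explicit C
  depending only on m, instead of passing to a limit. The variable x is a moment map for the
  rotation of the fibres. The gradient of a function f(s) is a multiple of the Euler field of the
  fibre with coefficient f'(s) / x'(s), up to sign, and holomorphy forces this coefficient to be
  constant.\<close>

no_notation fps_nth (infixl "$" 75)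

section \<open>The momentum profile\<close>

text \<open>The second and third equations determine \<open>A\<close> and \<open>B\<close>, which are \<open>O(n)\<close>. At \<open>x = 1 + e\<^sup>2\<close> their contribution
  is \<open>O(n e\<^sup>4)\<close>, while \<open>c y\<^sup>3 / 3\<close> is at least of the order of \<open>n e\<^sup>3\<close>, so the profile is negative there
  once \<open>e\<close> is small and \<open>n\<close> is large.\<close>

lemma large_n_no_positive_profile:
  fixes m :: real
  assumes m: "m > 1"
  shows "\<exists>M>1. \<forall>n>M. \<forall>A B c. c * (n\<^sup>2 - 1) = m\<^sup>2 - 1 \<longrightarrow>
    m + m * n - 4 + A * (m\<^sup>2 - 1) / 2 + B * (m^3 - 1) / 3 = 0 \<longrightarrow>
    4 * (m - 1) - (m\<^sup>2 - 1) - A * ((m^3 - 1) / 6 - (m - 1) / 2)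
      - B * ((m^4 - 1) / 12 - (m - 1) / 3) - c * (n^3 - 1) / 3 = 0 \<longrightarrow>
    (\<exists>x y. 1 < x \<and> x < m \<and> y > 0 \<and> c * (y\<^sup>2 - 1) = x\<^sup>2 - 1 \<and>
      4 * (x - 1) - (x\<^sup>2 - 1) - A * ((x^3 - 1) / 6 - (x - 1) / 2)
      - B * ((x^4 - 1) / 12 - (x - 1) / 3) - c * (y^3 - 1) / 3 < 0)"
proof -
  define D where "D = m - 1"
  have D: "D > 0" and mD: "m = 1 + D" using m by (auto simp: D_def)
  \<comment> \<open>The determinant of the two linear equations for \<open>A\<close> and
    \<open>B\<close>, written in powers of \<open>D\<close> so that its positivity is
    visible.\<close>
  define \<Delta> where "\<Delta> = D^4 / 72 * (D\<^sup>2 + 6*D + 6)"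
  have \<Delta>: "\<Delta> > 0" unfolding \<Delta>_def using D by (intro mult_pos_pos) (auto intro!: add_pos_pos)
  define P1 where "P1 = (m^3 - 1) / 6 - (m - 1) / 2"
  define P2 where "P2 = (m^4 - 1) / 12 - (m - 1) / 3"
  define Q1 where "Q1 = (m\<^sup>2 - 1) / 2"
  define Q2 where "Q2 = (m^3 - 1) / 3"
  have det: "Q2 * P1 - Q1 * P2 = \<Delta>"
    unfolding Q1_def Q2_def P1_def P2_def mD \<Delta>_def by (simp add: field_simps power2_eq_square power3_eq_cube power4_eq_xxxx)
  \<comment> \<open>\<open>C1 * n\<close> will bound both right-hand sides of the linear system;
    Cramer's rule then bounds \<open>A\<close> and \<open>B\<close> by \<open>C * n\<close>, with
    \<open>C\<close> depending only on \<open>m\<close>.\<close>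
  define C1 where "C1 = 4 + 2 * m + 4 * m + m\<^sup>2 + m\<^sup>2"
  define C where "C = C1 * (\<bar>P1\<bar> + \<bar>P2\<bar> + \<bar>Q1\<bar> + \<bar>Q2\<bar>) / \<Delta>"
  have C1: "C1 > 0" unfolding C1_def using m by (intro add_pos_pos) auto
  have C: "C \<ge> 0" unfolding C_def using C1 \<Delta> by (intro divide_nonneg_pos mult_nonneg_nonneg) auto
  \<comment> \<open>The entry \<open>sqrt D / 2\<close> keeps \<open>1 + e^2\<close> below
    \<open>m\<close>. The last entry makes the terms with \<open>A\<close> and \<open>B\<close>,
    together at most \<open>2 * C * n * e^4\<close>, no larger than half of
    \<open>n * e^3 / (3 * m)\<close>, which is the lower bound for
    \<open>c * y^3 / 3\<close>.\<close>
  define e where "e = min (min 1 (sqrt D / 2)) (1 / (6 * m * (2 * C + 1)))"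
  define d where "d = e\<^sup>2"
  have e: "e > 0" unfolding e_def using D m C by (auto intro!: divide_pos_pos mult_pos_pos)
  have e1: "e \<le> 1" unfolding e_def by auto
  have "e \<le> sqrt D / 2" unfolding e_def by auto
  also have "\<dots> < sqrt D" using D by simp
  finally have "e\<^sup>2 < (sqrt D)\<^sup>2" using e by (intro power_strict_mono) auto
  hence dD: "d < D" using D by (simp add: d_def)
  have d: "d > 0" "d \<le> 1" using e e1 by (auto simp: d_def power_le_one)
  have "e \<le> 1 / (6 * m * (2 * C + 1))" unfolding e_def by auto
  moreover have "6 * m * (2 * C + 1) > 0" using m C by (intro mult_pos_pos) auto
  ultimately have eC: "e * (6 * m * (2 * C + 1)) \<le> 1" by (simp add: field_simps)
  \<comment> \<open>Beyond this threshold the terms that do not grow with \<open>n\<close>, at most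
    \<open>4 * d + c / 3\<close>, stay below the other half. The entry 2 keeps
    \<open>n^2 - 1\<close> away from 0.\<close>
  define M where "M = max 2 (6 * m * (4 * d + m\<^sup>2) / e^3)"
  have step: "\<exists>x y. 1 < x \<and> x < m \<and> y > 0 \<and> c * (y\<^sup>2 - 1) = x\<^sup>2 - 1 \<and>
      4 * (x - 1) - (x\<^sup>2 - 1) - A * ((x^3 - 1) / 6 - (x - 1) / 2)
      - B * ((x^4 - 1) / 12 - (x - 1) / 3) - c * (y^3 - 1) / 3 < 0"
    if n: "n > M" and c: "c * (n\<^sup>2 - 1) = m\<^sup>2 - 1"
      and i: "m + m * n - 4 + A * (m\<^sup>2 - 1) / 2 + B * (m^3 - 1) / 3 = 0"
      and ii: "4 * (m - 1) - (m\<^sup>2 - 1) - A * ((m^3 - 1) / 6 - (m - 1) / 2)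
      - B * ((m^4 - 1) / 12 - (m - 1) / 3) - c * (n^3 - 1) / 3 = 0" for n A B c
  proof -
    have n2: "n > 2" and nM: "n > 6 * m * (4 * d + m\<^sup>2) / e^3" using n by (auto simp: M_def)
    have n4: "n\<^sup>2 \<ge> 4" using power_mono[of 2 n 2] n2 by simp
    have n21: "n\<^sup>2 - 1 > 0" using n4 by simp
    have m21: "m\<^sup>2 - 1 > 0" using m by (simp add: one_less_power)
    have ceq: "c = (m\<^sup>2 - 1) / (n\<^sup>2 - 1)" using c n21 by (simp add: field_simps)
    have cpos: "c > 0" unfolding ceq using n21 m21 by simp
    have n31: "n^3 - 1 \<ge> 0" using n2 by (simp add: one_le_power)
    \<comment> \<open>As \<open>c\<close> decays like \<open>n^-2\<close>, this leaves
      \<open>c * (n^3 - 1)\<close> of order \<open>n\<close>, the same growth as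
      \<open>m * n\<close> in \<open>r1\<close>.\<close>
    have "n^3 - 1 \<le> 2 * n * (n\<^sup>2 - 1)"
    proof -
      have "2 * n * (n\<^sup>2 - 1) - (n^3 - 1) = n * (n\<^sup>2 - 2) + 1"
        by (simp add: algebra_simps power2_eq_square power3_eq_cube)
      moreover have "n\<^sup>2 > 2" using n4 by simp
      hence "n * (n\<^sup>2 - 2) \<ge> 0" using n2 by (intro mult_nonneg_nonneg) auto
      ultimately show ?thesis by linarith
    qed
    hence "c * (n^3 - 1) \<le> c * (2 * n * (n\<^sup>2 - 1))" using cpos by (intro mult_left_mono) auto
    also have "\<dots> = 2 * n * (m\<^sup>2 - 1)" unfolding c[symmetric] by (simp add: mult_ac)
    finally have cn: "c * (n^3 - 1) \<le> 2 * n * (m\<^sup>2 - 1)" .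
    have cn0: "c * (n^3 - 1) \<ge> 0" using cpos n31 by auto
    define r1 where "r1 = 4 - m - m * n"
    define r2 where "r2 = 4 * (m - 1) - (m\<^sup>2 - 1) - c * (n^3 - 1) / 3"
    have s1: "A * Q1 + B * Q2 = r1" using i by (simp add: Q1_def Q2_def r1_def)
    have s2: "A * P1 + B * P2 = r2" using ii by (simp add: P1_def P2_def r2_def)
    have nm: "m \<le> m * n" "m\<^sup>2 \<le> m\<^sup>2 * n" using m n2 by auto
    have m20: "0 \<le> m\<^sup>2 * n" "0 \<le> m * n" using m n2 by auto
    have C1n: "C1 * n = 4 * n + 6 * (m * n) + 2 * (m\<^sup>2 * n)" by (simp add: C1_def algebra_simps)
    have r1: "\<bar>r1\<bar> \<le> C1 * n"
    proof -
      have "\<bar>r1\<bar> \<le> 4 + m + m * n" unfolding r1_def using m n2 mult_pos_pos[of m n] by linarith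
      also have "\<dots> \<le> 4 * n + m * n + m * n" using nm n2 by linarith
      also have "\<dots> \<le> C1 * n" unfolding C1n using nm m20 m n2 by (simp only: mult.commute[of n])
      finally show ?thesis .
    qed
    have r2: "\<bar>r2\<bar> \<le> C1 * n"
    proof -
      have "\<bar>r2\<bar> \<le> 4 * m + m\<^sup>2 + n * m\<^sup>2"
      proof -
        have "2 * n * (m\<^sup>2 - 1) \<le> 2 * (n * m\<^sup>2)" "0 \<le> n * m\<^sup>2" using n2 by auto
        moreover have "0 \<le> z \<Longrightarrow> z \<le> 2 * q \<Longrightarrow> 0 \<le> q \<Longrightarrow> 0 < p - 1 \<Longrightarrow>
          \<bar>4 * (m - 1) - (p - 1) - z / 3\<bar> \<le> 4 * m + p + q" for z q p :: real
          using m by (simp add: abs_le_iff field_simps)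
        ultimately show ?thesis unfolding r2_def using cn cn0 m21 by (meson order_trans)
      qed
      also have "\<dots> \<le> C1 * n" unfolding C1n using nm m20 m n2 by (simp only: mult.commute[of n])
      finally show ?thesis .
    qed
    have A\<Delta>: "A * \<Delta> = r2 * Q2 - r1 * P2" unfolding det[symmetric] s1[symmetric] s2[symmetric] by (simp add: algebra_simps)
    have B\<Delta>: "B * \<Delta> = r1 * P1 - r2 * Q1" unfolding det[symmetric] s1[symmetric] s2[symmetric] by (simp add: algebra_simps)
    have lin: "\<bar>r2 * q - r1 * p\<bar> \<le> C1 * n * (\<bar>q\<bar> + \<bar>p\<bar>)" for p q
    proof -
      have "\<bar>r2 * q - r1 * p\<bar> \<le> \<bar>r2\<bar> * \<bar>q\<bar> + \<bar>r1\<bar> * \<bar>p\<bar>" by (metis abs_mult abs_triangle_ineq4)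
      also have "\<dots> \<le> C1 * n * \<bar>q\<bar> + C1 * n * \<bar>p\<bar>" using r1 r2 by (intro add_mono mult_right_mono) auto
      finally show ?thesis by (simp add: algebra_simps)
    qed
    have "\<bar>A\<bar> * \<Delta> \<le> C1 * n * (\<bar>Q2\<bar> + \<bar>P2\<bar>)"
      using lin[of Q2 P2] \<Delta> unfolding A\<Delta>[symmetric] by (simp add: abs_mult)
    also have "\<dots> \<le> C1 * n * (\<bar>P1\<bar> + \<bar>P2\<bar> + \<bar>Q1\<bar> + \<bar>Q2\<bar>)" using C1 n2 by (intro mult_left_mono) auto
    finally have Ab: "\<bar>A\<bar> \<le> C * n" unfolding C_def using \<Delta> by (simp add: field_simps)
    have "\<bar>B\<bar> * \<Delta> \<le> C1 * n * (\<bar>Q1\<bar> + \<bar>P1\<bar>)"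
      using lin[of Q1 P1] \<Delta> unfolding abs_minus_commute[of "r2 * Q1"] B\<Delta>[symmetric] by (simp add: abs_mult)
    also have "\<dots> \<le> C1 * n * (\<bar>P1\<bar> + \<bar>P2\<bar> + \<bar>Q1\<bar> + \<bar>Q2\<bar>)" using C1 n2 by (intro mult_left_mono) auto
    finally have Bb: "\<bar>B\<bar> \<le> C * n" unfolding C_def using \<Delta> by (simp add: field_simps)
    define x where "x = 1 + d"
    define y where "y = sqrt (1 + (x\<^sup>2 - 1) / c)"
    have xx: "x\<^sup>2 - 1 = d * (2 + d)" by (simp add: x_def power2_eq_square algebra_simps)
    have y2: "y\<^sup>2 = 1 + (x\<^sup>2 - 1) / c" unfolding y_def using cpos d xx by simp
    have ypos: "y > 0" unfolding y_def using cpos d xx by (simp add: add_pos_nonneg)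
    have cy: "c * (y\<^sup>2 - 1) = x\<^sup>2 - 1" unfolding y2 using cpos by simp
    \<comment> \<open>The polynomials multiplying \<open>A\<close> and \<open>B\<close> are the
      double integrals from 1 of \<open>t\<close> and \<open>t^2\<close>; hence the factor
      \<open>d^2 = e^4\<close>, which loses against \<open>e^3\<close> for small
      \<open>e\<close>.\<close>
    have p1: "(x^3 - 1) / 6 - (x - 1) / 2 = d\<^sup>2 * (d + 3) / 6"
      by (simp add: x_def field_simps power2_eq_square power3_eq_cube power4_eq_xxxx)
    have p2: "(x^4 - 1) / 12 - (x - 1) / 3 = d\<^sup>2 * (d\<^sup>2 + 4 * d + 6) / 12"
      by (simp add: x_def field_simps power2_eq_square power3_eq_cube power4_eq_xxxx)
    have d2: "d\<^sup>2 \<le> 1" using d by (simp add: power_le_one)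
    have q1: "0 \<le> d\<^sup>2 * (d + 3) / 6" "d\<^sup>2 * (d + 3) / 6 \<le> d\<^sup>2"
      using d mult_left_mono[of "d+3" 6 "d\<^sup>2"] by auto
    have q2: "0 \<le> d\<^sup>2 * (d\<^sup>2 + 4 * d + 6) / 12" "d\<^sup>2 * (d\<^sup>2 + 4 * d + 6) / 12 \<le> d\<^sup>2"
      using d d2 mult_left_mono[of "d\<^sup>2 + 4*d+6" 12 "d\<^sup>2"] by auto
    have Ap: "- A * (d\<^sup>2 * (d + 3) / 6) \<le> C * n * d\<^sup>2"
    proof -
      have "- A * (d\<^sup>2 * (d + 3) / 6) \<le> \<bar>A\<bar> * (d\<^sup>2 * (d + 3) / 6)" using q1 by (intro mult_right_mono) auto
      also have "\<dots> \<le> C * n * d\<^sup>2" using Ab q1 by (intro mult_mono) auto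
      finally show ?thesis .
    qed
    have Bp: "- B * (d\<^sup>2 * (d\<^sup>2 + 4 * d + 6) / 12) \<le> C * n * d\<^sup>2"
    proof -
      have "- B * (d\<^sup>2 * (d\<^sup>2 + 4 * d + 6) / 12) \<le> \<bar>B\<bar> * (d\<^sup>2 * (d\<^sup>2 + 4 * d + 6) / 12)"
        using q2 by (intro mult_right_mono) auto
      also have "\<dots> \<le> C * n * d\<^sup>2" using Bb q2 by (intro mult_mono) auto
      finally show ?thesis .
    qed
    \<comment> \<open>At a fixed \<open>x\<close> the value \<open>y\<close> grows linearly in
      \<open>n\<close>, since \<open>y^2\<close> is at least \<open>2 * d / c\<close> and
      \<open>1 / c\<close> is of order \<open>n^2\<close>.\<close>
    have yl: "e * n / (2 * m) \<le> y"
    proof (rule power2_le_imp_le)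
      have "(e * n / (2 * m))\<^sup>2 = d * (n\<^sup>2 / (4 * m\<^sup>2))" by (simp add: d_def power_mult_distrib power_divide)
      also have "n\<^sup>2 / (4 * m\<^sup>2) \<le> 2 * (n\<^sup>2 - 1) / (m\<^sup>2 - 1)"
      proof -
        have a: "n\<^sup>2 \<le> 2 * (n\<^sup>2 - 1)" using n4 by simp
        have "n\<^sup>2 / (4 * m\<^sup>2) \<le> (2 * (n\<^sup>2 - 1)) / (m\<^sup>2 - 1)"
          using a m21 n21 by (intro frac_le) auto
        thus ?thesis .
      qed
      also have "d * (2 * (n\<^sup>2 - 1) / (m\<^sup>2 - 1)) = (2 * d) / c" unfolding ceq by simp
      also have "\<dots> \<le> y\<^sup>2"
      proof -
        have "2 * d / c \<le> d * (2 + d) / c" using d cpos by (intro divide_right_mono) (auto simp: algebra_simps)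
        thus ?thesis unfolding y2 xx by simp
      qed
      finally show "(e * n / (2 * m))\<^sup>2 \<le> y\<^sup>2" using d by (auto intro: mult_left_mono)
    qed (use ypos in auto)
    define X where "X = n * e^3 / m"
    \<comment> \<open>\<open>c * y^2 = c + x^2 - 1\<close> stays above \<open>2 * d\<close> however
      small \<open>c\<close> is, so the remaining factor \<open>y\<close> contributes a full power
      of \<open>n\<close>.\<close>
    have cy3: "c * y^3 \<ge> X"
    proof -
      have "c * y^3 = (c * y\<^sup>2) * y" by (simp add: power2_eq_square power3_eq_cube)
      also have "c * y\<^sup>2 = c + d * (2 + d)" using cy xx by (simp add: algebra_simps)
      also have "(c + d * (2 + d)) * y \<ge> (2 * d) * (e * n / (2 * m))"
        using cpos d yl ypos e n2 m by (intro mult_mono) (auto simp: algebra_simps)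
      finally show ?thesis by (simp add: X_def d_def power2_eq_square power3_eq_cube mult_ac)
    qed
    have cm: "c \<le> m\<^sup>2"
    proof -
      have "c * 1 \<le> c * (n\<^sup>2 - 1)" using cpos n4 by (intro mult_left_mono) auto
      thus ?thesis using c by simp
    qed
    have fin: "4 * d + C * n * d\<^sup>2 + C * n * d\<^sup>2 + c / 3 < X / 3"
    proof -
      have "6 * m * (4 * d + m\<^sup>2) < n * e^3" using nM e by (simp add: field_simps)
      hence "6 * (4 * d + m\<^sup>2) * m < n * e^3" by (simp add: mult_ac)
      hence "6 * (4 * d + m\<^sup>2) < X" using m by (simp add: X_def pos_less_divide_eq)
      hence 1: "4 * d + c / 3 < X / 6" using cm zero_le_power2[of m] by argo
      have "X * (e * (6 * m * (2 * C + 1))) \<le> X * 1"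
        using eC m n2 e by (intro mult_left_mono) (auto simp: X_def)
      moreover have "X * (e * (6 * m * (2 * C + 1))) = 6 * n * d\<^sup>2 * (2 * C + 1)"
        using m by (simp add: X_def d_def power2_eq_square power3_eq_cube)
      moreover have "6 * n * d\<^sup>2 \<ge> 0" using n2 by auto
      ultimately have "12 * C * n * d\<^sup>2 \<le> X" by (simp add: algebra_simps)
      thus ?thesis using 1 by (simp add: mult_ac)
    qed
    have "4 * (x - 1) - (x\<^sup>2 - 1) - A * ((x^3 - 1) / 6 - (x - 1) / 2)
      - B * ((x^4 - 1) / 12 - (x - 1) / 3) - c * (y^3 - 1) / 3 < 0"
    proof -
      have "c * (y^3 - 1) / 3 = c * y^3 / 3 - c / 3" by (simp add: right_diff_distrib diff_divide_distrib)
      moreover have "4 * (x - 1) = 4 * d" "0 \<le> d * (2 + d)" using d by (auto simp: x_def)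
      ultimately show ?thesis unfolding p1 p2 xx
        using Ap[folded minus_mult_left] Bp[folded minus_mult_left] cy3 fin by linarith
    qed
    moreover have "1 < x" "x < m" using d dD by (auto simp: x_def mD)
    ultimately show ?thesis using ypos cy by blast
  qed
  have "M > 1" by (simp add: M_def)
  thus ?thesis using step by blast
qed

section \<open>First integrals of the profile equation\<close>

text \<open>Evaluates a first integral from the boundary data at one end; comparison with the other
  end turns it into an equation between the constants.\<close>

lemma eq_limits_of_deriv_zero:
  fixes f :: "real \<Rightarrow> real"
  assumes "\<And>s. (f has_real_derivative 0) (at s)"
    and "(f \<longlongrightarrow> l) at_bot"
  shows "f s = l" "(f \<longlongrightarrow> l') at_top \<Longrightarrow> l' = l"
proof -
  have c: "f t = f s" for t s
    using DERIV_isconst_all[of f t s] assms(1) by blast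
  have f: "f = (\<lambda>_. f s)" by (rule ext) (rule c)
  have "((\<lambda>_::real. f s) \<longlongrightarrow> l) at_bot" using assms(2) f by metis
  thus l: "f s = l" by (simp add: tendsto_const_iff)
  assume "(f \<longlongrightarrow> l') at_top"
  hence "((\<lambda>_::real. f s) \<longlongrightarrow> l') at_top" using f by metis
  thus "l' = l" using l by (simp add: tendsto_const_iff)
qed

text \<open>With \<Phi> = x p as a function of x, d/dx is (1/p) d/ds. Thus
  \<open>p / x + p' / p\<close> is the logarithmic derivative of x p in s, and x times it is
  \<Phi>'(x). The first integrals \<open>E0\<close>, \<open>E1\<close>, \<open>E2\<close> express
  the relation between x and y, then \<Phi>', then \<Phi>; their values at the two ends give the
  three equations.\<close>

lemma coupled_profile_equations:
  fixes x y p p' q G' :: "real \<Rightarrow> real" and m n A B c :: real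
  assumes m: "m > 1"
    and dx: "\<And>s. (x has_real_derivative p s) (at s)"
    and dp: "\<And>s. (p has_real_derivative p' s) (at s)"
    and dy: "\<And>s. (y has_real_derivative q s) (at s)"
    and dG: "\<And>s. ((\<lambda>s. p s / x s + p' s / p s) has_real_derivative G' s) (at s)"
    and pos: "\<And>s. x s > 0" "\<And>s. p s > 0" "\<And>s. y s > 0"
    and xlim: "(x \<longlongrightarrow> 1) at_bot" "(x \<longlongrightarrow> m) at_top"
    and ylim: "(y \<longlongrightarrow> 1) at_bot" "(y \<longlongrightarrow> n) at_top"
    and plim: "(p \<longlongrightarrow> 0) at_bot" "(p \<longlongrightarrow> 0) at_top"
    and p'lim: "((\<lambda>s. p' s / p s) \<longlongrightarrow> 1) at_bot" "((\<lambda>s. p' s / p s) \<longlongrightarrow> -1) at_top"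
    and ratio: "\<And>s. x s * p s = c * (y s * q s)"
    and ode: "\<And>s. (- 2 - (p s / x s + p' s / p s)) / x s - G' s / p s - y s / x s - q s / p s
      = A + B * x s"
  shows "c * (n\<^sup>2 - 1) = m\<^sup>2 - 1"
    and "m + m * n - 4 + A * (m\<^sup>2 - 1) / 2 + B * (m^3 - 1) / 3 = 0"
    and "4 * (m - 1) - (m\<^sup>2 - 1) - A * ((m^3 - 1) / 6 - (m - 1) / 2)
      - B * ((m^4 - 1) / 12 - (m - 1) / 3) - c * (n^3 - 1) / 3 = 0"
    and "\<And>\<xi> \<eta>. 1 < \<xi> \<Longrightarrow> \<xi> < m \<Longrightarrow> \<eta> > 0 \<Longrightarrow> c * (\<eta>\<^sup>2 - 1) = \<xi>\<^sup>2 - 1 \<Longrightarrow>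
      4 * (\<xi> - 1) - (\<xi>\<^sup>2 - 1) - A * ((\<xi>^3 - 1) / 6 - (\<xi> - 1) / 2)
      - B * ((\<xi>^4 - 1) / 12 - (\<xi> - 1) / 3) - c * (\<eta>^3 - 1) / 3 > 0"
proof -
  have x0: "x s \<noteq> 0" "p s \<noteq> 0" for s using pos[of s] by auto
  define E0 where "E0 = (\<lambda>s. (x s)\<^sup>2 - c * (y s)\<^sup>2)"
  have E0: "(E0 has_real_derivative 0) (at s)" for s
    unfolding E0_def
    by (rule DERIV_cong, (rule derivative_eq_intros dx dy refl)+) (use ratio[of s] in \<open>simp add: algebra_simps\<close>)
  have E0b: "(E0 \<longlongrightarrow> 1\<^sup>2 - c * 1\<^sup>2) at_bot" and E0t: "(E0 \<longlongrightarrow> m\<^sup>2 - c * n\<^sup>2) at_top"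
    unfolding E0_def by (intro tendsto_intros xlim ylim)+
  have c: "(x s)\<^sup>2 - c * (y s)\<^sup>2 = 1 - c" for s
    using eq_limits_of_deriv_zero(1)[OF E0 E0b, of s] by (simp add: E0_def)
  show cmn: "c * (n\<^sup>2 - 1) = m\<^sup>2 - 1"
    using eq_limits_of_deriv_zero(2)[OF E0 E0b E0t] by (simp add: algebra_simps)

  define g where "g = (\<lambda>s. p s / x s + p' s / p s)"
  have dg: "(g has_real_derivative G' s) (at s)" for s using dG by (simp add: g_def)
  \<comment> \<open>\<open>x s * g s\<close> is \<Phi>'(x); the other summands are antiderivatives
    in x of the remaining terms of the equation, which becomes exact in s after multiplication by
    \<open>x s * p s\<close>.\<close>
  define E1 where "E1 = (\<lambda>s. x s * g s + 2 * x s + x s * y s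
    + A / 2 * (x s)\<^sup>2 + B / 3 * (x s)^3)"
  have E1: "(E1 has_real_derivative 0) (at s)" for s
  proof -
    have eq: "p s * g s + x s * G' s + 2 * p s + (p s * y s + x s * q s)
      + A * x s * p s + B * (x s)\<^sup>2 * p s = 0"
    proof -
      have "x s * p s * ((- 2 - g s) / x s - G' s / p s - y s / x s - q s / p s)
        = x s * p s * (A + B * x s)" using ode[of s] by (simp add: g_def)
      moreover have "x s * p s * ((- 2 - g s) / x s - G' s / p s - y s / x s - q s / p s)
        = p s * (-2 - g s) - x s * G' s - p s * y s - x s * q s"
        using x0[of s] by (simp add: field_simps)
      ultimately show ?thesis by (simp add: algebra_simps power2_eq_square)
    qed
    show ?thesis unfolding E1_def
      by (rule DERIV_cong, (rule derivative_intros dx dy dg)+)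
        (use eq in \<open>simp add: algebra_simps power2_eq_square\<close>)
  qed
  have E1': "E1 s = p s + x s * (p' s / p s) + 2 * x s + x s * y s
    + A / 2 * (x s)\<^sup>2 + B / 3 * (x s)^3" for s
    using x0[of s] by (simp add: E1_def g_def field_simps)
  have E1b: "(E1 \<longlongrightarrow> 0 + 1 * 1 + 2 * 1 + 1 * 1 + A / 2 * 1\<^sup>2 + B / 3 * 1^3) at_bot"
    and E1t: "(E1 \<longlongrightarrow> 0 + m * (-1) + 2 * m + m * n + A / 2 * m\<^sup>2 + B / 3 * m^3) at_top"
    unfolding E1' by (intro tendsto_intros xlim ylim plim p'lim; simp)+
  \<comment> \<open>The 4 collects the limits at minus infinity of \<Phi>', 2 x and x y, namely 1 +
    2 + 1.\<close>
  define K where "K = 4 + A / 2 + B / 3"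
  have K: "E1 s = K" for s using eq_limits_of_deriv_zero(1)[OF E1 E1b, of s] by (simp add: K_def)
  show "m + m * n - 4 + A * (m\<^sup>2 - 1) / 2 + B * (m^3 - 1) / 3 = 0"
    using eq_limits_of_deriv_zero(2)[OF E1 E1b E1t] by (simp add: field_simps)

  define E2 where "E2 = (\<lambda>s. x s * p s - K * x s + (x s)\<^sup>2 + A / 6 * (x s)^3 + B / 12 * (x s)^4
    + c / 3 * (y s)^3)"
  have E2: "(E2 has_real_derivative 0) (at s)" for s
  proof -
    have 1: "p s * (p s + x s * (p' s / p s) + 2 * x s + x s * y s
      + A / 2 * (x s)\<^sup>2 + B / 3 * (x s)^3) = p s * K" using K[of s] E1'[of s] by simp
    have eq: "p s * p s + x s * p' s - K * p s + 2 * x s * p s + A * (x s)\<^sup>2 * p s / 2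
      + B * (x s)^3 * p s / 3 + x s * p s * y s = 0"
      using 1 x0[of s] by (simp add: algebra_simps)
    \<comment> \<open>In differentials: x y dx = c y^2 dy, so the coupling term integrates to c y^3
      / 3.\<close>
    have eq': "x s * p s * y s = c * (y s)\<^sup>2 * q s"
      unfolding ratio by (simp add: power2_eq_square)
    show ?thesis unfolding E2_def
      by (rule DERIV_cong, (rule derivative_intros dx dy dp)+)
        (use eq eq' in \<open>simp add: algebra_simps\<close>)
  qed
  have E2b: "(E2 \<longlongrightarrow> 1 * 0 - K * 1 + 1\<^sup>2 + A / 6 * 1^3 + B / 12 * 1^4 + c / 3 * 1^3) at_bot"
    and E2t: "(E2 \<longlongrightarrow> m * 0 - K * m + m\<^sup>2 + A / 6 * m^3 + B / 12 * m^4 + c / 3 * n^3) at_top"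
    unfolding E2_def by (intro tendsto_intros xlim ylim plim; simp)+
  show "4 * (m - 1) - (m\<^sup>2 - 1) - A * ((m^3 - 1) / 6 - (m - 1) / 2)
      - B * ((m^4 - 1) / 12 - (m - 1) / 3) - c * (n^3 - 1) / 3 = 0"
    using eq_limits_of_deriv_zero(2)[OF E2 E2b E2t] by (simp add: K_def field_simps)

  fix \<xi> \<eta> :: real
  assume \<xi>: "1 < \<xi>" "\<xi> < m" and \<eta>: "\<eta> > 0" "c * (\<eta>\<^sup>2 - 1) = \<xi>\<^sup>2 - 1"
  \<comment> \<open>Some s has \<open>x s = \<xi>\<close>. There \<open>y s\<close> is the positive
    solution \<eta> of the relation between x and y, so the expression to be estimated is the value
    x p of \<Phi> at \<xi>.\<close>
  have "\<forall>\<^sub>F s in at_bot. x s < \<xi>" using order_tendstoD(2)[OF xlim(1) \<xi>(1)] .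
  then obtain s1 where s1: "x s1 < \<xi>" by (auto simp: eventually_at_bot_linorder)
  have "\<forall>\<^sub>F s in at_top. x s > \<xi>" using order_tendstoD(1)[OF xlim(2) \<xi>(2)] .
  then obtain s2 where s2: "x s2 > \<xi>" by (auto simp: eventually_at_top_linorder)
  have cont: "isCont x s" for s using dx[of s] DERIV_isCont by blast
  have "\<exists>s. x s = \<xi>"
  proof (cases "s1 \<le> s2")
    case True thus ?thesis using IVT[of x s1 \<xi> s2] s1 s2 cont by auto
  next
    case False thus ?thesis using IVT2[of x s1 \<xi> s2] s1 s2 cont by auto
  qed
  then obtain s where s: "x s = \<xi>" by blast
  have m2: "m\<^sup>2 - 1 > 0" using m by (simp add: one_less_power)
  hence c0: "c \<noteq> 0" using cmn by auto
  have "c * \<eta>\<^sup>2 - c = \<xi>\<^sup>2 - 1" using \<eta>(2) by (simp add: right_diff_distrib)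
  hence "c * (y s)\<^sup>2 = c * \<eta>\<^sup>2" using c[of s] unfolding s by linarith
  hence "(y s)\<^sup>2 = \<eta>\<^sup>2" using c0 by simp
  hence y: "y s = \<eta>" using pos(3)[of s] \<eta> by simp
  have "x s * p s > 0" using pos by simp
  moreover have "E2 s = - K + 1 + A / 6 + B / 12 + c / 3"
    using eq_limits_of_deriv_zero(1)[OF E2 E2b, of s] by simp
  ultimately have "K * \<xi> - \<xi>\<^sup>2 - A / 6 * \<xi>^3 - B / 12 * \<xi>^4 - c / 3 * \<eta>^3
    - K + 1 + A / 6 + B / 12 + c / 3 > 0" unfolding E2_def s y by linarith
  thus "4 * (\<xi> - 1) - (\<xi>\<^sup>2 - 1) - A * ((\<xi>^3 - 1) / 6 - (\<xi> - 1) / 2)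
      - B * ((\<xi>^4 - 1) / 12 - (\<xi> - 1) / 3) - c * (\<eta>^3 - 1) / 3 > 0"
    by (simp add: K_def field_simps)
qed

section \<open>Differentiable functions of one real variable\<close>

text \<open>The derivative is an existential witness, so closure under sums, products and quotients
  only requires a formula for it. \<open>smooth_on\<close> instead speaks of
  \<open>frechet_derivative\<close> in every direction.\<close>

primrec times_differentiable :: "nat \<Rightarrow> (real \<Rightarrow> real) \<Rightarrow> bool" where
  "times_differentiable 0 f \<longleftrightarrow> True"
| "times_differentiable (Suc k) f \<longleftrightarrow>
     (\<exists>f'. (\<forall>s. (f has_real_derivative f' s) (at s)) \<and> times_differentiable k f')"

lemma times_differentiable_Suc: "times_differentiable (Suc k) f \<Longrightarrow> times_differentiable k f"
proof (induction k arbitrary: f)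
  case (Suc k)
  then obtain f' where "\<forall>s. (f has_real_derivative f' s) (at s)" "times_differentiable (Suc k) f'"
    by (metis times_differentiable.simps(2))
  thus ?case using Suc.IH times_differentiable.simps(2) by blast
qed simp

lemma times_differentiable_const: "times_differentiable k (\<lambda>_. c)"
proof (induction k arbitrary: c)
  case (Suc k)
  show ?case using Suc[of 0] by (auto intro!: exI[of _ "\<lambda>_. 0"])
qed simp

lemma times_differentiable_add:
  "times_differentiable k f \<Longrightarrow> times_differentiable k g \<Longrightarrow> times_differentiable k (\<lambda>s. f s + g s)"
proof (induction k arbitrary: f g)
  case (Suc k)
  then obtain f' g' where "\<And>s. (f has_real_derivative f' s) (at s)" "times_differentiable k f'"
    "\<And>s. (g has_real_derivative g' s) (at s)" "times_differentiable k g'" by auto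
  thus ?case using Suc.IH[of f' g'] by (auto intro!: exI[of _ "\<lambda>s. f' s + g' s"] derivative_intros)
qed simp

lemma times_differentiable_mult:
  "times_differentiable k f \<Longrightarrow> times_differentiable k g \<Longrightarrow> times_differentiable k (\<lambda>s. f s * g s)"
proof (induction k arbitrary: f g)
  case (Suc k)
  then obtain f' g' where D: "\<And>s. (f has_real_derivative f' s) (at s)" "times_differentiable k f'"
    "\<And>s. (g has_real_derivative g' s) (at s)" "times_differentiable k g'" by auto
  define h where "h = (\<lambda>s. f' s * g s + g' s * f s)"
  have "times_differentiable k h" unfolding h_def
    using Suc times_differentiable_Suc D by (intro times_differentiable_add Suc.IH) auto
  moreover have "((\<lambda>s. f s * g s) has_real_derivative h s) (at s)" for s
    unfolding h_def by (rule DERIV_mult) (use D in auto)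
  ultimately show ?case by auto
qed simp

lemma times_differentiable_diff:
  assumes "times_differentiable k f" "times_differentiable k g"
  shows "times_differentiable k (\<lambda>s. f s - g s)"
  using times_differentiable_add[OF assms(1) times_differentiable_mult[OF times_differentiable_const assms(2)], of "-1"]
  by simp

lemma times_differentiable_inverse:
  "times_differentiable k f \<Longrightarrow> (\<And>s. f s \<noteq> 0) \<Longrightarrow> times_differentiable k (\<lambda>s. inverse (f s))"
proof (induction k arbitrary: f)
  case (Suc k)
  then obtain f' where D: "\<And>s. (f has_real_derivative f' s) (at s)" "times_differentiable k f'" by auto
  have i: "times_differentiable k (\<lambda>s. inverse (f s))"
    using Suc times_differentiable_Suc by blast
  \<comment> \<open>The derivative -f' / f^2 is written as a product, so that closure under products
    and the induction hypothesis for \<open>inverse (f s)\<close> apply.\<close>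
  define g where "g = (\<lambda>s. (-1) * (inverse (f s) * (f' s * inverse (f s))))"
  have "times_differentiable k g" unfolding g_def
    by (intro times_differentiable_mult times_differentiable_const i D)
  moreover have "((\<lambda>s. inverse (f s)) has_real_derivative g s) (at s)" for s
    by (rule DERIV_cong[OF DERIV_inverse'[OF D(1)]]) (use Suc in \<open>auto simp: g_def\<close>)
  ultimately show ?case by auto
qed simp

lemma times_differentiable_divide:
  "times_differentiable k f \<Longrightarrow> times_differentiable k g \<Longrightarrow> (\<And>s. g s \<noteq> 0) \<Longrightarrow>
    times_differentiable k (\<lambda>s. f s / g s)"
  unfolding divide_inverse by (intro times_differentiable_mult times_differentiable_inverse)

lemmas times_differentiable_intros = times_differentiable_const times_differentiable_add
  times_differentiable_mult times_differentiable_diff times_differentiable_divide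

lemma smooth_on_UNIV_deriv:
  fixes u :: "real \<Rightarrow> real"
  assumes "smooth_on u UNIV"
  shows "(u has_real_derivative deriv u s) (at s)" and "smooth_on (deriv u) UNIV"
proof -
  have C: "Ck_on (Suc k) u UNIV" for k using assms unfolding smooth_on_def by blast
  hence "u differentiable (at s)" for s by auto
  thus D: "(u has_real_derivative deriv u s) (at s)" for s
    using DERIV_deriv_iff_real_differentiable by blast
  have "frechet_derivative u (at s) 1 = deriv u s" for s
    unfolding frechet_derivative_at[OF has_field_derivative_imp_has_derivative[OF D], symmetric] by simp
  hence "(\<lambda>s. frechet_derivative u (at s) 1) = deriv u" by (rule ext)
  thus "smooth_on (deriv u) UNIV" using C unfolding smooth_on_def by (metis Ck_on.simps(2))
qed

lemma smooth_on_UNIV_times_differentiable: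
  fixes u :: "real \<Rightarrow> real"
  shows "smooth_on u UNIV \<Longrightarrow> times_differentiable k u"
proof (induction k arbitrary: u)
  case (Suc k)
  thus ?case using smooth_on_UNIV_deriv[OF Suc.prems] by auto
qed simp

section \<open>Wirtinger calculus\<close>

text \<open>\<open>frechet_derivative\<close> is a choice among all derivatives at the point. Both
  functions have the same set of derivatives there, so the choices agree even if that set is
  empty.\<close>

lemma frechet_derivative_cong_open:
  assumes "open U" "x \<in> U" "\<And>y. y \<in> U \<Longrightarrow> f y = g y"
  shows "frechet_derivative f (at x) = frechet_derivative g (at x)"
proof -
  have "(f has_derivative D) (at x) \<longleftrightarrow> (g has_derivative D) (at x)" for D
    using has_derivative_transform_within_open[of f D x UNIV U g]
      has_derivative_transform_within_open[of g D x UNIV U f] assms by auto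
  thus ?thesis unfolding frechet_derivative_def by simp
qed

lemma del_cong_open:
  assumes "open U" "x \<in> U" "\<And>y. y \<in> U \<Longrightarrow> f y = g y"
  shows "del j f x = del j g x" "delbar j f x = delbar j g x"
  by (simp_all only: del_def delbar_def frechet_derivative_cong_open[OF assms])

lemma dz_cong_open:
  assumes "open U" "x \<in> U" "\<And>y. y \<in> U \<Longrightarrow> f y = g y"
  shows "dz f x = dz g x" "dzbar f x = dzbar g x"
  by (simp_all only: dz_def dzbar_def frechet_derivative_cong_open[OF assms])

lemma del_eqI:
  assumes "(f has_derivative D) (at x)"
  shows "del j f x = (D (axis j 1) - \<i> * D (axis j \<i>)) / 2"
    and "delbar j f x = (D (axis j 1) + \<i> * D (axis j \<i>)) / 2"
  unfolding del_def delbar_def frechet_derivative_at[OF assms, symmetric] by auto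

lemma dz_eqI:
  assumes "(f has_derivative D) (at x)"
  shows "dz f x = (D 1 - \<i> * D \<i>) / 2" and "dzbar f x = (D 1 + \<i> * D \<i>) / 2"
  unfolding dz_def dzbar_def frechet_derivative_at[OF assms, symmetric] by auto

lemma del_add:
  assumes "f differentiable (at x)" "g differentiable (at x)"
  shows "del j (\<lambda>y. f y + g y) x = del j f x + del j g x"
    and "delbar j (\<lambda>y. f y + g y) x = delbar j f x + delbar j g x"
proof -
  obtain D E where D: "(f has_derivative D) (at x)" and E: "(g has_derivative E) (at x)"
    using assms unfolding differentiable_def by blast
  show "del j (\<lambda>y. f y + g y) x = del j f x + del j g x"
    "delbar j (\<lambda>y. f y + g y) x = delbar j f x + delbar j g x"
    unfolding del_eqI[OF has_derivative_add[OF D E]] del_eqI[OF D] del_eqI[OF E]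
    by (simp_all add: algebra_simps add_divide_distrib diff_divide_distrib)
qed

lemma del_mult:
  assumes "f differentiable (at x)" "g differentiable (at x)"
  shows "del j (\<lambda>y. f y * g y) x = del j f x * g x + f x * del j g x"
    and "delbar j (\<lambda>y. f y * g y) x = delbar j f x * g x + f x * delbar j g x"
proof -
  obtain D E where D: "(f has_derivative D) (at x)" and E: "(g has_derivative E) (at x)"
    using assms unfolding differentiable_def by blast
  show "del j (\<lambda>y. f y * g y) x = del j f x * g x + f x * del j g x"
    "delbar j (\<lambda>y. f y * g y) x = delbar j f x * g x + f x * delbar j g x"
    unfolding del_eqI[OF has_derivative_mult[OF D E]] del_eqI[OF D] del_eqI[OF E]
    by (simp_all add: algebra_simps add_divide_distrib diff_divide_distrib)
qed

lemma del_of_real_chain: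
  fixes f :: "complex^2 \<Rightarrow> real" and q :: "real \<Rightarrow> real"
  assumes "(q has_real_derivative q') (at (f x))" "f differentiable (at x)"
  shows "del j (\<lambda>y. of_real (q (f y))) x = of_real q' * del j (\<lambda>y. of_real (f y)) x"
    and "delbar j (\<lambda>y. of_real (q (f y))) x = of_real q' * delbar j (\<lambda>y. of_real (f y)) x"
    and "(\<lambda>y. q (f y)) differentiable (at x)"
proof -
  obtain D where D: "(f has_derivative D) (at x)"
    using assms unfolding differentiable_def by blast
  have q: "((\<lambda>y. q (f y)) has_derivative (\<lambda>h. q' * D h)) (at x)"
    using has_derivative_compose[OF D has_field_derivative_imp_has_derivative[OF assms(1)]] by simp
  have 1: "((\<lambda>y. complex_of_real (q (f y))) has_derivative (\<lambda>h. of_real (q' * D h))) (at x)"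
    and 2: "((\<lambda>y. complex_of_real (f y)) has_derivative (\<lambda>h. of_real (D h))) (at x)"
    by (intro has_derivative_of_real q D)+
  show "del j (\<lambda>y. of_real (q (f y))) x = of_real q' * del j (\<lambda>y. of_real (f y)) x"
    "delbar j (\<lambda>y. of_real (q (f y))) x = of_real q' * delbar j (\<lambda>y. of_real (f y)) x"
    unfolding del_eqI[OF 1] del_eqI[OF 2] by (simp_all add: algebra_simps)
  show "(\<lambda>y. q (f y)) differentiable (at x)" using q unfolding differentiable_def by blast
qed

lemma has_derivative_coordinate:
  fixes f :: "complex \<Rightarrow> 'b::real_normed_vector"
  assumes "(f has_derivative D) (at (x $ k))"
  shows "((\<lambda>y::complex^2. f (y $ k)) has_derivative (\<lambda>h. D (h $ k))) (at x)"
  using has_derivative_compose[OF bounded_linear_imp_has_derivative[OF bounded_linear_vec_nth] assms] .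

lemma differentiable_coordinate:
  fixes f :: "complex \<Rightarrow> 'b::real_normed_vector" and x :: "complex^2"
  assumes "f differentiable (at (x $ k))"
  shows "(\<lambda>y. f (y $ k)) differentiable (at x)"
  using assms has_derivative_coordinate unfolding differentiable_def by blast

lemma del_coordinate:
  assumes "f differentiable (at (x $ k))"
  shows "del j (\<lambda>y. f (y $ k)) x = (if j = k then dz f (x $ k) else 0)"
    and "delbar j (\<lambda>y. f (y $ k)) x = (if j = k then dzbar f (x $ k) else 0)"
proof -
  obtain D where D: "(f has_derivative D) (at (x $ k))"
    using assms unfolding differentiable_def by blast
  have "D 0 = 0" using D has_derivative_linear linear_0 by blast
  thus "del j (\<lambda>y. f (y $ k)) x = (if j = k then dz f (x $ k) else 0)"
    "delbar j (\<lambda>y. f (y $ k)) x = (if j = k then dzbar f (x $ k) else 0)"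
    unfolding del_eqI[OF has_derivative_coordinate[OF D]] dz_eqI[OF D] by (simp_all add: axis_def)
qed

lemma dz_of_real_eq_cnj_dzbar:
  assumes "f differentiable (at z)"
  shows "dz (\<lambda>z. of_real (f z)) z = cnj (dzbar (\<lambda>z. of_real (f z)) z)"
proof -
  obtain D where D: "(f has_derivative D) (at z)" using assms unfolding differentiable_def by blast
  show ?thesis unfolding dz_eqI[OF has_derivative_of_real[OF D]] by simp
qed

lemma ln_norm_square:
  assumes "w \<noteq> 0"
  shows "(\<lambda>w. ln ((cmod w)\<^sup>2)) differentiable (at w)"
    and "dz (\<lambda>w. of_real (ln ((cmod w)\<^sup>2))) w = 1 / w"
    and "dzbar (\<lambda>w. of_real (ln ((cmod w)\<^sup>2))) w = 1 / cnj w"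
proof -
  have D: "((\<lambda>w. ln ((cmod w)\<^sup>2)) has_derivative (\<lambda>h. 2 * (w \<bullet> h) / (cmod w)\<^sup>2)) (at w)"
    unfolding power2_norm_eq_inner using assms
    by (auto intro!: derivative_eq_intros simp: fun_eq_iff inner_commute field_simps)
  thus "(\<lambda>w. ln ((cmod w)\<^sup>2)) differentiable (at w)" unfolding differentiable_def by blast
  have w: "complex_of_real ((cmod w)\<^sup>2) = w * cnj w" by (simp add: complex_norm_square[symmetric])
  have "Complex (Re w) (Im w) = of_real (Re w) + \<i> * of_real (Im w)" by (simp add: complex_eq_iff)
  hence 1: "of_real (Re w) + \<i> * of_real (Im w) = w" "of_real (Re w) - \<i> * of_real (Im w) = cnj w"
    by (simp_all add: complex_eq_iff)
  have "dz (\<lambda>w. of_real (ln ((cmod w)\<^sup>2))) w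
      = (of_real (Re w) - \<i> * of_real (Im w)) / of_real ((cmod w)\<^sup>2)"
    unfolding dz_eqI[OF has_derivative_of_real[OF D]]
    by (simp add: inner_complex_def diff_divide_distrib)
  also have "\<dots> = 1 / w" unfolding 1 w using assms by simp
  finally show "dz (\<lambda>w. of_real (ln ((cmod w)\<^sup>2))) w = 1 / w" .
  have "dzbar (\<lambda>w. of_real (ln ((cmod w)\<^sup>2))) w
      = (of_real (Re w) + \<i> * of_real (Im w)) / of_real ((cmod w)\<^sup>2)"
    unfolding dz_eqI[OF has_derivative_of_real[OF D]]
    by (simp add: inner_complex_def add_divide_distrib)
  also have "\<dots> = 1 / cnj w" unfolding 1 w using assms by simp
  finally show "dzbar (\<lambda>w. of_real (ln ((cmod w)\<^sup>2))) w = 1 / cnj w" .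
qed

text \<open>The function is antiholomorphic. Applied to the dzbar derivative of the logarithm of
  |w|^2, this says that this logarithm has zero complex Hessian off w = 0, so that the Hessian of s
  comes entirely from the base.\<close>

lemma dz_inverse_cnj:
  assumes "w \<noteq> 0"
  shows "(\<lambda>w. c / cnj w) differentiable (at w)" and "dz (\<lambda>w. c / cnj w) w = 0"
proof -
  have D: "((\<lambda>w. c / cnj w) has_derivative (\<lambda>h. - c * cnj h / (cnj w)\<^sup>2)) (at w)"
    using assms by (auto intro!: derivative_eq_intros simp: fun_eq_iff field_simps power2_eq_square)
  thus "(\<lambda>w. c / cnj w) differentiable (at w)" unfolding differentiable_def by blast
  show "dz (\<lambda>w. c / cnj w) w = 0" unfolding dz_eqI[OF D] by (simp add: algebra_simps)
qed

text \<open>The curvature conditions concern logarithms of smooth positive functions. The first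
  derivatives of \<open>ln h\<close> are quotients \<open>D v z / h z\<close>, which can be
  differentiated once more.\<close>

lemma smooth_on_ln_differentiable:
  fixes h :: "complex \<Rightarrow> real"
  assumes "smooth_on h V" "open V" "z \<in> V" "\<And>z. z \<in> V \<Longrightarrow> h z > 0"
  shows "(\<lambda>z. ln (h z)) differentiable (at z)"
    and "dzbar (\<lambda>z. of_real (ln (h z))) differentiable (at z)"
proof -
  have C: "Ck_on (Suc (Suc 0)) h V" using assms(1) unfolding smooth_on_def by blast
  define D where "D = (\<lambda>v z. frechet_derivative h (at z) v)"
  have hd: "(h has_derivative (\<lambda>v. D v z)) (at z)" if "z \<in> V" for z
    using C that by (simp add: D_def frechet_derivative_works[symmetric])
  have Dd: "D v differentiable (at z)" if "z \<in> V" for v z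
    using C that by (simp add: D_def)
  have lnd: "((\<lambda>z. ln (h z)) has_derivative (\<lambda>v. D v z / h z)) (at z)" if "z \<in> V" for z
    using hd[OF that] assms(4)[OF that]
    by (auto intro!: derivative_eq_intros simp: fun_eq_iff field_simps)
  show "(\<lambda>z. ln (h z)) differentiable (at z)"
    using lnd assms(3) unfolding differentiable_def by blast
  have eq: "dzbar (\<lambda>z. of_real (ln (h z))) z =
    (of_real (D 1 z / h z) + \<i> * of_real (D \<i> z / h z)) / 2" if "z \<in> V" for z
    unfolding dz_eqI[OF has_derivative_of_real[OF lnd[OF that]]] by simp
  have h: "h differentiable (at z)" using hd assms(3) unfolding differentiable_def by blast
  have "(\<lambda>z. D v z / h z) differentiable (at z)" for v
    using assms(3,4) Dd h by (intro differentiable_divide) (auto simp: less_imp_neq[symmetric])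
  hence "(\<lambda>z. complex_of_real (D v z / h z)) differentiable (at z)" for v
    unfolding differentiable_def using has_derivative_of_real by blast
  hence "(\<lambda>z. (of_real (D 1 z / h z) + \<i> * of_real (D \<i> z / h z)) / 2 :: complex) differentiable (at z)"
    by (intro differentiable_divide differentiable_add differentiable_mult differentiable_const) auto
  then obtain E where "((\<lambda>z. (of_real (D 1 z / h z) + \<i> * of_real (D \<i> z / h z)) / 2 :: complex)
    has_derivative E) (at z)" unfolding differentiable_def by blast
  hence "(dzbar (\<lambda>z. of_real (ln (h z))) has_derivative E) (at z)"
    by (rule has_derivative_transform_within_open[OF _ assms(2,3)]) (use eq in auto)
  thus "dzbar (\<lambda>z. of_real (ln (h z))) differentiable (at z)" unfolding differentiable_def by blast
qed

lemma dz_add: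
  assumes "f differentiable (at x)" "g differentiable (at x)"
  shows "dz (\<lambda>y. f y + g y) x = dz f x + dz g x"
    and "dzbar (\<lambda>y. f y + g y) x = dzbar f x + dzbar g x"
proof -
  obtain D E where D: "(f has_derivative D) (at x)" and E: "(g has_derivative E) (at x)"
    using assms unfolding differentiable_def by blast
  show "dz (\<lambda>y. f y + g y) x = dz f x + dz g x" "dzbar (\<lambda>y. f y + g y) x = dzbar f x + dzbar g x"
    unfolding dz_eqI[OF has_derivative_add[OF D E]] dz_eqI[OF D] dz_eqI[OF E]
    by (simp_all add: algebra_simps add_divide_distrib diff_divide_distrib)
qed

lemma dz_cmult:
  assumes "f differentiable (at x)"
  shows "dz (\<lambda>y. c * f y) x = c * dz f x" and "dzbar (\<lambda>y. c * f y) x = c * dzbar f x"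
proof -
  obtain D where D: "(f has_derivative D) (at x)"
    using assms unfolding differentiable_def by blast
  show "dz (\<lambda>y. c * f y) x = c * dz f x" "dzbar (\<lambda>y. c * f y) x = c * dzbar f x"
    unfolding dz_eqI[OF has_derivative_mult_right[OF D]] dz_eqI[OF D]
    by (simp_all add: algebra_simps add_divide_distrib diff_divide_distrib)
qed

lemma differentiable_of_real:
  "f differentiable (at x) \<Longrightarrow> (\<lambda>y. complex_of_real (f y)) differentiable (at x)"
  unfolding differentiable_def using has_derivative_of_real by blast

lemma differentiable_cong_open:
  assumes "open U" "x \<in> U" "\<And>y. y \<in> U \<Longrightarrow> f y = g y" "g differentiable (at x)"
  shows "f differentiable (at x)"
  using assms has_derivative_transform_within_open[of g _ x UNIV U f]
  unfolding differentiable_def by (metis)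

section \<open>Invariant forms in fibre coordinates\<close>

text \<open>\<open>H\<close> is the logarithm of the Hermitian metric of the line bundle in a trivialization, and \<open>s\<close> the
  logarithm of the fibrewise norm squared. The second coordinate is the fibre coordinate \<open>w\<close> for
  \<open>\<epsilon> = 1\<close> and \<open>1 / w\<close> for \<open>\<epsilon> = -1\<close>.\<close>

locale fibre_coordinates =
  fixes V :: "complex set" and g H :: "complex \<Rightarrow> real" and \<epsilon> :: real
  assumes open_V: "open V" and g_pos: "z \<in> V \<Longrightarrow> g z > 0" and \<epsilon>: "\<epsilon>\<^sup>2 = 1"
    and H_diff: "z \<in> V \<Longrightarrow> H differentiable (at z)"
    and H_diff2: "z \<in> V \<Longrightarrow> dzbar (\<lambda>z. of_real (H z)) differentiable (at z)"
    and H_hessian: "z \<in> V \<Longrightarrow> dz (dzbar (\<lambda>z. of_real (H z))) z = of_real (g z)"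
    and g_diff: "z \<in> V \<Longrightarrow> (\<lambda>z. ln (g z)) differentiable (at z)"
    and g_diff2: "z \<in> V \<Longrightarrow> dzbar (\<lambda>z. of_real (ln (g z))) differentiable (at z)"
    and g_hessian: "z \<in> V \<Longrightarrow> dz (dzbar (\<lambda>z. of_real (ln (g z)))) z = 2 * of_real (g z)"
begin

definition U :: "(complex^2) set" where "U = {y. y $ 1 \<in> V \<and> y $ 2 \<noteq> 0}"

definition s :: "complex^2 \<Rightarrow> real" where "s y = H (y $ 1) + \<epsilon> * ln ((cmod (y $ 2))\<^sup>2)"

definition sbar :: "2 \<Rightarrow> complex^2 \<Rightarrow> complex" where
  "sbar k y = (if k = 1 then dzbar (\<lambda>z. of_real (H z)) (y $ 1) else of_real \<epsilon> / cnj (y $ 2))"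

text \<open>The form \<open>A p\<^sup>*\<omega>\<^sub>\<Sigma> + B \<surd>-1 \<partial>s \<and> \<partial>bar s\<close>; here \<open>sbar k\<close> is the derivative of \<open>s\<close> along the
  conjugate of the \<open>k\<close>-th coordinate.\<close>

definition inv_form :: "real \<Rightarrow> real \<Rightarrow> complex^2 \<Rightarrow> complex^2^2" where
  "inv_form A B y = (\<chi> j k. (if j = 1 \<and> k = 1 then of_real (A * g (y $ 1)) else 0)
     + of_real B * cnj (sbar j y) * sbar k y)"

lemma eps_cases: "\<epsilon> = 1 \<or> \<epsilon> = -1" using \<epsilon> by (simp add: power2_eq_1_iff)

lemma two_cases: "j = 1 \<or> j = (2::2)" using exhaust_2 by blast

lemma open_U: "open U"
proof -
  have "U = (\<lambda>y. y $ 1) -` V \<inter> (\<lambda>y. y $ 2) -` (- {0})" by (auto simp: U_def)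
  thus ?thesis by (auto intro!: open_Int open_vimage open_V continuous_intros)
qed

lemma U_D: "y \<in> U \<Longrightarrow> y $ 1 \<in> V" "y \<in> U \<Longrightarrow> y $ 2 \<noteq> 0" by (auto simp: U_def)

text \<open>Turns an identity between functions of s on \<open>U\<close> into an identity on the
  whole real line. The point has a positive real fibre coordinate r solving H z + \<epsilon> ln
  (r^2) = \<sigma>, where \<epsilon> is its own inverse.\<close>

lemma s_surj:
  assumes "z \<in> V"
  obtains y where "y \<in> U" "s y = \<sigma>" "y $ 1 = z"
proof
  define r where "r = exp (\<epsilon> * (\<sigma> - H z) / 2)"
  define y :: "complex^2" where "y = vector [z, of_real r]"
  have r: "r > 0" by (simp add: r_def)
  have "ln (r\<^sup>2) = \<epsilon> * (\<sigma> - H z)" using r by (simp add: ln_realpow r_def)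
  hence "s y = H z + \<epsilon>\<^sup>2 * (\<sigma> - H z)" by (simp add: s_def y_def power2_eq_square)
  thus "s y = \<sigma>" using \<epsilon> by simp
  show "y \<in> U" "y $ 1 = z" using r assms by (auto simp: U_def y_def)
qed

lemma s_differentiable: "y \<in> U \<Longrightarrow> s differentiable (at y)"
  unfolding s_def[abs_def] using U_D[of y]
  by (intro differentiable_add differentiable_mult differentiable_const
      differentiable_coordinate[where f = H]
      differentiable_coordinate[where f = "\<lambda>w. ln ((cmod w)\<^sup>2)"] H_diff ln_norm_square)

lemma del_s:
  assumes y: "y \<in> U"
  shows "delbar k (\<lambda>y. of_real (s y)) y = sbar k y" and "del k (\<lambda>y. of_real (s y)) y = cnj (sbar k y)"
proof -
  define l where "l = (\<lambda>w. complex_of_real (ln ((cmod w)\<^sup>2)))"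
  define h where "h = (\<lambda>z. complex_of_real (H z))"
  have s: "(\<lambda>y. complex_of_real (s y)) = (\<lambda>y. h (y $ 1) + of_real \<epsilon> * l (y $ 2))"
    by (simp add: s_def l_def h_def fun_eq_iff)
  have h: "h differentiable (at (y $ 1))" unfolding h_def
    by (intro differentiable_of_real H_diff U_D y)
  have l: "l differentiable (at (y $ 2))" unfolding l_def
    by (intro differentiable_of_real ln_norm_square U_D y)
  have \<epsilon>l: "(\<lambda>w. of_real \<epsilon> * l w) differentiable (at (y $ 2))"
    by (intro differentiable_mult l) simp
  note d = del_coordinate[OF h] del_coordinate[OF \<epsilon>l, unfolded dz_cmult[OF l]]
    ln_norm_square(2,3)[OF U_D(2)[OF y], folded l_def]
    del_add[OF differentiable_coordinate[OF h] differentiable_coordinate[OF \<epsilon>l]]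
  show "delbar k (\<lambda>y. of_real (s y)) y = sbar k y"
    using two_cases[of k] unfolding s d sbar_def by (auto simp: h_def)
  show "del k (\<lambda>y. of_real (s y)) y = cnj (sbar k y)"
    using two_cases[of k] dz_of_real_eq_cnj_dzbar[OF H_diff[OF U_D(1)[OF y]]] unfolding s d sbar_def
    by (auto simp: h_def)
qed

lemma del_sbar:
  assumes y: "y \<in> U"
  shows "sbar k differentiable (at y)"
    and "del j (sbar k) y = (if j = 1 \<and> k = 1 then of_real (g (y $ 1)) else 0)"
proof -
  have 1: "sbar 1 = (\<lambda>y. dzbar (\<lambda>z. of_real (H z)) (y $ 1))"
    and 2: "sbar 2 = (\<lambda>y. of_real \<epsilon> / cnj (y $ 2))" by (auto simp: sbar_def)
  note d1 = H_diff2[OF U_D(1)[OF y]] and d2 = dz_inverse_cnj[OF U_D(2)[OF y]]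
  show "sbar k differentiable (at y)" using two_cases[of k]
    differentiable_coordinate[OF d1] differentiable_coordinate[OF d2(1)] 1 2 by auto
  show "del j (sbar k) y = (if j = 1 \<and> k = 1 then of_real (g (y $ 1)) else 0)"
    using two_cases[of k]
  proof
    assume k: "k = 1"
    show ?thesis unfolding k 1 del_coordinate[OF d1] by (simp add: H_hessian[OF U_D(1)[OF y]])
  next
    assume k: "k = 2"
    show ?thesis unfolding k 2 del_coordinate[OF d2(1)] d2(2) by simp
  qed
qed

text \<open>The chain rule produces Q' times the Hessian of s plus Q'' times \<partial>s \<and>
  \<partial>bar s, and the Hessian of s is the pulled back base form. The base term P serves the
  logarithm of the volume form; a Calabi potential has P = 0.\<close>

lemma hessian:
  assumes y: "y \<in> U"
    and P: "\<And>z. z \<in> V \<Longrightarrow> P differentiable (at z)"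
      "\<And>z. z \<in> V \<Longrightarrow> dzbar (\<lambda>z. of_real (P z)) differentiable (at z)"
      "\<And>z. z \<in> V \<Longrightarrow> dz (dzbar (\<lambda>z. of_real (P z))) z = of_real (c * g z)"
    and Q: "\<And>t. (Q has_real_derivative Q' t) (at t)" "\<And>t. (Q' has_real_derivative Q'' t) (at t)"
    and f: "\<And>y. y \<in> U \<Longrightarrow> f y = of_real (P (y $ 1) + Q (s y))"
  shows "(\<chi> j k. del j (delbar k f) y) = inv_form (c + Q' (s y)) (Q'' (s y)) y"
proof -
  define p where "p = (\<lambda>z. complex_of_real (P z))"
  define pb where "pb = (\<lambda>k y. if k = (1::2) then dzbar p (y $ (1::2)) else 0)"
  define qb where "qb = (\<lambda>y. complex_of_real (Q' (s y)))"
  have b: "delbar k f y = pb k y + qb y * sbar k y" if y: "y \<in> U" for k y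
  proof -
    have pd: "p differentiable (at (y $ 1))" unfolding p_def
      by (intro differentiable_of_real P U_D y)
    have "delbar k f y = delbar k (\<lambda>y. p (y $ 1) + of_real (Q (s y))) y"
      by (rule del_cong_open(2)[OF open_U y]) (simp add: f p_def)
    also have "\<dots> = delbar k (\<lambda>y. p (y $ 1)) y + delbar k (\<lambda>y. of_real (Q (s y))) y"
      by (intro del_add differentiable_coordinate[OF pd] differentiable_of_real
          del_of_real_chain(3)[OF Q(1)] s_differentiable y)
    also have "\<dots> = pb k y + qb y * sbar k y"
      unfolding del_coordinate[OF pd] del_of_real_chain(2)[OF Q(1) s_differentiable[OF y]]
        del_s[OF y] pb_def qb_def by simp
    finally show ?thesis .
  qed
  have pbd: "pb k differentiable (at y)" for k
    unfolding pb_def p_def using differentiable_coordinate[OF P(2)[OF U_D(1)[OF y]]] by (cases "k = 1") auto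
  have pbe: "del j (pb k) y = (if j = 1 \<and> k = 1 then of_real (c * g (y $ 1)) else 0)" for j k
  proof (cases "k = 1")
    case True
    show ?thesis unfolding pb_def p_def True
      using del_coordinate(1)[OF P(2)[OF U_D(1)[OF y]], of j] P(3)[OF U_D(1)[OF y]] by simp
  next
    case False
    have "del j (\<lambda>_. 0) y = 0" by (simp add: del_eqI[OF has_derivative_const])
    thus ?thesis unfolding pb_def using False by simp
  qed
  have qbd: "qb differentiable (at y)" unfolding qb_def
    by (intro differentiable_of_real del_of_real_chain(3)[OF Q(2)] s_differentiable y)
  have qbe: "del j qb y = of_real (Q'' (s y)) * cnj (sbar j y)" for j
    unfolding qb_def del_of_real_chain(1)[OF Q(2) s_differentiable[OF y]] del_s[OF y] ..
  have "del j (delbar k f) y = inv_form (c + Q' (s y)) (Q'' (s y)) y $ j $ k" for j k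
  proof -
    have "del j (delbar k f) y = del j (\<lambda>y. pb k y + qb y * sbar k y) y"
      by (rule del_cong_open(1)[OF open_U y]) (rule b)
    also have "\<dots> = del j (pb k) y + del j (\<lambda>y. qb y * sbar k y) y"
      by (intro del_add pbd differentiable_mult qbd del_sbar y)
    also have "\<dots> = del j (pb k) y + (del j qb y * sbar k y + qb y * del j (sbar k) y)"
      by (subst del_mult(1)[OF qbd del_sbar(1)[OF y]]) simp
    also have "\<dots> = inv_form (c + Q' (s y)) (Q'' (s y)) y $ j $ k"
      unfolding pbe qbe del_sbar[OF y] by (auto simp: inv_form_def qb_def algebra_simps)
    finally show ?thesis .
  qed
  thus ?thesis by (simp add: vec_eq_iff)
qed

lemma sbar_2: "y \<in> U \<Longrightarrow> cnj (sbar 2 y) * sbar 2 y = of_real (1 / (cmod (y $ 2))\<^sup>2)"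
proof -
  assume y: "y \<in> U"
  have "cnj (sbar 2 y) * sbar 2 y = of_real (\<epsilon>\<^sup>2) / (y $ 2 * cnj (y $ 2))"
    by (simp add: sbar_def power2_eq_square)
  thus ?thesis unfolding \<epsilon> by (simp add: complex_norm_square[symmetric])
qed

lemma inv_form_22: "y \<in> U \<Longrightarrow> inv_form A B y $ 2 $ 2 = of_real (B / (cmod (y $ 2))\<^sup>2)"
  using sbar_2[of y] by (simp add: inv_form_def mult.assoc)

lemma inv_form_add: "inv_form A B y + inv_form A' B' y = inv_form (A + A') (B + B') y"
  by (simp add: inv_form_def vec_eq_iff algebra_simps)

lemma inv_form_minus: "- inv_form A B y = inv_form (- A) (- B) y"
  by (simp add: inv_form_def vec_eq_iff)

text \<open>The pulled back base form and \<partial>s \<and> \<partial>bar s both have square zero,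
  so only the mixed products remain, and in these only the fibre entry 1 / |w|^2 of the second form
  counts.\<close>

lemma wedge11_inv_form:
  assumes "y \<in> U"
  shows "wedge11 (inv_form A B y) (inv_form A' B' y)
    = of_real ((A * B' + A' * B) * g (y $ 1) / (cmod (y $ 2))\<^sup>2)"
proof -
  have "wedge11 (inv_form A B y) (inv_form A' B' y)
    = of_real ((A * B' + A' * B) * g (y $ 1)) * (cnj (sbar 2 y) * sbar 2 y)"
    by (simp add: wedge11_def inv_form_def algebra_simps)
  thus ?thesis unfolding sbar_2[OF assms] by simp
qed

lemma inv_form_inject:
  assumes "y \<in> U" "inv_form A B y = inv_form A' B' y"
  shows "A = A'" "B = B'"
proof -
  have "inv_form A B y $ 2 $ 2 = inv_form A' B' y $ 2 $ 2" using assms by simp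
  thus B: "B = B'" unfolding inv_form_22[OF assms(1)] using U_D[OF assms(1)] by simp
  have "inv_form A B y $ 1 $ 1 = inv_form A' B' y $ 1 $ 1" using assms by simp
  thus "A = A'" unfolding inv_form_def using B g_pos[OF U_D(1)[OF assms(1)]] by simp
qed

section \<open>Ricci form, trace and gradient of invariant forms\<close>

lemma Ric_inv_form:
  assumes y: "y \<in> U"
    and x: "\<And>t. x t > 0" "\<And>t. p t > 0"
    and D: "\<And>t. (x has_real_derivative p t) (at t)" "\<And>t. (p has_real_derivative p' t) (at t)"
      "\<And>t. ((\<lambda>t. p t / x t + p' t / p t) has_real_derivative G' t) (at t)"
    and \<omega>: "\<And>y. y \<in> U \<Longrightarrow> \<omega> \<kappa> y = inv_form (x (s y)) (p (s y)) y"
  shows "Ric \<omega> \<kappa> y = inv_form (- (2 + (p (s y) / x (s y) + p' (s y) / p (s y)))) (- G' (s y)) y"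
proof -
  \<comment> \<open>The logarithm of the volume density contains -ln |w|^2 = \<epsilon> H -
    \<epsilon> s, which is shared out between the base part P and the part Q in s. The \<epsilon> in
    the Hessian (2 + \<epsilon>) g of P then cancels against the derivative of -\<epsilon> t in
    Q.\<close>
  define P where "P = (\<lambda>z. ln (g z) + \<epsilon> * H z)"
  define Q where "Q = (\<lambda>t. ln 2 + ln (x t) + ln (p t) - \<epsilon> * t)"
  have P1: "P differentiable (at z)" if "z \<in> V" for z
    unfolding P_def using that
    by (intro differentiable_add differentiable_mult differentiable_const g_diff H_diff)
  define lg where "lg = (\<lambda>z. complex_of_real (ln (g z)))"
  define h where "h = (\<lambda>z. complex_of_real (H z))"
  have P2: "dzbar (\<lambda>z. of_real (P z)) z = dzbar lg z + of_real \<epsilon> * dzbar h z" if z: "z \<in> V" for z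
  proof -
    have lg: "lg differentiable (at z)" and h: "h differentiable (at z)"
      unfolding lg_def h_def by (intro differentiable_of_real g_diff H_diff z)+
    have \<epsilon>h: "(\<lambda>w. of_real \<epsilon> * h w) differentiable (at z)" by (intro differentiable_mult h) simp
    have "(\<lambda>z. complex_of_real (P z)) = (\<lambda>z. lg z + of_real \<epsilon> * h z)"
      by (simp add: P_def lg_def h_def)
    thus ?thesis using dz_add(2)[OF lg \<epsilon>h] dz_cmult(2)[OF h] by simp
  qed
  have P3: "dzbar (\<lambda>z. of_real (P z)) differentiable (at z) \<and>
    dz (dzbar (\<lambda>z. of_real (P z))) z = of_real ((2 + \<epsilon>) * g z)" if z: "z \<in> V" for z
  proof -
    have lg: "dzbar lg differentiable (at z)" and h: "dzbar h differentiable (at z)"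
      unfolding lg_def h_def by (intro g_diff2 H_diff2 z)+
    have \<epsilon>h: "(\<lambda>w. of_real \<epsilon> * dzbar h w) differentiable (at z)" by (intro differentiable_mult h) simp
    have 1: "dzbar (\<lambda>z. of_real (P z)) differentiable (at z)"
      by (rule differentiable_cong_open[OF open_V z P2]) (use differentiable_add[OF lg \<epsilon>h] in auto)
    have "dz (dzbar (\<lambda>z. of_real (P z))) z = dz (\<lambda>z. dzbar lg z + of_real \<epsilon> * dzbar h z) z"
      by (rule dz_cong_open(1)[OF open_V z P2])
    also have "\<dots> = of_real ((2 + \<epsilon>) * g z)"
      unfolding dz_add(1)[OF lg \<epsilon>h] dz_cmult(1)[OF h]
      using g_hessian[OF z] H_hessian[OF z] by (simp add: lg_def h_def algebra_simps)
    finally show ?thesis using 1 by simp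
  qed
  have Q1: "(Q has_real_derivative (p t / x t + p' t / p t) - \<epsilon>) (at t)" for t
    unfolding Q_def using x[of t] by (auto intro!: derivative_eq_intros D)
  have Q2: "((\<lambda>t. (p t / x t + p' t / p t) - \<epsilon>) has_real_derivative G' t) (at t)" for t
    using DERIV_diff[OF D(3) DERIV_const] by simp
  have e: "complex_of_real (ln (Re (wedge11 (\<omega> \<kappa> y) (\<omega> \<kappa> y)))) = of_real (P (y $ 1) + Q (s y))"
    if y: "y \<in> U" for y
  proof -
    note g = g_pos[OF U_D(1)[OF y]] and w = U_D(2)[OF y]
    have "Re (wedge11 (\<omega> \<kappa> y) (\<omega> \<kappa> y)) = 2 * x (s y) * p (s y) * g (y $ 1) / (cmod (y $ 2))\<^sup>2"
      unfolding \<omega>[OF y] wedge11_inv_form[OF y] by simp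
    hence "ln (Re (wedge11 (\<omega> \<kappa> y) (\<omega> \<kappa> y)))
      = ln 2 + ln (x (s y)) + ln (p (s y)) + ln (g (y $ 1)) - ln ((cmod (y $ 2))\<^sup>2)"
      using g w x[of "s y"] by (simp add: ln_div ln_mult)
    moreover have "\<epsilon> * s y = \<epsilon> * H (y $ 1) + \<epsilon>\<^sup>2 * ln ((cmod (y $ 2))\<^sup>2)"
      by (simp add: s_def power2_eq_square algebra_simps)
    ultimately show ?thesis using \<epsilon> by (simp add: P_def Q_def)
  qed
  have "i_del_delbar (\<lambda>\<kappa> y. of_real (ln (Re (wedge11 (\<omega> \<kappa> y) (\<omega> \<kappa> y))))) \<kappa> y
    = inv_form (2 + \<epsilon> + ((p (s y) / x (s y) + p' (s y) / p (s y)) - \<epsilon>)) (G' (s y)) y"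
    unfolding i_del_delbar_def by (rule hessian[OF y P1 _ _ Q1 Q2 e]) (use P3 in auto)
  thus ?thesis unfolding Ric_def by (simp add: inv_form_minus)
qed

text \<open>The two forms are simultaneously diagonal, so the trace is the sum of the ratios of
  their base and fibre coefficients.\<close>

lemma Lambda_inv_form:
  assumes y: "y \<in> U" and "A > 0" "B > 0"
    and "\<omega> \<kappa> y = inv_form A B y" "\<alpha> \<kappa> y = inv_form A' B' y"
  shows "Lambda \<omega> \<alpha> \<kappa> y = of_real (A' / A + B' / B)"
proof -
  have "Lambda \<omega> \<alpha> \<kappa> y = of_real (2 * ((A' * B + A * B') * g (y $ 1) / (cmod (y $ 2))\<^sup>2)
    / ((A * B + A * B) * g (y $ 1) / (cmod (y $ 2))\<^sup>2))"
    unfolding Lambda_def assms wedge11_inv_form[OF y] by (simp add: algebra_simps)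
  also have "2 * ((A' * B + A * B') * g (y $ 1) / (cmod (y $ 2))\<^sup>2)
    / ((A * B + A * B) * g (y $ 1) / (cmod (y $ 2))\<^sup>2) = A' / A + B' / B"
    using assms(2,3) U_D(2)[OF y] g_pos[OF U_D(1)[OF y]] by (simp add: field_simps)
  finally show ?thesis .
qed

text \<open>With \<open>v = (0, \<epsilon> w)\<close> one has \<open>\<Sum>\<^sub>j v\<^sub>j \<omega>\<^sub>j\<^sub>k = B s\<^sub>k\<close>, so the gradient of a function of \<open>s\<close> is a
  multiple of the Euler field.\<close>

lemma gradient10_inv_form:
  assumes y: "y \<in> U" and AB: "A > 0" "B > 0" and \<omega>: "\<omega> \<kappa> y = inv_form A B y"
    and F: "(F has_real_derivative F') (at (s y))" and f: "\<And>y. y \<in> U \<Longrightarrow> f \<kappa> y = of_real (F (s y))"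
  shows "gradient10 \<omega> f \<kappa> y $ 2 = of_real (\<epsilon> * F' / B) * y $ 2"
proof -
  define M where "M = inv_form A B y"
  define N where "N = matrix_inv M"
  have "2 * det M = wedge11 M M" by (simp add: det_2 wedge11_def)
  also have "\<dots> \<noteq> 0" unfolding M_def wedge11_inv_form[OF y]
    using AB U_D(2)[OF y] g_pos[OF U_D(1)[OF y]] by simp
  finally have "invertible M" by (simp add: invertible_det_nz)
  hence MN: "M ** N = mat 1"
    unfolding N_def matrix_inv_def invertible_def by (rule someI2_ex) blast
  have e: "of_real B * sbar k y = of_real \<epsilon> * y $ 2 * M $ 2 $ k" for k
  proof -
    have "of_real \<epsilon> * y $ 2 * M $ 2 $ k = of_real (\<epsilon>\<^sup>2) * of_real B * sbar k y"
      using U_D(2)[OF y] by (simp add: M_def inv_form_def sbar_def[of 2] power2_eq_square)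
    thus ?thesis unfolding \<epsilon> by simp
  qed
  have d: "delbar k (f \<kappa>) y = of_real F' * sbar k y" for k
  proof -
    have "delbar k (f \<kappa>) y = delbar k (\<lambda>y. of_real (F (s y))) y"
      by (rule del_cong_open(2)[OF open_U y]) (rule f)
    thus ?thesis unfolding del_of_real_chain(2)[OF F s_differentiable[OF y]] del_s[OF y] .
  qed
  have "of_real B * gradient10 \<omega> f \<kappa> y $ 2
    = of_real F' * (\<Sum>k\<in>UNIV. N $ k $ 2 * (of_real B * sbar k y))"
    unfolding gradient10_def \<omega> d by (simp add: N_def M_def sum_distrib_left mult_ac)
  also have "\<dots> = of_real F' * of_real \<epsilon> * y $ 2 * (\<Sum>k\<in>UNIV. M $ 2 $ k * N $ k $ 2)"
    unfolding e by (simp add: sum_distrib_left mult_ac)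
  also have "(\<Sum>k\<in>UNIV. M $ 2 $ k * N $ k $ 2) = (M ** N) $ 2 $ 2"
    by (simp add: matrix_matrix_mult_def)
  also have "\<dots> = 1" unfolding MN by (simp add: mat_def)
  finally show ?thesis using AB by (simp add: field_simps)
qed

text \<open>Since w is holomorphic, the derivative of F(s) w along the conjugate of w is F'(s) times
  the nonzero factor \<epsilon> w / cnj w. Holomorphy of the gradient thus becomes constancy of its
  coefficient.\<close>

lemma holomorphic_Euler_multiple:
  assumes y: "y \<in> U" and F: "(F has_real_derivative F') (at (s y))"
    and v: "\<And>y. y \<in> U \<Longrightarrow> v y = of_real (F (s y)) * y $ 2" and "delbar 2 v y = 0"
  shows "F' = 0"
proof -
  have i: "(\<lambda>w::complex. w) differentiable (at (y $ 2))" by simp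
  have "dzbar (\<lambda>w. w) (y $ 2) = 0" by (simp add: dz_eqI[OF has_derivative_ident])
  hence z: "delbar 2 (\<lambda>y. y $ 2) y = 0" using del_coordinate(2)[OF i, of 2] by simp
  have "delbar 2 v y = delbar 2 (\<lambda>y. of_real (F (s y)) * y $ 2) y"
    by (rule del_cong_open(2)[OF open_U y]) (rule v)
  also have "\<dots> = delbar 2 (\<lambda>y. of_real (F (s y))) y * y $ 2 + of_real (F (s y)) * delbar 2 (\<lambda>y. y $ 2) y"
    by (intro del_mult differentiable_of_real differentiable_coordinate[OF i]
        del_of_real_chain(3)[of F F' s, OF F s_differentiable[OF y]])
  also have "\<dots> = of_real F' * sbar 2 y * y $ 2"
    unfolding z del_of_real_chain(2)[OF F s_differentiable[OF y]] del_s[OF y] by simp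
  finally show ?thesis using assms(4) U_D(2)[OF y] eps_cases by (auto simp: sbar_def)
qed

end

section \<open>Points and charts of the projectivized bundle\<close>

text \<open>A single base chart and a single trivialization suffice: the unknown functions depend on
  s alone, and s takes every real value over each point of the piece.\<close>

locale ruled_chart =
  fixes S :: "'a surface" and L :: "('a, 'l) line_bundle"
    and g :: "'a surface_metric" and N :: "'l \<Rightarrow> real"
    and c :: "('a, complex) chart" and t :: "'a set \<times> ('l \<Rightarrow> complex)"
  assumes surface: "compact_riemann_surface S"
    and kaehler: "surface_kaehler S g"
    and curvature: "\<forall>c\<in>surf_atlas S. \<forall>z\<in>chart_image c. surface_scalar_curvature g c z = -2"
    and hol_bundle: "holomorphic_line_bundle S L"
    and metric: "hermitian_metric S L N" and curvature_L: "curvature_is_minus S L N g"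
    and c: "c \<in> surf_atlas S" and t: "t \<in> lb_trivs L"
begin

abbreviation \<psi> where "\<psi> \<equiv> snd t"

definition V :: "complex set" where "V = overlap c (fst t)"

definition H :: "complex \<Rightarrow> real" where "H z = ln (metric_coeff L N t (chart_inv c z))"

lemma chart_props:
  "openin (surf_top S) (fst c)" "open (chart_image c)"
  "homeomorphic_map (subtopology (surf_top S) (fst c)) (top_of_set (chart_image c)) (snd c)"
proof -
  have "\<forall>c\<in>surf_atlas S. openin (surf_top S) (fst c) \<and> open (chart_image c) \<and>
    homeomorphic_map (subtopology (surf_top S) (fst c)) (top_of_set (chart_image c)) (snd c)"
    using surface unfolding compact_riemann_surface_def by (elim conjE)
  note p = bspec[OF this c]
  show "openin (surf_top S) (fst c)" "open (chart_image c)"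
    "homeomorphic_map (subtopology (surf_top S) (fst c)) (top_of_set (chart_image c)) (snd c)"
    by (rule conjunct1[OF p], rule conjunct1[OF conjunct2[OF p]], rule conjunct2[OF conjunct2[OF p]])
qed

lemma bundle_props:
  "lb_proj L ` lb_total L \<subseteq> surf_points S"
  "\<forall>t\<in>lb_trivs L. openin (surf_top S) (fst t) \<and> (\<forall>x\<in>fst t. bij_betw (snd t) (lb_fibre L x) UNIV)"
  "(\<Union>t\<in>lb_trivs L. fst t) = surf_points S"
  "\<forall>t\<in>lb_trivs L. \<forall>t'\<in>lb_trivs L. \<exists>\<tau>. holomorphic_fun S (fst t \<inter> fst t') \<tau> \<and>
    (\<forall>x\<in>fst t \<inter> fst t'. \<tau> x \<noteq> 0 \<and> (\<forall>l\<in>lb_fibre L x. snd t' l = \<tau> x * snd t l))"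
proof -
  note h = hol_bundle[unfolded holomorphic_line_bundle_def case_prod_unfold]
  note h1 = conjunct2[OF h] note h2 = conjunct2[OF h1]
  show "lb_proj L ` lb_total L \<subseteq> surf_points S" by (rule conjunct1[OF h])
  show "\<forall>t\<in>lb_trivs L. openin (surf_top S) (fst t) \<and> (\<forall>x\<in>fst t. bij_betw (snd t) (lb_fibre L x) UNIV)"
    by (rule conjunct1[OF h1])
  show "(\<Union>t\<in>lb_trivs L. fst t) = surf_points S" by (rule conjunct1[OF h2])
  show "\<forall>t\<in>lb_trivs L. \<forall>t'\<in>lb_trivs L. \<exists>\<tau>. holomorphic_fun S (fst t \<inter> fst t') \<tau> \<and>
    (\<forall>x\<in>fst t \<inter> fst t'. \<tau> x \<noteq> 0 \<and> (\<forall>l\<in>lb_fibre L x. snd t' l = \<tau> x * snd t l))"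
    by (rule conjunct2[OF h2])
qed

lemma triv_props:
  assumes "t' \<in> lb_trivs L"
  shows "openin (surf_top S) (fst t')" "x \<in> fst t' \<Longrightarrow> bij_betw (snd t') (lb_fibre L x) UNIV"
  using bundle_props(2) assms by blast+

lemma triv_cover:
  assumes "l \<in> lb_total L"
  obtains t' where "t' \<in> lb_trivs L" "lb_proj L l \<in> fst t'"
proof -
  have "lb_proj L l \<in> (\<Union>t\<in>lb_trivs L. fst t)"
    unfolding bundle_props(3) using bundle_props(1) assms by blast
  thus ?thesis using that by blast
qed

lemma topspace_chart: "topspace (subtopology (surf_top S) (fst c)) = fst c"
  using openin_subset[OF chart_props(1)] by auto

lemma inj_chart: "inj_on (snd c) (fst c)"
  using homeomorphic_imp_injective_map[OF chart_props(3)] unfolding topspace_chart .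

lemma open_V: "open V"
proof -
  have "openin (subtopology (surf_top S) (fst c)) (fst c \<inter> fst t)"
    using openin_subtopology_Int2[OF triv_props(1)[OF t]] by simp
  hence "openin (top_of_set (chart_image c)) (snd c ` (fst c \<inter> fst t))"
    using homeomorphic_imp_open_map[OF chart_props(3)] unfolding open_map_def by blast
  thus ?thesis unfolding V_def overlap_def
    using chart_props(2) openin_open_eq by blast
qed

lemma V_subset: "V \<subseteq> chart_image c" by (auto simp: V_def overlap_def chart_image_def)

lemma chart_inv_V:
  assumes "z \<in> V"
  shows "chart_inv c z \<in> fst c" "chart_inv c z \<in> fst t" "snd c (chart_inv c z) = z"
  using assms inj_chart by (auto simp: V_def overlap_def chart_inv_def)

lemma transition_multiple:
  assumes "t1 \<in> lb_trivs L" "t2 \<in> lb_trivs L" "x \<in> fst t1" "x \<in> fst t2"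
  obtains \<tau> where "\<And>l. l \<in> lb_fibre L x \<Longrightarrow> snd t2 l = \<tau> * snd t1 l"
proof -
  obtain \<tau> where \<tau>: "\<forall>x\<in>fst t1 \<inter> fst t2. \<tau> x \<noteq> 0 \<and> (\<forall>l\<in>lb_fibre L x. snd t2 l = \<tau> x * snd t1 l)"
    using bspec[OF bspec[OF bundle_props(4) assms(1)] assms(2)] by blast
  show ?thesis by (rule that[of "\<tau> x"]) (use \<tau> assms(3,4) in blast)
qed

lemma inj_fibre:
  assumes "x \<in> fst t" "l \<in> lb_fibre L x" "l' \<in> lb_fibre L x" "\<psi> l = \<psi> l'"
  shows "l = l'"
  using triv_props(2)[OF t assms(1)] assms unfolding bij_betw_def inj_on_def by blast

lemma fibre_vector:
  assumes "x \<in> fst t"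
  obtains l where "l \<in> lb_fibre L x" "\<psi> l = w"
  using triv_props(2)[OF t assms] unfolding bij_betw_def by (metis UNIV_I imageE)

text \<open>The definite descriptions in \<open>lb_scale\<close> and \<open>lb_zero\<close> quantify
  over all trivializations. Transition functions act by multiplication, so an element with the right
  coordinate in \<open>t\<close> has it in every other trivialization as well.\<close>

lemma ex1_multiple:
  assumes x: "x \<in> fst t" and l: "l \<in> lb_fibre L x"
  shows "\<exists>!m. m \<in> lb_fibre L x \<and> (\<forall>(V, \<psi>)\<in>lb_trivs L. x \<in> V \<longrightarrow> \<psi> m = a * \<psi> l)"
proof -
  obtain m where m: "m \<in> lb_fibre L x" "\<psi> m = a * \<psi> l" using fibre_vector[OF x] .
  have "snd t' m = a * snd t' l" if t': "t' \<in> lb_trivs L" "x \<in> fst t'" for t'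
  proof -
    obtain \<tau> where "\<And>l. l \<in> lb_fibre L x \<Longrightarrow> snd t' l = \<tau> * \<psi> l"
      using transition_multiple[OF t t'(1) x t'(2)] by metis
    thus ?thesis using m l by simp
  qed
  hence ex: "m \<in> lb_fibre L x \<and> (\<forall>(V, \<psi>)\<in>lb_trivs L. x \<in> V \<longrightarrow> \<psi> m = a * \<psi> l)"
    using m unfolding case_prod_unfold by blast
  have t': "(fst t, snd t) \<in> lb_trivs L" using t by simp
  show ?thesis
  proof (rule ex1I, rule ex)
    fix m' assume m': "m' \<in> lb_fibre L x \<and> (\<forall>(V, \<psi>)\<in>lb_trivs L. x \<in> V \<longrightarrow> \<psi> m' = a * \<psi> l)"
    have "\<psi> m' = a * \<psi> l" using m' t' x by blast
    thus "m' = m" using inj_fibre[OF x, of m' m] m m' by simp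
  qed
qed

lemma lb_scale:
  assumes x: "x \<in> fst t" and l: "l \<in> lb_fibre L x"
  shows "lb_scale L a l \<in> lb_fibre L x" "\<psi> (lb_scale L a l) = a * \<psi> l"
proof -
  have p: "lb_proj L l = x" using l by (simp add: lb_fibre_def)
  have t': "(fst t, snd t) \<in> lb_trivs L" using t by simp
  have *: "lb_scale L a l \<in> lb_fibre L x \<and> (\<forall>(V, \<psi>)\<in>lb_trivs L. x \<in> V \<longrightarrow> \<psi> (lb_scale L a l) = a * \<psi> l)"
    unfolding lb_scale_def p by (rule theI'[OF ex1_multiple[OF x l]])
  show "lb_scale L a l \<in> lb_fibre L x" using * by blast
  show "\<psi> (lb_scale L a l) = a * \<psi> l" using * t' x by blast
qed

lemma lb_zero:
  assumes x: "x \<in> fst t"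
  shows "lb_zero L x \<in> lb_fibre L x" "\<psi> (lb_zero L x) = 0"
proof -
  obtain l where l: "l \<in> lb_fibre L x" "\<psi> l = 0" using fibre_vector[OF x] .
  have t': "(fst t, snd t) \<in> lb_trivs L" using t by simp
  have *: "lb_zero L x \<in> lb_fibre L x \<and> (\<forall>(V, \<psi>)\<in>lb_trivs L. x \<in> V \<longrightarrow> \<psi> (lb_zero L x) = 0)"
    unfolding lb_zero_def by (rule theI'[OF ex1_multiple[OF x l(1), of 0, unfolded mult_zero_left]])
  show "lb_zero L x \<in> lb_fibre L x" using * by blast
  show "\<psi> (lb_zero L x) = 0" using * t' x by blast
qed

text \<open>A line is described by its homogeneous coordinates \<open>\<psi> l\<close> and
  \<open>r\<close>; with this the definite descriptions of base point, affine vector and coordinate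
  at infinity reduce to algebra.\<close>

lemma line_through_eq:
  assumes x: "x \<in> fst t" and l: "l \<in> lb_fibre L x"
  shows "line_through L l r = {(m, r'). m \<in> lb_fibre L x \<and> (\<exists>a. \<psi> m = a * \<psi> l \<and> r' = a * r)}"
proof (intro equalityI subsetI)
  fix p assume "p \<in> line_through L l r"
  then obtain a where "p = (lb_scale L a l, a * r)" unfolding line_through_def by blast
  thus "p \<in> {(m, r'). m \<in> lb_fibre L x \<and> (\<exists>a. \<psi> m = a * \<psi> l \<and> r' = a * r)}"
    using lb_scale[OF x l, of a] by auto
next
  fix p assume "p \<in> {(m, r'). m \<in> lb_fibre L x \<and> (\<exists>a. \<psi> m = a * \<psi> l \<and> r' = a * r)}"
  then obtain m a where p: "p = (m, a * r)" "m \<in> lb_fibre L x" "\<psi> m = a * \<psi> l" by blast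
  have "m = lb_scale L a l" using inj_fibre[OF x p(2) lb_scale(1)[OF x l, of a]] lb_scale(2)[OF x l, of a] p(3) by simp
  thus "p \<in> line_through L l r" unfolding line_through_def p(1) by blast
qed

lemma base_point_line:
  assumes x: "x \<in> fst t" and l: "l \<in> lb_fibre L x"
  shows "base_point L (line_through L l r) = x"
  unfolding base_point_def
proof (rule the_equality)
  have "(l, r) \<in> line_through L l r" unfolding line_through_eq[OF assms] using l
    by (auto intro!: exI[of _ 1])
  thus "\<exists>p\<in>line_through L l r. lb_proj L (fst p) = x" using l by (force simp: lb_fibre_def)
qed (auto simp: line_through_eq[OF assms] lb_fibre_def)

lemma affine_vector_line:
  assumes x: "x \<in> fst t" and l: "l \<in> lb_fibre L x" and r: "r \<noteq> 0"
  shows "affine_vector (line_through L l r) \<in> lb_fibre L x"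
    "\<psi> (affine_vector (line_through L l r)) = \<psi> l / r"
proof -
  obtain m where m: "m \<in> lb_fibre L x" "\<psi> m = \<psi> l / r" using fibre_vector[OF x] .
  have "affine_vector (line_through L l r) = m"
    unfolding affine_vector_def line_through_eq[OF x l]
  proof (rule the_equality)
    show "(m, 1) \<in> {(m, r'). m \<in> lb_fibre L x \<and> (\<exists>a. \<psi> m = a * \<psi> l \<and> r' = a * r)}"
      using m r by (auto intro!: exI[of _ "1 / r"])
  next
    fix m' assume "(m', 1) \<in> {(m, r'). m \<in> lb_fibre L x \<and> (\<exists>a. \<psi> m = a * \<psi> l \<and> r' = a * r)}"
    then obtain a where "m' \<in> lb_fibre L x" "\<psi> m' = a * \<psi> l" "1 = a * r" by auto
    thus "m' = m" using inj_fibre[OF x, of m' m] m r by (simp add: field_simps)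
  qed
  thus "affine_vector (line_through L l r) \<in> lb_fibre L x"
    "\<psi> (affine_vector (line_through L l r)) = \<psi> l / r" using m by auto
qed

lemma infinity_coordinate_line:
  assumes x: "x \<in> fst t" and l: "l \<in> lb_fibre L x" and r: "\<psi> l \<noteq> 0"
  shows "(THE y. \<exists>m. (m, y) \<in> line_through L l r \<and> \<psi> m = 1) = r / \<psi> l"
proof (rule the_equality)
  obtain m where m: "m \<in> lb_fibre L x" "\<psi> m = 1" using fibre_vector[OF x] .
  thus "\<exists>m. (m, r / \<psi> l) \<in> line_through L l r \<and> \<psi> m = 1"
    unfolding line_through_eq[OF x l] using r
    by (auto intro!: exI[of _ m] exI[of _ "1 / \<psi> l"])
qed (use r in \<open>auto simp: line_through_eq[OF x l] field_simps\<close>)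

lemma line_through_cong:
  assumes x: "x \<in> fst t" and l: "l \<in> lb_fibre L x" "l' \<in> lb_fibre L x"
    and "\<psi> l = b * \<psi> l'" "r = b * r'" "b \<noteq> 0"
  shows "line_through L l r = line_through L l' r'"
proof -
  have "(\<exists>a. \<psi> m = a * \<psi> l \<and> y = a * r) \<longleftrightarrow> (\<exists>a. \<psi> m = a * \<psi> l' \<and> y = a * r')" for m y
  proof
    assume "\<exists>a. \<psi> m = a * \<psi> l \<and> y = a * r"
    then obtain a where "\<psi> m = a * \<psi> l" "y = a * r" by blast
    thus "\<exists>a. \<psi> m = a * \<psi> l' \<and> y = a * r'" using assms(4,5) by (intro exI[of _ "a * b"]) simp
  next
    assume "\<exists>a. \<psi> m = a * \<psi> l' \<and> y = a * r'"
    then obtain a where "\<psi> m = a * \<psi> l'" "y = a * r'" by blast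
    thus "\<exists>a. \<psi> m = a * \<psi> l \<and> y = a * r" using assms(4-6) by (intro exI[of _ "a / b"]) simp
  qed
  thus ?thesis unfolding line_through_eq[OF x l(1)] line_through_eq[OF x l(2)] by simp
qed

lemma mem_line_through:
  assumes "x \<in> fst t" "l \<in> lb_fibre L x"
  shows "(l, r) \<in> line_through L l r"
  unfolding line_through_eq[OF assms] using assms(2) by (auto intro!: exI[of _ 1])

lemma line_mem_proj_bundle:
  assumes x: "x \<in> fst t" and l: "l \<in> lb_fibre L x" and nz: "\<psi> l \<noteq> 0 \<or> r \<noteq> 0"
  shows "line_through L l r \<in> proj_bundle L"
proof -
  have "l \<in> lb_total L" "lb_proj L l = x" using l by (auto simp: lb_fibre_def)
  moreover have "\<not> (l = lb_zero L x \<and> r = 0)" using nz lb_zero[OF x] by auto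
  ultimately show ?thesis unfolding proj_bundle_def by blast
qed

text \<open>The representative supplied by \<open>proj_bundle\<close> is not known in advance to lie
  over \<open>fst t\<close>. A second instance of the locale, with a trivialization around its own
  base point, identifies that point with \<open>base_point L q\<close>.\<close>

lemma proj_bundle_cases:
  assumes q: "q \<in> proj_bundle L" and x: "base_point L q \<in> fst t"
  obtains l r where "l \<in> lb_fibre L (base_point L q)" "q = line_through L l r" "\<psi> l \<noteq> 0 \<or> r \<noteq> 0"
proof -
  obtain l r where l: "q = line_through L l r" "l \<in> lb_total L" "\<not> (l = lb_zero L (lb_proj L l) \<and> r = 0)"
    using q unfolding proj_bundle_def by blast
  obtain t' where t': "t' \<in> lb_trivs L" "lb_proj L l \<in> fst t'" using triv_cover[OF l(2)] .
  interpret T: ruled_chart S L g N c t'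
    using surface kaehler curvature hol_bundle metric curvature_L c t'(1) by unfold_locales
  have l': "l \<in> lb_fibre L (lb_proj L l)" using l(2) by (simp add: lb_fibre_def)
  have b: "base_point L q = lb_proj L l" unfolding l(1) by (rule T.base_point_line[OF t'(2) l'])
  have "\<psi> l \<noteq> 0 \<or> r \<noteq> 0"
    using l(3) inj_fibre[OF x[unfolded b] l' lb_zero(1)[OF x[unfolded b]]] lb_zero(2)[OF x[unfolded b]] by auto
  thus ?thesis using that l l' b by metis
qed

lemma line_mem_D_infinity:
  assumes x: "x \<in> fst t" and l: "l \<in> lb_fibre L x" and nz: "\<psi> l \<noteq> 0 \<or> r \<noteq> 0"
  shows "line_through L l r \<in> D_infinity L \<longleftrightarrow> r = 0"
proof
  assume "line_through L l r \<in> D_infinity L"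
  then obtain l' where "line_through L l r = line_through L l' 0" unfolding D_infinity_def by blast
  thus "r = 0" using mem_line_through[OF x l, of r] unfolding line_through_def[of L l' 0] by auto
next
  assume r: "r = 0"
  have "l \<in> lb_total L" "lb_proj L l = x" using l by (auto simp: lb_fibre_def)
  moreover have "l \<noteq> lb_zero L x" using nz r lb_zero[OF x] by auto
  ultimately show "line_through L l r \<in> D_infinity L" unfolding D_infinity_def r by blast
qed

lemma line_mem_D_zero:
  assumes x: "x \<in> fst t" and l: "l \<in> lb_fibre L x" and nz: "\<psi> l \<noteq> 0 \<or> r \<noteq> 0"
  shows "line_through L l r \<in> D_zero L \<longleftrightarrow> \<psi> l = 0"
proof
  assume "line_through L l r \<in> D_zero L"
  then obtain l0 where l0: "l0 \<in> lb_total L"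
    and e: "line_through L l r = line_through L (lb_zero L (lb_proj L l0)) 1"
    unfolding D_zero_def by blast
  \<comment> \<open>The zero vector is taken over an unknown point, so the base point of this line
    is first computed in a trivialization around that point.\<close>
  obtain t' where t': "t' \<in> lb_trivs L" "lb_proj L l0 \<in> fst t'" using triv_cover[OF l0] .
  interpret T: ruled_chart S L g N c t'
    using surface kaehler curvature hol_bundle metric curvature_L c t'(1) by unfold_locales
  have "x = lb_proj L l0"
    using T.base_point_line[OF t'(2) T.lb_zero(1)[OF t'(2)]] base_point_line[OF x l] e by metis
  hence "(l, r) \<in> line_through L (lb_zero L x) 1" using mem_line_through[OF x l, of r] e by simp
  thus "\<psi> l = 0" unfolding line_through_eq[OF x lb_zero(1)[OF x]] using lb_zero(2)[OF x] by auto
next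
  assume l0: "\<psi> l = 0"
  have "l \<in> lb_total L" "lb_proj L l = x" using l by (auto simp: lb_fibre_def)
  moreover have "line_through L l r = line_through L (lb_zero L x) 1"
    by (rule line_through_cong[OF x l lb_zero(1)[OF x], where b = r]) (use l0 nz lb_zero(2)[OF x] in auto)
  ultimately show "line_through L l r \<in> D_zero L" unfolding D_zero_def by blast
qed

section \<open>Fibre charts around the zero divisor and the infinity divisor\<close>

lemma chart_inv_eqI:
  assumes "inj_on (snd \<kappa>) (fst \<kappa>)" "q \<in> fst \<kappa>" "snd \<kappa> q = y"
  shows "chart_inv \<kappa> y = q"
  using assms unfolding chart_inv_def by (auto simp: inv_into_f_f)

lemma vector_2_eq_iff: "(vector [a, b] :: complex^2) = vector [a', b'] \<longleftrightarrow> a = a' \<and> b = b'"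
  by (auto simp: vec_eq_iff forall_2)

lemma inj_zero_chart: "inj_on (snd (zero_chart L c t)) (fst (zero_chart L c t))"
proof (rule inj_onI)
  fix q q' assume q: "q \<in> fst (zero_chart L c t)" "q' \<in> fst (zero_chart L c t)"
    and e: "snd (zero_chart L c t) q = snd (zero_chart L c t) q'"
  let ?x = "base_point L q"
  have x: "?x \<in> fst c" "?x \<in> fst t" "base_point L q' \<in> fst c" "base_point L q' \<in> fst t"
    using q by (auto simp: zero_chart_def)
  have qb: "q \<in> proj_bundle L" "q' \<in> proj_bundle L" using q by (auto simp: zero_chart_def)
  have e: "snd c ?x = snd c (base_point L q')" "\<psi> (affine_vector q) = \<psi> (affine_vector q')"
    using e by (auto simp: zero_chart_def vector_2_eq_iff)
  have xx: "base_point L q' = ?x" using inj_chart e(1) x unfolding inj_on_def by metis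
  obtain l r where l: "l \<in> lb_fibre L ?x" "q = line_through L l r" "\<psi> l \<noteq> 0 \<or> r \<noteq> 0"
    using proj_bundle_cases[OF qb(1) x(2)] .
  obtain l' r' where l': "l' \<in> lb_fibre L ?x" "q' = line_through L l' r'" "\<psi> l' \<noteq> 0 \<or> r' \<noteq> 0"
    using proj_bundle_cases[OF qb(2) x(4), unfolded xx] .
  have r: "r \<noteq> 0" "r' \<noteq> 0"
    using q line_mem_D_infinity[OF x(2) l(1) l(3)] line_mem_D_infinity[OF x(2) l'(1) l'(3)] l(2) l'(2)
    by (auto simp: zero_chart_def)
  have "\<psi> l / r = \<psi> l' / r'"
    using e(2) affine_vector_line(2)[OF x(2) l(1) r(1)] affine_vector_line(2)[OF x(2) l'(1) r(2)]
      l(2) l'(2) by simp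
  thus "q = q'" unfolding l(2) l'(2)
    by (intro line_through_cong[OF x(2) l(1) l'(1), where b = "r / r'"]) (use r in \<open>auto simp: field_simps\<close>)
qed

lemma inj_infinity_chart: "inj_on (snd (infinity_chart L c t)) (fst (infinity_chart L c t))"
proof (rule inj_onI)
  fix q q' assume q: "q \<in> fst (infinity_chart L c t)" "q' \<in> fst (infinity_chart L c t)"
    and e: "snd (infinity_chart L c t) q = snd (infinity_chart L c t) q'"
  let ?x = "base_point L q" and ?y = "\<lambda>q. THE y. \<exists>l. (l, y) \<in> q \<and> snd t l = 1"
  have x: "?x \<in> fst c" "?x \<in> fst t" "base_point L q' \<in> fst c" "base_point L q' \<in> fst t"
    using q by (auto simp: infinity_chart_def)
  have qb: "q \<in> proj_bundle L" "q' \<in> proj_bundle L" using q by (auto simp: infinity_chart_def)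
  have e: "snd c ?x = snd c (base_point L q')" "?y q = ?y q'"
    using e by (auto simp: infinity_chart_def vector_2_eq_iff)
  have xx: "base_point L q' = ?x" using inj_chart e(1) x unfolding inj_on_def by metis
  obtain l r where l: "l \<in> lb_fibre L ?x" "q = line_through L l r" "\<psi> l \<noteq> 0 \<or> r \<noteq> 0"
    using proj_bundle_cases[OF qb(1) x(2)] .
  obtain l' r' where l': "l' \<in> lb_fibre L ?x" "q' = line_through L l' r'" "\<psi> l' \<noteq> 0 \<or> r' \<noteq> 0"
    using proj_bundle_cases[OF qb(2) x(4), unfolded xx] .
  have r: "\<psi> l \<noteq> 0" "\<psi> l' \<noteq> 0"
    using q line_mem_D_zero[OF x(2) l(1) l(3)] line_mem_D_zero[OF x(2) l'(1) l'(3)] l(2) l'(2)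
    by (auto simp: infinity_chart_def)
  have "r / \<psi> l = r' / \<psi> l'"
    using e(2) infinity_coordinate_line[OF x(2) l(1) r(1), of r]
      infinity_coordinate_line[OF x(2) l'(1) r(2), of r'] l(2) l'(2) by simp
  thus "q = q'" unfolding l(2) l'(2)
    by (intro line_through_cong[OF x(2) l(1) l'(1), where b = "\<psi> l / \<psi> l'"]) (use r in \<open>auto simp: field_simps\<close>)
qed

lemma metric_coeff_pos: "x \<in> fst t \<Longrightarrow> metric_coeff L N t x > 0"
  and norm_fibre: "x \<in> fst t \<Longrightarrow> l \<in> lb_fibre L x \<Longrightarrow> N l = metric_coeff L N t x * (cmod (\<psi> l))\<^sup>2"
  using metric t unfolding hermitian_metric_def by blast+

lemma log_norm_line:
  assumes z: "z \<in> V" and l: "l \<in> lb_fibre L (chart_inv c z)" and "\<psi> l \<noteq> 0" "r \<noteq> 0"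
  shows "log_norm N (line_through L l r) = H z + ln ((cmod (\<psi> l / r))\<^sup>2)"
proof -
  note x = chart_inv_V(2)[OF z]
  note a = affine_vector_line[OF x l assms(4)]
  show ?thesis unfolding log_norm_def norm_fibre[OF x a(1)] a(2) H_def
    using metric_coeff_pos[OF x] assms(3,4) by (subst ln_mult) auto
qed

text \<open>What the zero chart (\<epsilon> = 1) and the infinity chart (\<epsilon> = -1) have in
  common, so that the analysis is done once for both. Points with second coordinate 0 lie on the
  divisor: they belong to the chart, but the formula for the logarithmic norm excludes them.\<close>

definition adapted_chart :: "('l proj_point, complex^2) chart \<Rightarrow> real \<Rightarrow> bool" where
  "adapted_chart \<kappa> \<epsilon> \<longleftrightarrow> \<kappa> \<in> proj_atlas S L \<and> (\<forall>y. y $ 1 \<in> V \<longrightarrow>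
     chart_inv \<kappa> y \<in> fst \<kappa> \<and> snd \<kappa> (chart_inv \<kappa> y) = y \<and>
     base_point L (chart_inv \<kappa> y) = chart_inv c (y $ 1) \<and>
     (y $ 2 \<noteq> 0 \<longrightarrow> chart_inv \<kappa> y \<notin> D_zero L \<union> D_infinity L \<and>
        log_norm N (chart_inv \<kappa> y) = H (y $ 1) + \<epsilon> * ln ((cmod (y $ 2))\<^sup>2)))"

lemma adapted_zero_chart: "adapted_chart (zero_chart L c t) 1"
  unfolding adapted_chart_def
proof (intro conjI allI impI)
  show "zero_chart L c t \<in> proj_atlas S L" using c t by (auto simp: proj_atlas_def)
  fix y :: "complex^2" assume y: "y $ 1 \<in> V"
  let ?\<kappa> = "zero_chart L c t"
  note x = chart_inv_V[OF y]
  obtain l where l: "l \<in> lb_fibre L (chart_inv c (y $ 1))" "\<psi> l = y $ 2" using fibre_vector[OF x(2)] .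
  let ?q = "line_through L l 1"
  have q: "?q \<in> fst ?\<kappa>" "snd ?\<kappa> ?q = y"
    using line_mem_proj_bundle[OF x(2) l(1), of 1] line_mem_D_infinity[OF x(2) l(1), of 1]
      base_point_line[OF x(2) l(1), of 1] affine_vector_line[OF x(2) l(1), of 1] x l
    by (auto simp: zero_chart_def vec_eq_iff forall_2)
  note qi = chart_inv_eqI[OF inj_zero_chart q]
  show "chart_inv ?\<kappa> y \<in> fst ?\<kappa>" "snd ?\<kappa> (chart_inv ?\<kappa> y) = y"
    "base_point L (chart_inv ?\<kappa> y) = chart_inv c (y $ 1)"
    unfolding qi using q base_point_line[OF x(2) l(1)] by auto
  assume y2: "y $ 2 \<noteq> 0"
  show "chart_inv ?\<kappa> y \<notin> D_zero L \<union> D_infinity L"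
    unfolding qi using line_mem_D_infinity[OF x(2) l(1), of 1] line_mem_D_zero[OF x(2) l(1), of 1] l y2 by auto
  show "log_norm N (chart_inv ?\<kappa> y) = H (y $ 1) + 1 * ln ((cmod (y $ 2))\<^sup>2)"
    unfolding qi using log_norm_line[OF y l(1), of 1] l y2 by simp
qed

lemma adapted_infinity_chart: "adapted_chart (infinity_chart L c t) (-1)"
  unfolding adapted_chart_def
proof (intro conjI allI impI)
  show "infinity_chart L c t \<in> proj_atlas S L" using c t by (auto simp: proj_atlas_def)
  fix y :: "complex^2" assume y: "y $ 1 \<in> V"
  let ?\<kappa> = "infinity_chart L c t"
  note x = chart_inv_V[OF y]
  obtain l where l: "l \<in> lb_fibre L (chart_inv c (y $ 1))" "\<psi> l = 1" using fibre_vector[OF x(2)] .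
  let ?q = "line_through L l (y $ 2)"
  have q: "?q \<in> fst ?\<kappa>" "snd ?\<kappa> ?q = y"
    using line_mem_proj_bundle[OF x(2) l(1), of "y $ 2"] line_mem_D_zero[OF x(2) l(1), of "y $ 2"]
      base_point_line[OF x(2) l(1), of "y $ 2"] infinity_coordinate_line[OF x(2) l(1), of "y $ 2"] x l
    by (auto simp: infinity_chart_def vec_eq_iff forall_2)
  note qi = chart_inv_eqI[OF inj_infinity_chart q]
  show "chart_inv ?\<kappa> y \<in> fst ?\<kappa>" "snd ?\<kappa> (chart_inv ?\<kappa> y) = y"
    "base_point L (chart_inv ?\<kappa> y) = chart_inv c (y $ 1)"
    unfolding qi using q base_point_line[OF x(2) l(1)] by auto
  assume y2: "y $ 2 \<noteq> 0"
  show "chart_inv ?\<kappa> y \<notin> D_zero L \<union> D_infinity L"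
    unfolding qi using line_mem_D_infinity[OF x(2) l(1), of "y $ 2"]
      line_mem_D_zero[OF x(2) l(1), of "y $ 2"] l y2 by auto
  \<comment> \<open>The line through \<open>(l, y $ 2)\<close> with \<open>\<psi> l = 1\<close> has
    affine coordinate \<open>1 / y $ 2\<close>; this is the source of the sign -1.\<close>
  have "ln ((cmod (\<psi> l / y $ 2))\<^sup>2) = - ln ((cmod (y $ 2))\<^sup>2)"
    using y2 by (simp add: l norm_divide power_divide ln_div)
  thus "log_norm N (chart_inv ?\<kappa> y) = H (y $ 1) + - 1 * ln ((cmod (y $ 2))\<^sup>2)"
    unfolding qi using log_norm_line[OF y l(1), of "y $ 2"] l y2 by simp
qed

end

section \<open>Metrics satisfying the Calabi ansatz\<close>

text \<open>Substituting s = h + \<epsilon> ln (r^2), the approach r \<rightarrow> 0 to the divisor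
  is s \<rightarrow> -\<infinity> for \<epsilon> = 1 and s \<rightarrow> \<infinity> for \<epsilon>
  = -1.\<close>

lemma tendsto_log_coordinate:
  fixes k :: "real \<Rightarrow> real"
  assumes "((\<lambda>r. k (h + \<epsilon> * ln (r\<^sup>2))) \<longlongrightarrow> l) (at_right 0)"
  shows "\<epsilon> = 1 \<Longrightarrow> (k \<longlongrightarrow> l) at_bot" and "\<epsilon> = -1 \<Longrightarrow> (k \<longlongrightarrow> l) at_top"
proof -
  have l: "h + 1 * ln ((exp ((s - h) / 2))\<^sup>2) = s" "h + -1 * ln ((exp ((h - s) / 2))\<^sup>2) = s" for s
    by (simp_all add: ln_realpow field_simps)
  show "(k \<longlongrightarrow> l) at_bot" if "\<epsilon> = 1"
  proof -
    have "filterlim (\<lambda>s. exp ((s - h) / 2)) (at_right 0) at_bot" by real_asymp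
    from filterlim_compose[OF assms this] show ?thesis unfolding that l .
  qed
  show "(k \<longlongrightarrow> l) at_top" if "\<epsilon> = -1"
  proof -
    have "filterlim (\<lambda>s. exp ((h - s) / 2)) (at_right 0) at_top" by real_asymp
    from filterlim_compose[OF assms this] show ?thesis unfolding that l .
  qed
qed

lemma greater_limit_at_bot:
  fixes f :: "real \<Rightarrow> real"
  assumes D: "\<And>s. (f has_real_derivative f' s) (at s)" "\<And>s. f' s > 0" and l: "(f \<longlongrightarrow> l) at_bot"
  shows "f s > l"
proof -
  have mono: "f r < f r'" if "r < r'" for r r'
    using DERIV_pos_imp_increasing[OF that] D by blast
  have "\<forall>\<^sub>F r in at_bot. f r \<le> f (s - 1)"
    unfolding eventually_at_bot_linorder using mono by (intro exI[of _ "s - 1"]) (metis le_less)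
  hence "l \<le> f (s - 1)" by (rule tendsto_upperbound[OF l]) simp
  thus ?thesis using mono[of "s - 1" s] by simp
qed

context ruled_chart
begin

text \<open>The signs: the curvature of the bundle is minus the Hessian of H and equals -g, so H has
  Hessian g; scalar curvature -2 gives the logarithm of g the Hessian 2 g.\<close>

lemma fibre_coordinates_axioms:
  assumes "\<epsilon>\<^sup>2 = 1"
  shows "fibre_coordinates V (g c) H \<epsilon>"
proof
  have g: "smooth_on (g c) (chart_image c)" "\<And>z. z \<in> chart_image c \<Longrightarrow> g c z > 0"
    using kaehler c unfolding surface_kaehler_def by blast+
  define h where "h = (metric_coeff L N t \<circ> chart_inv c)"
  have h: "smooth_on h V" using metric c t unfolding hermitian_metric_def V_def h_def by blast
  have h_pos: "h z > 0" if "z \<in> V" for z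
    unfolding h_def using metric_coeff_pos chart_inv_V(2)[OF that] by simp
  have H: "H = (\<lambda>z. ln (h z))" by (simp add: H_def h_def fun_eq_iff)
  show "open V" by (rule open_V)
  show "\<epsilon>\<^sup>2 = 1" by fact
  fix z assume z: "z \<in> V"
  hence zc: "z \<in> chart_image c" using V_subset by blast
  show gz: "g c z > 0" by (rule g(2)[OF zc])
  note smH = smooth_on_ln_differentiable[OF h open_V z h_pos]
  show "H differentiable (at z)" "dzbar (\<lambda>z. complex_of_real (H z)) differentiable (at z)"
    unfolding H using smH by auto
  note smg = smooth_on_ln_differentiable[OF g(1) chart_props(2) zc g(2)]
  show "(\<lambda>z. ln (g c z)) differentiable (at z)"
    "dzbar (\<lambda>z. complex_of_real (ln (g c z))) differentiable (at z)"
    using smg by auto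
  have "curvature_coeff L N c t z = - of_real (g c z)"
    using curvature_L c t z unfolding curvature_is_minus_def V_def by blast
  thus "dz (dzbar (\<lambda>z. complex_of_real (H z))) z = of_real (g c z)"
    unfolding curvature_coeff_def H_def by simp
  have "surface_scalar_curvature g c z = -2" using curvature c zc by blast
  thus "dz (dzbar (\<lambda>z. complex_of_real (ln (g c z)))) z = 2 * of_real (g c z)"
    unfolding surface_scalar_curvature_def using gz by (simp add: field_simps)
qed

lemma adapted_chart_image:
  assumes "adapted_chart \<kappa> \<epsilon>" "y $ 1 \<in> V"
  shows "y \<in> chart_image \<kappa>"
  using assms unfolding adapted_chart_def chart_image_def by (metis imageI)

text \<open>The last clause of \<open>calabi_ansatz\<close>, separated so that the potential can be
  named.\<close>

definition calabi_potential :: "(real \<Rightarrow> real) \<Rightarrow> 'l proj_point form11 \<Rightarrow> bool" where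
  "calabi_potential u \<omega> \<longleftrightarrow>
     (\<forall>\<kappa>\<in>proj_atlas S L. \<forall>c\<in>surf_atlas S. \<forall>q\<in>fst \<kappa> - (D_zero L \<union> D_infinity L).
           base_point L q \<in> fst c \<longrightarrow>
           \<omega> \<kappa> (snd \<kappa> q) = pullback_base L g c \<kappa> (snd \<kappa> q)
             + i_del_delbar (\<lambda>\<kappa> y. of_real (u (log_norm N (chart_inv \<kappa> y)))) \<kappa> (snd \<kappa> q))"

text \<open>The pulled back base form contributes the coefficients 1 and 0, the potential u' and
  u''. The formula lives off the divisors, which are reached later by limits.\<close>

lemma calabi_inv_form:
  assumes \<kappa>: "adapted_chart \<kappa> \<epsilon>" and \<epsilon>: "\<epsilon>\<^sup>2 = 1"
    and u: "\<And>s. (u has_real_derivative u' s) (at s)" "\<And>s. (u' has_real_derivative u'' s) (at s)"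
    and \<omega>: "calabi_potential u \<omega>" and y: "y \<in> fibre_coordinates.U V"
  shows "\<omega> \<kappa> y = fibre_coordinates.inv_form (g c) H \<epsilon>
    (1 + u' (fibre_coordinates.s H \<epsilon> y)) (u'' (fibre_coordinates.s H \<epsilon> y)) y"
proof -
  interpret F: fibre_coordinates V "g c" H \<epsilon> by (rule fibre_coordinates_axioms[OF \<epsilon>])
  let ?q = "chart_inv \<kappa> y"
  note y1 = F.U_D(1)[OF y] and y2 = F.U_D(2)[OF y]
  have \<kappa>': "\<kappa> \<in> proj_atlas S L" using \<kappa> by (simp add: adapted_chart_def)
  have q: "?q \<in> fst \<kappa> - (D_zero L \<union> D_infinity L)" "snd \<kappa> ?q = y"
    "base_point L ?q = chart_inv c (y $ 1)"
    using \<kappa> y1 y2 unfolding adapted_chart_def by auto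
  have "base_point L ?q \<in> fst c" unfolding q(3) by (rule chart_inv_V(1)[OF y1])
  hence e: "\<omega> \<kappa> y = pullback_base L g c \<kappa> y
    + i_del_delbar (\<lambda>\<kappa> y. of_real (u (log_norm N (chart_inv \<kappa> y)))) \<kappa> y"
    using \<omega> \<kappa>' c q(1,2) unfolding calabi_potential_def by metis
  have "i_del_delbar (\<lambda>\<kappa> y. of_real (u (log_norm N (chart_inv \<kappa> y)))) \<kappa> y
    = F.inv_form (0 + u' (F.s y)) (u'' (F.s y)) y"
    unfolding i_del_delbar_def
  proof (rule F.hessian[where P = "\<lambda>_. 0" and Q = u, OF y _ _ _ u])
    have 0: "dzbar (\<lambda>z. complex_of_real 0) = (\<lambda>_. 0)" "dz (\<lambda>_. 0) z = 0" for z
      by (auto simp: fun_eq_iff dz_eqI[OF has_derivative_const])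
    show "dzbar (\<lambda>z. complex_of_real 0) differentiable (at z)"
      "dz (dzbar (\<lambda>z. complex_of_real 0)) z = of_real (0 * g c z)" for z
      unfolding 0 by auto
    show "complex_of_real (u (log_norm N (chart_inv \<kappa> y))) = of_real (0 + u (F.s y))"
      if "y \<in> F.U" for y
      using \<kappa> F.U_D[OF that] unfolding adapted_chart_def F.s_def by simp
  qed simp
  moreover have "pullback_base L g c \<kappa> y = F.inv_form 1 0 y"
  proof -
    define qf where "qf = (\<lambda>y. snd c (base_point L (chart_inv \<kappa> y)))"
    have qf: "qf y = y $ 1" if "y \<in> F.U" for y
      using \<kappa> F.U_D(1)[OF that] chart_inv_V(3)[OF F.U_D(1)[OF that]]
      unfolding adapted_chart_def qf_def by simp
    have i: "(\<lambda>w::complex. w) differentiable (at (y $ 1))" by simp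
    have "dz (\<lambda>w. w) (y $ 1) = 1" by (simp add: dz_eqI[OF has_derivative_ident])
    hence "del j (\<lambda>y. y $ 1) y = (if j = 1 then 1 else 0)" for j
      using del_coordinate(1)[OF i, of j] by simp
    hence d: "del j qf y = (if j = 1 then 1 else 0)" for j
      using del_cong_open(1)[OF F.open_U y qf] by simp
    show ?thesis unfolding pullback_base_def Let_def qf_def[symmetric] d qf[OF y]
      by (simp add: F.inv_form_def vec_eq_iff)
  qed
  ultimately show ?thesis unfolding e by (simp add: F.inv_form_add)
qed

lemma kaehler_22_pos:
  assumes "kaehler_metric At \<omega>" "\<kappa> \<in> At" "y \<in> chart_image \<kappa>"
  shows "Re (\<omega> \<kappa> y $ 2 $ 2) > 0"
proof -
  have "\<forall>v. v \<noteq> 0 \<longrightarrow> Re (\<Sum>j\<in>UNIV. \<Sum>k\<in>UNIV. \<omega> \<kappa> y $ j $ k * v $ j * cnj (v $ k)) > 0"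
    using assms unfolding kaehler_metric_def by blast
  moreover have "axis 2 (1 :: complex) \<noteq> (0 :: complex^2)" by (simp add: axis_eq_0_iff)
  ultimately have "Re (\<Sum>j\<in>UNIV. \<Sum>k\<in>UNIV. \<omega> \<kappa> y $ j $ k * (axis 2 1 :: complex^2) $ j
    * cnj ((axis 2 1 :: complex^2) $ k)) > 0" by blast
  thus ?thesis by (simp add: sum_2 axis_def)
qed

text \<open>The fibre entry of the metric is p / |w|^2, so positive definiteness gives the strict
  sign of p at every real argument.\<close>

lemma calabi_positive:
  assumes \<kappa>: "adapted_chart \<kappa> \<epsilon>" and \<epsilon>: "\<epsilon>\<^sup>2 = 1" and z: "z \<in> V"
    and \<omega>: "kaehler_metric (proj_atlas S L) \<omega>"
    and e: "\<And>y. y \<in> fibre_coordinates.U V \<Longrightarrow> \<omega> \<kappa> y = fibre_coordinates.inv_form (g c) H \<epsilon>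
      (x (fibre_coordinates.s H \<epsilon> y)) (p (fibre_coordinates.s H \<epsilon> y)) y"
  shows "p \<sigma> > 0"
proof -
  interpret F: fibre_coordinates V "g c" H \<epsilon> by (rule fibre_coordinates_axioms[OF \<epsilon>])
  obtain y where y: "y \<in> F.U" "F.s y = \<sigma>" using F.s_surj[OF z] by metis
  have "\<kappa> \<in> proj_atlas S L" using \<kappa> by (simp add: adapted_chart_def)
  from kaehler_22_pos[OF \<omega> this adapted_chart_image[OF \<kappa> F.U_D(1)[OF y(1)]]]
  have "p \<sigma> / (cmod (y $ 2))\<^sup>2 > 0" unfolding e[OF y(1)] F.inv_form_22[OF y(1)] y(2) by simp
  thus ?thesis by (simp add: zero_less_divide_iff)
qed

text \<open>Along the fibre coordinate \<open>r > 0\<close> one has \<open>p = r\<^sup>2 \<rho>(r)\<close> where \<open>\<rho> > 0\<close> is the coefficient of the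
  metric in the fibre direction, which is \<open>C\<^sup>1\<close> across the divisor \<open>r = 0\<close>.\<close>

lemma calabi_endpoint:
  assumes \<kappa>: "adapted_chart \<kappa> \<epsilon>" and \<epsilon>: "\<epsilon>\<^sup>2 = 1" and z: "z \<in> V"
    and \<omega>: "kaehler_metric (proj_atlas S L) \<omega>"
    and e: "\<And>y. y \<in> fibre_coordinates.U V \<Longrightarrow> \<omega> \<kappa> y = fibre_coordinates.inv_form (g c) H \<epsilon>
      (x (fibre_coordinates.s H \<epsilon> y)) (p (fibre_coordinates.s H \<epsilon> y)) y"
    and D: "\<And>t. (p has_real_derivative p' t) (at t)"
  shows "((\<lambda>r. p (H z + \<epsilon> * ln (r\<^sup>2))) \<longlongrightarrow> 0) (at_right 0)"
    and "((\<lambda>r. p' (H z + \<epsilon> * ln (r\<^sup>2)) / p (H z + \<epsilon> * ln (r\<^sup>2))) \<longlongrightarrow> \<epsilon>) (at_right 0)"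
proof -
  interpret F: fibre_coordinates V "g c" H \<epsilon> by (rule fibre_coordinates_axioms[OF \<epsilon>])
  have \<kappa>': "\<kappa> \<in> proj_atlas S L" using \<kappa> by (simp add: adapted_chart_def)
  \<comment> \<open>Smoothness of the metric is available only through its real 2-form; on the fibre
    directions that form is twice the fibre entry.\<close>
  define \<phi> where "\<phi> = (\<lambda>y. real_form \<omega> \<kappa> y (axis 2 1) (axis 2 \<i>))"
  have \<phi>: "\<phi> y = 2 * Re (\<omega> \<kappa> y $ 2 $ 2)" for y
    by (simp add: \<phi>_def real_form_def sum_2 axis_def algebra_simps)
  have "smooth_on \<phi> (chart_image \<kappa>)"
    using \<omega> \<kappa>' unfolding kaehler_metric_def closed_two_form_def smooth_two_form_def \<phi>_def by blast
  hence C: "Ck_on (Suc 0) \<phi> (chart_image \<kappa>)" unfolding smooth_on_def by blast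
  \<comment> \<open>The real ray in the fibre over \<open>z\<close>, which meets the divisor at r =
    0.\<close>
  define \<gamma> :: "real \<Rightarrow> complex^2" where "\<gamma> = (\<lambda>r. axis 1 z + r *\<^sub>R axis 2 1)"
  have \<gamma>1: "\<gamma> r $ 1 = z" and \<gamma>2: "\<gamma> r $ 2 = of_real r" for r
    by (simp_all add: \<gamma>_def axis_def of_real_def)
  have \<gamma>i: "\<gamma> r \<in> chart_image \<kappa>" for r
    by (rule adapted_chart_image[OF \<kappa>]) (simp add: \<gamma>1 z)
  have \<gamma>d: "(\<gamma> has_derivative (\<lambda>h. h *\<^sub>R axis 2 1)) (at r)" for r
    unfolding \<gamma>_def by (auto intro!: derivative_eq_intros)
  define \<rho> where "\<rho> = (\<lambda>r. \<phi> (\<gamma> r) / 2)"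
  define \<rho>' where "\<rho>' = (\<lambda>r. frechet_derivative \<phi> (at (\<gamma> r)) (axis 2 1) / 2)"
  have \<rho>d: "(\<rho> has_real_derivative \<rho>' r) (at r)" for r
  proof -
    have "(\<phi> has_derivative frechet_derivative \<phi> (at (\<gamma> r))) (at (\<gamma> r))"
      using C \<gamma>i by (simp add: frechet_derivative_works[symmetric])
    note d = has_derivative_compose[OF \<gamma>d this]
    have "linear (frechet_derivative \<phi> (at (\<gamma> r)))"
      using C \<gamma>i linear_frechet_derivative by auto
    hence "(\<lambda>h. frechet_derivative \<phi> (at (\<gamma> r)) (h *\<^sub>R axis 2 1)) = (\<lambda>h. 2 * \<rho>' r * h)"
      by (simp add: linear_cmul \<rho>'_def fun_eq_iff)
    hence "((\<lambda>r. \<phi> (\<gamma> r)) has_real_derivative 2 * \<rho>' r) (at r)"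
      using d unfolding has_field_derivative_def by simp
    thus ?thesis unfolding \<rho>_def using DERIV_cdivide[of _ "2 * \<rho>' r" r UNIV 2] by simp
  qed
  have "continuous_on (chart_image \<kappa>) (\<lambda>y. frechet_derivative \<phi> (at y) (axis 2 1))"
    using C by simp
  moreover have "continuous_on UNIV \<gamma>"
    using \<gamma>d by (intro continuous_at_imp_continuous_on ballI has_derivative_continuous)
  ultimately have "continuous_on UNIV (\<lambda>r. frechet_derivative \<phi> (at (\<gamma> r)) (axis 2 1))"
    by (rule continuous_on_compose2) (use \<gamma>i in auto)
  hence "continuous_on UNIV \<rho>'" unfolding \<rho>'_def by (intro continuous_on_divide continuous_on_const) auto
  hence "isCont \<rho>' 0" by (simp add: continuous_on_eq_continuous_at)
  hence \<rho>'l: "(\<rho>' \<longlongrightarrow> \<rho>' 0) (at_right 0)"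
    unfolding isCont_def by (rule tendsto_within_subset) simp
  have \<rho>l: "(\<rho> \<longlongrightarrow> \<rho> 0) (at_right 0)"
    using DERIV_isCont[OF \<rho>d[of 0]] unfolding isCont_def by (rule tendsto_within_subset) simp
  have \<rho>0: "\<rho> 0 > 0" unfolding \<rho>_def \<phi> using kaehler_22_pos[OF \<omega> \<kappa>' \<gamma>i] by simp
  define \<sigma> where "\<sigma> = (\<lambda>r. H z + \<epsilon> * ln (r\<^sup>2))"
  have p: "p (\<sigma> r) = r\<^sup>2 * \<rho> r" if r: "r > 0" for r
  proof -
    have "\<gamma> r \<in> F.U" "F.s (\<gamma> r) = \<sigma> r" using r z by (auto simp: F.U_def F.s_def \<gamma>1 \<gamma>2 \<sigma>_def)
    thus ?thesis using r unfolding \<rho>_def \<phi> by (simp add: e F.inv_form_22 \<gamma>2)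
  qed
  \<comment> \<open>Differentiate p(\<sigma>(r)) = r^2 \<rho>(r) and divide by \<sigma>'(r) = 2
    \<epsilon> / r, using \<epsilon>^2 = 1.\<close>
  have p': "p' (\<sigma> r) = \<epsilon> * (r\<^sup>2 * \<rho> r + r^3 * \<rho>' r / 2)" if r: "r > 0" for r
  proof -
    have "(\<sigma> has_real_derivative \<epsilon> * (2 / r)) (at r)" unfolding \<sigma>_def
      using r by (auto intro!: derivative_eq_intros simp: field_simps power2_eq_square)
    from DERIV_chain2[OF D this]
    have 1: "((\<lambda>r. p (\<sigma> r)) has_real_derivative p' (\<sigma> r) * (\<epsilon> * (2 / r))) (at r)" .
    have "((\<lambda>r. r\<^sup>2 * \<rho> r) has_real_derivative 2 * r * \<rho> r + r\<^sup>2 * \<rho>' r) (at r)"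
      by (auto intro!: derivative_eq_intros \<rho>d)
    hence 2: "((\<lambda>r. p (\<sigma> r)) has_real_derivative 2 * r * \<rho> r + r\<^sup>2 * \<rho>' r) (at r)"
      by (rule has_field_derivative_transform_within_open[where S = "{0<..}"]) (use r p in auto)
    have "p' (\<sigma> r) * (\<epsilon> * (2 / r)) = 2 * r * \<rho> r + r\<^sup>2 * \<rho>' r" by (rule DERIV_unique[OF 1 2])
    hence "\<epsilon> * r * (p' (\<sigma> r) * (\<epsilon> * (2 / r))) / 2 = \<epsilon> * r * (2 * r * \<rho> r + r\<^sup>2 * \<rho>' r) / 2" by simp
    moreover have "\<epsilon> * r * (p' (\<sigma> r) * (\<epsilon> * (2 / r))) / 2 = \<epsilon>\<^sup>2 * p' (\<sigma> r)"
      using r by (simp add: power2_eq_square)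
    ultimately show ?thesis unfolding \<epsilon> by (simp add: power2_eq_square power3_eq_cube algebra_simps)
  qed
  have r0: "((\<lambda>r::real. r) \<longlongrightarrow> 0) (at_right 0)" by (rule tendsto_ident_at)
  have ev: "\<forall>\<^sub>F r::real in at_right 0. r > 0" by (simp add: eventually_at_right_less)
  have "((\<lambda>r. r\<^sup>2 * \<rho> r) \<longlongrightarrow> 0\<^sup>2 * \<rho> 0) (at_right 0)" by (intro tendsto_intros r0 \<rho>l)
  moreover have "\<forall>\<^sub>F r in at_right 0. r\<^sup>2 * \<rho> r = p (\<sigma> r)" using ev by eventually_elim (simp add: p)
  ultimately have "((\<lambda>r. p (\<sigma> r)) \<longlongrightarrow> 0\<^sup>2 * \<rho> 0) (at_right 0)" by (rule Lim_transform_eventually)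
  thus "((\<lambda>r. p (H z + \<epsilon> * ln (r\<^sup>2))) \<longlongrightarrow> 0) (at_right 0)" by (simp add: \<sigma>_def)
  \<comment> \<open>The quotient p'/p differs from \<epsilon> by a term that vanishes with r,
    because \<rho>' is continuous at 0 and \<rho>(0) > 0.\<close>
  have "((\<lambda>r. \<epsilon> * (1 + r * \<rho>' r / (2 * \<rho> r))) \<longlongrightarrow> \<epsilon> * (1 + 0 * \<rho>' 0 / (2 * \<rho> 0))) (at_right 0)"
    by (intro tendsto_intros r0 \<rho>l \<rho>'l) (use \<rho>0 in simp)
  moreover have "\<forall>\<^sub>F r in at_right 0. \<epsilon> * (1 + r * \<rho>' r / (2 * \<rho> r)) = p' (\<sigma> r) / p (\<sigma> r)"
    using ev order_tendstoD(1)[OF \<rho>l \<rho>0]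
    by eventually_elim (simp add: p p' field_simps power2_eq_square power3_eq_cube)
  ultimately have "((\<lambda>r. p' (\<sigma> r) / p (\<sigma> r)) \<longlongrightarrow> \<epsilon> * (1 + 0 * \<rho>' 0 / (2 * \<rho> 0))) (at_right 0)"
    by (rule Lim_transform_eventually)
  thus "((\<lambda>r. p' (H z + \<epsilon> * ln (r\<^sup>2)) / p (H z + \<epsilon> * ln (r\<^sup>2))) \<longlongrightarrow> \<epsilon>) (at_right 0)"
    by (simp add: \<sigma>_def)
qed

end

section \<open>The coupled equations for a pair of potentials\<close>

lemma (in ruled_chart) calabi_pair_profile:
  assumes z: "z \<in> V"
    and ce: "coupled_extremal (proj_atlas S L) \<omega> \<omega>'"
    and u: "smooth_on u UNIV" "(deriv u \<longlongrightarrow> 0) at_bot" "(deriv u \<longlongrightarrow> a) at_top" "calabi_potential u \<omega>"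
    and v: "smooth_on v UNIV" "(deriv v \<longlongrightarrow> 0) at_bot" "(deriv v \<longlongrightarrow> b) at_top" "calabi_potential v \<omega>'"
    and a: "a > 0"
  obtains A B C where "C * ((1 + b)\<^sup>2 - 1) = (1 + a)\<^sup>2 - 1"
    and "(1 + a) + (1 + a) * (1 + b) - 4 + A * ((1 + a)\<^sup>2 - 1) / 2 + B * ((1 + a)^3 - 1) / 3 = 0"
    and "4 * ((1 + a) - 1) - ((1 + a)\<^sup>2 - 1) - A * (((1 + a)^3 - 1) / 6 - ((1 + a) - 1) / 2)
      - B * (((1 + a)^4 - 1) / 12 - ((1 + a) - 1) / 3) - C * ((1 + b)^3 - 1) / 3 = 0"
    and "\<And>\<xi> \<eta>. 1 < \<xi> \<Longrightarrow> \<xi> < 1 + a \<Longrightarrow> \<eta> > 0 \<Longrightarrow> C * (\<eta>\<^sup>2 - 1) = \<xi>\<^sup>2 - 1 \<Longrightarrow>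
      4 * (\<xi> - 1) - (\<xi>\<^sup>2 - 1) - A * ((\<xi>^3 - 1) / 6 - (\<xi> - 1) / 2)
      - B * ((\<xi>^4 - 1) / 12 - (\<xi> - 1) / 3) - C * (\<eta>^3 - 1) / 3 > 0"
proof -
  let ?\<kappa> = "zero_chart L c t" and ?\<kappa>' = "infinity_chart L c t"
  note \<kappa> = adapted_zero_chart and \<kappa>' = adapted_infinity_chart
  have \<epsilon>: "(1::real)\<^sup>2 = 1" "(-1::real)\<^sup>2 = 1" by simp_all
  interpret F: fibre_coordinates V "g c" H 1 by (rule fibre_coordinates_axioms[OF \<epsilon>(1)])
  interpret F': fibre_coordinates V "g c" H "-1" by (rule fibre_coordinates_axioms[OF \<epsilon>(2)])
  have At: "?\<kappa> \<in> proj_atlas S L" using \<kappa> by (simp add: adapted_chart_def)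
  have K: "kaehler_metric (proj_atlas S L) \<omega>" "kaehler_metric (proj_atlas S L) \<omega>'"
    using ce unfolding coupled_extremal_def by blast+

  define x where "x = (\<lambda>s. 1 + deriv u s)"
  define p where "p = deriv (deriv u)"
  define p' where "p' = deriv p"
  define y where "y = (\<lambda>s. 1 + deriv v s)"
  define q where "q = deriv (deriv v)"
  define q' where "q' = deriv q"
  note u' = smooth_on_UNIV_deriv[OF u(1)] note u'' = smooth_on_UNIV_deriv[OF u'(2), folded p_def]
  note u''' = smooth_on_UNIV_deriv[OF u''(2), folded p'_def]
  note v' = smooth_on_UNIV_deriv[OF v(1)] note v'' = smooth_on_UNIV_deriv[OF v'(2), folded q_def]
  note v''' = smooth_on_UNIV_deriv[OF v''(2), folded q'_def]
  have dx: "(x has_real_derivative p s) (at s)" and dy: "(y has_real_derivative q s) (at s)" for s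
    unfolding x_def y_def using DERIV_add[OF DERIV_const u''(1)] DERIV_add[OF DERIV_const v''(1)] by simp_all

  have \<omega>: "\<omega> ?\<kappa> w = F.inv_form (x (F.s w)) (p (F.s w)) w" if "w \<in> F.U" for w
    using calabi_inv_form[OF \<kappa> \<epsilon>(1) u'(1) u''(1) u(4) that] by (simp add: x_def)
  have \<omega>_inf: "\<omega> ?\<kappa>' w = F'.inv_form (x (F'.s w)) (p (F'.s w)) w" if "w \<in> F'.U" for w
    using calabi_inv_form[OF \<kappa>' \<epsilon>(2) u'(1) u''(1) u(4) that] by (simp add: x_def)
  have \<omega>': "\<omega>' ?\<kappa> w = F.inv_form (y (F.s w)) (q (F.s w)) w" if "w \<in> F.U" for w
    using calabi_inv_form[OF \<kappa> \<epsilon>(1) v'(1) v''(1) v(4) that] by (simp add: y_def)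

  have p: "p s > 0" for s by (rule calabi_positive[OF \<kappa> \<epsilon>(1) z K(1) \<omega>])
  have q: "q s > 0" for s by (rule calabi_positive[OF \<kappa> \<epsilon>(1) z K(2) \<omega>'])
  have x: "x s > 0" for s
    using greater_limit_at_bot[OF u''(1) p u(2), of s] by (simp add: x_def)
  have y: "y s > 0" for s
    using greater_limit_at_bot[OF v''(1) q v(2), of s] by (simp add: y_def)
  have nz: "x s \<noteq> 0" "p s \<noteq> 0" "y s \<noteq> 0" "q s \<noteq> 0" for s
    using x[of s] p[of s] y[of s] q[of s] by auto

  have xlim: "(x \<longlongrightarrow> 1 + 0) at_bot" "(x \<longlongrightarrow> 1 + a) at_top"
    unfolding x_def by (intro tendsto_intros u)+
  have ylim: "(y \<longlongrightarrow> 1 + 0) at_bot" "(y \<longlongrightarrow> 1 + b) at_top"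
    unfolding y_def by (intro tendsto_intros v)+
  note zero_end = calabi_endpoint[OF \<kappa> \<epsilon>(1) z K(1) \<omega> u'''(1)]
  note infinity_end = calabi_endpoint[OF \<kappa>' \<epsilon>(2) z K(1) \<omega>_inf u'''(1)]
  have plim: "(p \<longlongrightarrow> 0) at_bot" "(p \<longlongrightarrow> 0) at_top"
    using tendsto_log_coordinate(1)[OF zero_end(1)] tendsto_log_coordinate(2)[OF infinity_end(1)] by auto
  have p'lim: "((\<lambda>s. p' s / p s) \<longlongrightarrow> 1) at_bot" "((\<lambda>s. p' s / p s) \<longlongrightarrow> -1) at_top"
    using tendsto_log_coordinate(1)[OF zero_end(2)] tendsto_log_coordinate(2)[OF infinity_end(2)] by auto

  define G where "G = (\<lambda>s. p s / x s + p' s / p s)"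
  define J where "J = (\<lambda>s. q s / y s + q' s / q s)"
  have td: "times_differentiable k p" "times_differentiable k p'" "times_differentiable k q"
    "times_differentiable k q'" "times_differentiable k x" "times_differentiable k y" for k
    unfolding x_def y_def
    by (intro times_differentiable_intros smooth_on_UNIV_times_differentiable u' u'' u''' v' v'' v''')+
  \<comment> \<open>Three derivatives of \<open>G\<close>: the function \<open>E\<close> below
    contains \<open>G'\<close>, and holomorphy of its gradient involves two derivatives of
    \<open>E\<close>.\<close>
  have "times_differentiable (Suc (Suc (Suc 0))) G" unfolding G_def
    by (intro times_differentiable_intros td nz)
  then obtain G' where G': "\<And>s. (G has_real_derivative G' s) (at s)" "times_differentiable (Suc (Suc 0)) G'"
    using times_differentiable.simps(2) by blast
  have "times_differentiable (Suc 0) J" unfolding J_def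
    by (intro times_differentiable_intros td nz)
  then obtain J' where J': "\<And>s. (J has_real_derivative J' s) (at s)" by auto

  have Ric: "Ric \<omega> ?\<kappa> w = F.inv_form (- (2 + G (F.s w))) (- G' (F.s w)) w" if "w \<in> F.U" for w
    using F.Ric_inv_form[where \<omega> = \<omega> and \<kappa> = ?\<kappa>, OF that x p dx u'''(1) G'(1)[unfolded G_def] \<omega>]
    by (simp add: G_def)
  have Ric': "Ric \<omega>' ?\<kappa> w = F.inv_form (- (2 + J (F.s w))) (- J' (F.s w)) w" if "w \<in> F.U" for w
    using F.Ric_inv_form[where \<omega> = \<omega>' and \<kappa> = ?\<kappa>, OF that y q dy v'''(1) J'(1)[unfolded J_def] \<omega>']
    by (simp add: J_def)
  have GJ: "G s = J s" for s
  proof -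
    obtain w where w: "w \<in> F.U" "F.s w = s" using F.s_surj[OF z] by metis
    have "Ric \<omega> ?\<kappa> w = Ric \<omega>' ?\<kappa> w"
      using ce At adapted_chart_image[OF \<kappa> F.U_D(1)[OF w(1)]] unfolding coupled_extremal_def by blast
    from F.inv_form_inject(1)[OF w(1) this[unfolded Ric[OF w(1)] Ric'[OF w(1)]]] w(2)
    show ?thesis by simp
  qed
  \<comment> \<open>\<open>G\<close> and \<open>J\<close> are the logarithmic derivatives of x p and
    y q. Their equality makes R constant, and \<open>exp (R 0)\<close> is the ratio c of the
    overview.\<close>
  define R where "R = (\<lambda>s. ln (x s) + ln (p s) - (ln (y s) + ln (q s)))"
  have "(R has_real_derivative 0) (at s)" for s
  proof -
    have "(R has_real_derivative G s - J s) (at s)"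
      unfolding R_def G_def J_def using x[of s] p[of s] y[of s] q[of s]
      by (auto intro!: derivative_eq_intros dx dy u'''(1) v'''(1))
    thus ?thesis using GJ by simp
  qed
  hence R: "R s = R 0" for s using DERIV_isconst_all by blast
  define k where "k = exp (R 0)"
  have ratio: "x s * p s = k * (y s * q s)" for s
  proof -
    have "ln (x s * p s) = R 0 + ln (y s * q s)"
      using R[of s] x[of s] p[of s] y[of s] q[of s] by (simp add: R_def ln_mult)
    hence "exp (ln (x s * p s)) = exp (R 0) * exp (ln (y s * q s))" by (simp add: exp_add)
    thus ?thesis using x[of s] p[of s] y[of s] q[of s] by (simp add: k_def)
  qed

  define f where "f = (\<lambda>\<kappa> w. scalar_curvature \<omega> \<kappa> w - Lambda \<omega> (\<lambda>\<kappa> y. \<omega> \<kappa> y + \<omega>' \<kappa> y) \<kappa> w)"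
  define E where "E = (\<lambda>s. ((- (2 + G s)) / x s + (- G' s) / p s) - ((x s + y s) / x s + (p s + q s) / p s))"
  have f: "f ?\<kappa> w = of_real (E (F.s w))" if w: "w \<in> F.U" for w
  proof -
    have "scalar_curvature \<omega> ?\<kappa> w = of_real ((- (2 + G (F.s w))) / x (F.s w) + (- G' (F.s w)) / p (F.s w))"
      unfolding scalar_curvature_def
      by (rule F.Lambda_inv_form[where \<omega> = \<omega> and \<kappa> = ?\<kappa> and \<alpha> = "Ric \<omega>", OF w x p \<omega>[OF w] Ric[OF w]])
    moreover have "Lambda \<omega> (\<lambda>\<kappa> y. \<omega> \<kappa> y + \<omega>' \<kappa> y) ?\<kappa> w
      = of_real ((x (F.s w) + y (F.s w)) / x (F.s w) + (p (F.s w) + q (F.s w)) / p (F.s w))"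
      by (rule F.Lambda_inv_form[where \<omega> = \<omega> and \<kappa> = ?\<kappa>, OF w x p \<omega>[OF w]]) (simp add: \<omega>[OF w] \<omega>'[OF w] F.inv_form_add)
    ultimately show ?thesis by (simp add: f_def E_def)
  qed
  have "times_differentiable (Suc (Suc 0)) (\<lambda>s. 0 - (2 + G s))" "times_differentiable (Suc (Suc 0)) (\<lambda>s. 0 - G' s)"
    unfolding G_def by (intro times_differentiable_intros td nz G'(2))+
  hence "times_differentiable (Suc (Suc 0)) E" unfolding E_def
    by (intro times_differentiable_intros td nz) auto
  then obtain E' where E': "\<And>s. (E has_real_derivative E' s) (at s)" "times_differentiable (Suc 0) E'"
    using times_differentiable.simps(2) by blast
  \<comment> \<open>\<open>1 * E' s / p s\<close> is the coefficient of the Euler field in the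
    gradient; the 1 is \<epsilon> in the zero chart. Once it is a constant B,
    \<open>E' = B * p = B * x'\<close> makes E affine in x.\<close>
  have "times_differentiable (Suc 0) (\<lambda>s. 1 * E' s / p s)"
    by (intro times_differentiable_intros td nz E')
  then obtain B' where B': "\<And>s. ((\<lambda>s. 1 * E' s / p s) has_real_derivative B' s) (at s)" by auto
  have "B' s = 0" for s
  proof -
    obtain w where w: "w \<in> F.U" "F.s w = s" using F.s_surj[OF z] by metis
    have "delbar 2 (\<lambda>y. gradient10 \<omega> f ?\<kappa> y $ 2) w = 0"
      using ce At adapted_chart_image[OF \<kappa> F.U_D(1)[OF w(1)]]
      unfolding coupled_extremal_def Let_def f_def by blast
    thus ?thesis
      using F.holomorphic_Euler_multiple[where v = "\<lambda>y. gradient10 \<omega> f ?\<kappa> y $ 2" and F = "\<lambda>s. 1 * E' s / p s",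
          OF w(1) B' F.gradient10_inv_form[where \<omega> = \<omega> and \<kappa> = ?\<kappa> and f = f, OF _ x p \<omega> E'(1) f]] w(2) by simp
  qed
  hence "1 * E' s / p s = 1 * E' 0 / p 0" for s
    using DERIV_isconst_all[of "\<lambda>s. 1 * E' s / p s" s 0] B' by metis
  then obtain B where B: "\<And>s. 1 * E' s / p s = B" by metis
  have "((\<lambda>s. E s - B * x s) has_real_derivative 0) (at s)" for s
  proof -
    have "((\<lambda>s. E s - B * x s) has_real_derivative E' s - B * p s) (at s)"
      by (intro DERIV_diff DERIV_cmult E' dx)
    moreover have "E' s - B * p s = 0" using B[of s] p[of s] by (simp add: field_simps)
    ultimately show ?thesis by metis
  qed
  hence "E s - B * x s = E 0 - B * x 0" for s
    using DERIV_isconst_all[of "\<lambda>s. E s - B * x s" s 0] by metis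
  then obtain A where A: "\<And>s. E s - B * x s = A" by metis
  \<comment> \<open>The shift by 2 absorbs the trace of \<omega> with respect to itself, so that
    only the trace of the second metric remains on the left.\<close>
  have ode: "(- 2 - (p s / x s + p' s / p s)) / x s - G' s / p s - y s / x s - q s / p s
      = (A + 2) + B * x s" for s
  proof -
    have "(x s + y s) / x s = 1 + y s / x s" "(p s + q s) / p s = 1 + q s / p s"
      using nz[of s] by (simp_all add: field_simps)
    moreover have "- (2 + G s) / x s = (- 2 - G s) / x s" by simp
    ultimately have "E s = (- 2 - G s) / x s - G' s / p s - (2 + y s / x s + q s / p s)"
      unfolding E_def by simp
    thus ?thesis using A[of s] unfolding G_def by linarith
  qed
  have m: "1 + a > 1" using a by simp
  note eqs = coupled_profile_equations[OF m dx u'''(1) dy G'(1)[unfolded G_def] x p y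
    xlim(1)[unfolded add_0_right] xlim(2) ylim(1)[unfolded add_0_right] ylim(2) plim p'lim ratio ode]
  show ?thesis by (rule that[OF eqs])
qed

theorem corollary1p5:
  fixes S :: "'a surface" and L :: "('a, 'l) line_bundle"
    and g :: "'a surface_metric" and N :: "'l \<Rightarrow> real"
  assumes "compact_riemann_surface S" and "has_genus S 2"
    and "surface_kaehler S g"
    and "\<forall>c\<in>surf_atlas S. \<forall>z\<in>chart_image c. surface_scalar_curvature g c z = -2"
    and "holomorphic_line_bundle S L" and "has_degree S L (-1)"
    and "hermitian_metric S L N" and "curvature_is_minus S L N g"
  shows "\<forall>a>0. \<exists>K>0. \<forall>b>K. \<not> (\<exists>\<omega> \<omega>'.
     real_form \<omega> \<in> Omega_class S L a \<and> real_form \<omega>' \<in> Omega_class S L b \<and>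
     coupled_extremal (proj_atlas S L) \<omega> \<omega>' \<and>
     calabi_ansatz S L N g a \<omega> \<and> calabi_ansatz S L N g b \<omega>')"
proof (intro allI impI)
  fix a :: real assume a: "a > 0"
  obtain x0 where x0: "x0 \<in> surf_points S"
    using assms(1) unfolding compact_riemann_surface_def by blast
  have "(\<Union>c\<in>surf_atlas S. fst c) = surf_points S"
    using assms(1) unfolding compact_riemann_surface_def by (elim conjE)
  then obtain c where cS: "c \<in> surf_atlas S" "x0 \<in> fst c" using x0 by blast
  have "(\<Union>t\<in>lb_trivs L. fst t) = surf_points S"
    using assms(5) unfolding holomorphic_line_bundle_def case_prod_unfold by (elim conjE)
  \<comment> \<open>Chart and trivialization are chosen around the same point, so \<open>V\<close>
    is not empty.\<close>
  then obtain t where tL: "t \<in> lb_trivs L" "x0 \<in> fst t" using x0 by blast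
  interpret ruled_chart S L g N c t using assms cS(1) tL(1) by unfold_locales
  have z: "snd c x0 \<in> V" using cS(2) tL(2) by (auto simp: V_def overlap_def)
  have "1 + a > 1" using a by simp
  from large_n_no_positive_profile[OF this] obtain M where "M > 1"
    and M: "\<forall>n>M. \<forall>A B c. c * (n\<^sup>2 - 1) = (1 + a)\<^sup>2 - 1 \<longrightarrow>
    (1 + a) + (1 + a) * n - 4 + A * ((1 + a)\<^sup>2 - 1) / 2 + B * ((1 + a)^3 - 1) / 3 = 0 \<longrightarrow>
    4 * ((1 + a) - 1) - ((1 + a)\<^sup>2 - 1) - A * (((1 + a)^3 - 1) / 6 - ((1 + a) - 1) / 2)
      - B * (((1 + a)^4 - 1) / 12 - ((1 + a) - 1) / 3) - c * (n^3 - 1) / 3 = 0 \<longrightarrow>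
    (\<exists>x y. 1 < x \<and> x < 1 + a \<and> y > 0 \<and> c * (y\<^sup>2 - 1) = x\<^sup>2 - 1 \<and>
      4 * (x - 1) - (x\<^sup>2 - 1) - A * ((x^3 - 1) / 6 - (x - 1) / 2)
      - B * ((x^4 - 1) / 12 - (x - 1) / 3) - c * (y^3 - 1) / 3 < 0)"
    by blast
  show "\<exists>K>0. \<forall>b>K. \<not> (\<exists>\<omega> \<omega>'.
     real_form \<omega> \<in> Omega_class S L a \<and> real_form \<omega>' \<in> Omega_class S L b \<and>
     coupled_extremal (proj_atlas S L) \<omega> \<omega>' \<and>
     calabi_ansatz S L N g a \<omega> \<and> calabi_ansatz S L N g b \<omega>')"
  \<comment> \<open>The threshold concerns n = 1 + b, which exceeds \<open>M\<close> as soon as b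
    does.\<close>
  proof (intro exI[of _ M] conjI allI impI notI)
    show "M > 0" using \<open>M > 1\<close> by simp
    fix b :: real assume b: "b > M"
    assume "\<exists>\<omega> \<omega>'. real_form \<omega> \<in> Omega_class S L a \<and> real_form \<omega>' \<in> Omega_class S L b \<and>
     coupled_extremal (proj_atlas S L) \<omega> \<omega>' \<and>
     calabi_ansatz S L N g a \<omega> \<and> calabi_ansatz S L N g b \<omega>'"
    then obtain \<omega> \<omega>' where ce: "coupled_extremal (proj_atlas S L) \<omega> \<omega>'"
      and ca: "calabi_ansatz S L N g a \<omega>" "calabi_ansatz S L N g b \<omega>'" by (elim exE conjE)
    obtain u where u: "smooth_on u UNIV" "(deriv u \<longlongrightarrow> 0) at_bot" "(deriv u \<longlongrightarrow> a) at_top"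
      "calabi_potential u \<omega>"
      using ca(1) unfolding calabi_ansatz_def calabi_potential_def by (elim exE conjE)
    obtain v where v: "smooth_on v UNIV" "(deriv v \<longlongrightarrow> 0) at_bot" "(deriv v \<longlongrightarrow> b) at_top"
      "calabi_potential v \<omega>'"
      using ca(2) unfolding calabi_ansatz_def calabi_potential_def by (elim exE conjE)
    obtain A B k where e: "k * ((1 + b)\<^sup>2 - 1) = (1 + a)\<^sup>2 - 1"
      "(1 + a) + (1 + a) * (1 + b) - 4 + A * ((1 + a)\<^sup>2 - 1) / 2 + B * ((1 + a)^3 - 1) / 3 = 0"
      "4 * ((1 + a) - 1) - ((1 + a)\<^sup>2 - 1) - A * (((1 + a)^3 - 1) / 6 - ((1 + a) - 1) / 2)
        - B * (((1 + a)^4 - 1) / 12 - ((1 + a) - 1) / 3) - k * ((1 + b)^3 - 1) / 3 = 0"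
      and pos: "\<And>\<xi> \<eta>. 1 < \<xi> \<Longrightarrow> \<xi> < 1 + a \<Longrightarrow> \<eta> > 0 \<Longrightarrow> k * (\<eta>\<^sup>2 - 1) = \<xi>\<^sup>2 - 1 \<Longrightarrow>
        4 * (\<xi> - 1) - (\<xi>\<^sup>2 - 1) - A * ((\<xi>^3 - 1) / 6 - (\<xi> - 1) / 2)
        - B * ((\<xi>^4 - 1) / 12 - (\<xi> - 1) / 3) - k * (\<eta>^3 - 1) / 3 > 0"
      using calabi_pair_profile[OF z ce u v a] by metis
    have "1 + b > M" using b by simp
    with M e obtain x y where "1 < x" "x < 1 + a" "y > 0" "k * (y\<^sup>2 - 1) = x\<^sup>2 - 1"
      "4 * (x - 1) - (x\<^sup>2 - 1) - A * ((x^3 - 1) / 6 - (x - 1) / 2)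
      - B * ((x^4 - 1) / 12 - (x - 1) / 3) - k * (y^3 - 1) / 3 < 0" by blast
    thus False using pos[of x y] by simp
  qed
qed

end
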